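(* Let $(M,\eta,\omega)$ be a closed conformal symplectic manifold of dimension $2n$ and $H:M\to\mathbb{R}$ a Hamiltonian with flow $(\varphi_t)$. The sets $\mathcal{C}_+$ and $\mathcal{C}_-$ coincide up to a set of zero volume. Moreover, for every embedded leaf $\Sigma$ of $\mathcal{F}$ included in $\{H\neq 0\}$ such that the inclusion map $\Sigma\hookrightarrow\{H\neq 0\}$ is proper, up to a set of zero $(2n-1)$-dimensional volume in $\Sigma$, $\mathcal{C}_+\cap\Sigma$ coincides with $\mathcal{C}_-\cap\Sigma$.
   Context: A conformal symplectic manifold $(M,\eta,\omega)$ is a smooth manifold $M$ of even dimension $2n$ with a closed 1-form $\eta$ (the Lee form) and a non-degenerate 2-form $\omega$ such that $\mathrm{d}_\eta\omega=0$, where $\mathrm{d}_\eta\alpha:=\mathrm{d}\alpha-\eta\wedge\alpha$. Given a smooth $H:M\to\mathbb{R}$ (the Hamiltonian), its Hamiltonian vector field $X$ is defined by $\iota_X\omega=\mathrm{d}_\eta H=\mathrm{d}H-H\eta$, and $(\varphi_t)$ denotes its flow. The winding is $r_t(x):=\int_0^t\eta(X(\varphi_s(x)))\,\mathrm{d}s$ for $t\in\mathbb{R}$. $\mathcal{C}_+:=\{x\in M: \liminf_{t\to+\infty}|r_t(x)|<+\infty\}$ (positively conservative points) and $\mathcal{C}_-:=\{x\in M: \liminf_{t\to-\infty}|r_t(x)|<+\infty\}$ (negatively conservative points). $\mathcal{F}:=\ker\mathrm{d}_\eta H$ is the invariant (singular) distribution; on the open set where $\mathrm{d}_\eta H\neq0$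 it is integrable of codimension 1. A leaf of $\mathcal{F}$ is a maximal connected integral manifold (of dimension $2n-1$) of $\mathcal{F}$ in the open set $\{\mathrm{d}_\eta H\neq 0\}$; it is embedded if it is an embedded submanifold of $M$. Zero volume is understood with respect to any volume form. *)

theory Defs
  imports "HOL-Analysis.Analysis"
begin

text \<open>These notions are meant for an open set \<open>S\<close>. Since the domain is finite-dimensional, continuity
  of all directional derivatives up to order \<open>k\<close> is the usual class \<open>C\<^sup>k\<close>.\<close>

primrec Ck_on :: "nat \<Rightarrow> 'a::euclidean_space set \<Rightarrow> ('a \<Rightarrow> 'b::euclidean_space) \<Rightarrow> bool" where
  "Ck_on 0 S f \<longleftrightarrow> continuous_on S f"
| "Ck_on (Suc k) S f \<longleftrightarrow>
     (\<forall>x\<in>S. f differentiable (at x)) \<and> (\<forall>v. Ck_on k S (\<lambda>x. frechet_derivative f (at x) v))"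

definition smooth_on :: "'a::euclidean_space set \<Rightarrow> ('a \<Rightarrow> 'b::euclidean_space) \<Rightarrow> bool" where
  "smooth_on S f \<longleftrightarrow> (\<forall>k. Ck_on k S f)"

text \<open>A manifold is given by a smooth atlas on a set of points; its topology is the one determined
  by the atlas. The values of \<open>coord c\<close> outside \<open>chart_domain c\<close> are irrelevant.\<close>

datatype ('m, 'e) chart = Chart (chart_domain: "'m set") (coord: "'m \<Rightarrow> 'e")

type_synonym ('m, 'e) atlas = "('m, 'e) chart set"

definition points :: "('m, 'e) atlas \<Rightarrow> 'm set" where
  "points A = (\<Union>c\<in>A. chart_domain c)"

definition chart_inv :: "('m, 'e) chart \<Rightarrow> 'e \<Rightarrow> 'm" where
  "chart_inv c = inv_into (chart_domain c) (coord c)"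

definition transition :: "('m, 'e) chart \<Rightarrow> ('m, 'e) chart \<Rightarrow> 'e \<Rightarrow> 'e" where
  "transition c d = coord d \<circ> chart_inv c"

definition smooth_atlas :: "('m, 'e::euclidean_space) atlas \<Rightarrow> bool" where
  "smooth_atlas A \<longleftrightarrow>
     (\<forall>c\<in>A. inj_on (coord c) (chart_domain c)) \<and>
     (\<forall>c\<in>A. \<forall>d\<in>A. open (coord c ` (chart_domain c \<inter> chart_domain d)) \<and>
        smooth_on (coord c ` (chart_domain c \<inter> chart_domain d)) (transition c d))"

definition atlas_open :: "('m, 'e::euclidean_space) atlas \<Rightarrow> 'm set \<Rightarrow> bool" where
  "atlas_open A U \<longleftrightarrow> U \<subseteq> points A \<and> (\<forall>c\<in>A. open (coord c ` (U \<inter> chart_domain c)))"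

definition atlas_topology :: "('m, 'e::euclidean_space) atlas \<Rightarrow> 'm topology" where
  "atlas_topology A = topology (atlas_open A)"

lemma openin_atlas_topology:
  assumes "smooth_atlas A"
  shows "openin (atlas_topology A) U \<longleftrightarrow> atlas_open A U"
proof -
  have "istopology (atlas_open A)"
    unfolding istopology_def
  proof (intro conjI allI impI)
    fix S T assume S: "atlas_open A S" and T: "atlas_open A T"
    have "coord c ` (S \<inter> T \<inter> chart_domain c) =
        coord c ` (S \<inter> chart_domain c) \<inter> coord c ` (T \<inter> chart_domain c)" if "c \<in> A" for c
    proof -
      have "inj_on (coord c) (chart_domain c)"
        using assms that by (simp add: smooth_atlas_def)
      then show ?thesis
        by (auto simp: inj_on_def)
    qed
    with S T show "atlas_open A (S \<inter> T)"
      by (auto simp: atlas_open_def intro!: open_Int)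
  next
    fix K assume K: "\<forall>S\<in>K. atlas_open A S"
    have "coord c ` (\<Union>K \<inter> chart_domain c) = (\<Union>S\<in>K. coord c ` (S \<inter> chart_domain c))" for c
      by auto
    with K show "atlas_open A (\<Union>K)"
      unfolding atlas_open_def by (metis (no_types, lifting) Sup_least open_UN)
  qed
  then show ?thesis
    by (simp add: atlas_topology_def topology_inverse')
qed

definition second_countable :: "'a topology \<Rightarrow> bool" where
  "second_countable T \<longleftrightarrow> (\<exists>\<B>. countable \<B> \<and> (\<forall>V\<in>\<B>. openin T V) \<and>
     (\<forall>U x. openin T U \<and> x \<in> U \<longrightarrow> (\<exists>V\<in>\<B>. x \<in> V \<and> V \<subseteq> U)))"

definition manifold :: "('m, 'e::euclidean_space) atlas \<Rightarrow> bool" where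
  "manifold A \<longleftrightarrow> smooth_atlas A \<and> Hausdorff_space (atlas_topology A) \<and>
     second_countable (atlas_topology A)"

text \<open>Charts take values in open sets of a vector space, so manifolds have no boundary.\<close>

definition closed_manifold :: "('m, 'e::euclidean_space) atlas \<Rightarrow> bool" where
  "closed_manifold A \<longleftrightarrow> manifold A \<and> compact_space (atlas_topology A)"

text \<open>Openness of the sets on which the local representatives are defined amounts to continuity.\<close>

definition smooth_map ::
  "('m, 'e::euclidean_space) atlas \<Rightarrow> ('p, 'f::euclidean_space) atlas \<Rightarrow> ('m \<Rightarrow> 'p) \<Rightarrow> bool" where
  "smooth_map A B f \<longleftrightarrow> f \<in> points A \<rightarrow> points B \<and>
     (\<forall>c\<in>A. \<forall>d\<in>B. let W = coord c ` {x \<in> chart_domain c. f x \<in> chart_domain d}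
        in open W \<and> smooth_on W (coord d \<circ> f \<circ> chart_inv c))"

definition real_atlas :: "(real, real) atlas" where
  "real_atlas = {Chart UNIV (\<lambda>t. t)}"

definition prod_atlas :: "('m, 'e) atlas \<Rightarrow> ('p, 'f) atlas \<Rightarrow> ('m \<times> 'p, 'e \<times> 'f) atlas" where
  "prod_atlas A B =
     {Chart (chart_domain c \<times> chart_domain d) (map_prod (coord c) (coord d)) | c d. c \<in> A \<and> d \<in> B}"

text \<open>A volume form is, in every chart, a nowhere vanishing smooth density times Lebesgue measure.
  Its null sets (subsets of measurable ones included) are therefore the sets that are
  Lebesgue-null in every chart, independently of the volume form.\<close>

definition zero_volume :: "('m, 'e::euclidean_space) atlas \<Rightarrow> 'm set \<Rightarrow> bool" where
  "zero_volume A S \<longleftrightarrow> (\<forall>c\<in>A. coord c ` (S \<inter> chart_domain c) \<in> null_sets lebesgue)"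

text \<open>The tangent space at \<open>x\<close> is identified with the model space \<open>'e\<close> by means of one chart
  \<open>chart_at A x\<close> around \<open>x\<close>, chosen once and for all. Other charts enter through the
  derivatives of the transition maps, so smoothness is tested on local representatives in all charts;
  in particular a smooth field need not depend continuously on \<open>x\<close> as a function into \<open>'e\<close>.\<close>

definition chart_at :: "('m, 'e) atlas \<Rightarrow> 'm \<Rightarrow> ('m, 'e) chart" where
  "chart_at A x = (SOME c. c \<in> A \<and> x \<in> chart_domain c)"

definition tangent_of_coords ::
  "('m, 'e::euclidean_space) atlas \<Rightarrow> ('m, 'e) chart \<Rightarrow> 'm \<Rightarrow> 'e \<Rightarrow> 'e" where
  "tangent_of_coords A c x = frechet_derivative (transition c (chart_at A x)) (at (coord c x))"

definition coords_of_tangent ::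
  "('m, 'e::euclidean_space) atlas \<Rightarrow> ('m, 'e) chart \<Rightarrow> 'm \<Rightarrow> 'e \<Rightarrow> 'e" where
  "coords_of_tangent A c x =
     frechet_derivative (transition (chart_at A x) c) (at (coord (chart_at A x) x))"

definition tangent_map ::
  "('m, 'e::euclidean_space) atlas \<Rightarrow> ('p, 'f::euclidean_space) atlas \<Rightarrow> ('m \<Rightarrow> 'p) \<Rightarrow> 'm \<Rightarrow> 'e \<Rightarrow> 'f"
  where
  "tangent_map A B f x =
     frechet_derivative (coord (chart_at B (f x)) \<circ> f \<circ> chart_inv (chart_at A x))
       (at (coord (chart_at A x) x))"

definition vector_field :: "('m, 'e::euclidean_space) atlas \<Rightarrow> ('m \<Rightarrow> 'e) \<Rightarrow> bool" where
  "vector_field A X \<longleftrightarrow> (\<forall>c\<in>A. smooth_on (coord c ` chart_domain c)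
     (\<lambda>y. coords_of_tangent A c (chart_inv c y) (X (chart_inv c y))))"

type_synonym ('m, 'e) form1 = "'m \<Rightarrow> 'e \<Rightarrow> real"
type_synonym ('m, 'e) form2 = "'m \<Rightarrow> 'e \<Rightarrow> 'e \<Rightarrow> real"
type_synonym ('m, 'e) form3 = "'m \<Rightarrow> 'e \<Rightarrow> 'e \<Rightarrow> 'e \<Rightarrow> real"

definition local1 ::
  "('m, 'e::euclidean_space) atlas \<Rightarrow> ('m, 'e) form1 \<Rightarrow> ('m, 'e) chart \<Rightarrow> 'e \<Rightarrow> 'e \<Rightarrow> real" where
  "local1 A \<alpha> c y u = (let x = chart_inv c y in \<alpha> x (tangent_of_coords A c x u))"

definition local2 ::
  "('m, 'e::euclidean_space) atlas \<Rightarrow> ('m, 'e) form2 \<Rightarrow> ('m, 'e) chart \<Rightarrow> 'e \<Rightarrow> 'e \<Rightarrow> 'e \<Rightarrow> real" where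
  "local2 A \<beta> c y u v =
     (let x = chart_inv c y in \<beta> x (tangent_of_coords A c x u) (tangent_of_coords A c x v))"

definition smooth_form1 :: "('m, 'e::euclidean_space) atlas \<Rightarrow> ('m, 'e) form1 \<Rightarrow> bool" where
  "smooth_form1 A \<alpha> \<longleftrightarrow> (\<forall>x\<in>points A. linear (\<alpha> x)) \<and>
     (\<forall>c\<in>A. \<forall>u. smooth_on (coord c ` chart_domain c) (\<lambda>y. local1 A \<alpha> c y u))"

definition smooth_form2 :: "('m, 'e::euclidean_space) atlas \<Rightarrow> ('m, 'e) form2 \<Rightarrow> bool" where
  "smooth_form2 A \<beta> \<longleftrightarrow>
     (\<forall>x\<in>points A. (\<forall>u. linear (\<beta> x u)) \<and> (\<forall>u v. \<beta> x u v = - \<beta> x v u)) \<and>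
     (\<forall>c\<in>A. \<forall>u v. smooth_on (coord c ` chart_domain c) (\<lambda>y. local2 A \<beta> c y u v))"

text \<open>Exterior derivatives at \<open>x\<close> are computed with constant vector fields in the coordinates
  \<open>chart_at A x\<close>; by naturality of the exterior derivative any other chart gives the same value.\<close>

definition d_fun :: "('m, 'e::euclidean_space) atlas \<Rightarrow> ('m \<Rightarrow> real) \<Rightarrow> ('m, 'e) form1" where
  "d_fun A f x u =
     (let c = chart_at A x in frechet_derivative (f \<circ> chart_inv c) (at (coord c x)) u)"

definition d_form1 :: "('m, 'e::euclidean_space) atlas \<Rightarrow> ('m, 'e) form1 \<Rightarrow> ('m, 'e) form2" where
  "d_form1 A \<alpha> x u v =
     (let c = chart_at A x;
          D = (\<lambda>w a. frechet_derivative (\<lambda>y. local1 A \<alpha> c y a) (at (coord c x)) w)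
      in D u v - D v u)"

definition d_form2 :: "('m, 'e::euclidean_space) atlas \<Rightarrow> ('m, 'e) form2 \<Rightarrow> ('m, 'e) form3" where
  "d_form2 A \<beta> x u v w =
     (let c = chart_at A x;
          D = (\<lambda>z a b. frechet_derivative (\<lambda>y. local2 A \<beta> c y a b) (at (coord c x)) z)
      in D u v w - D v u w + D w u v)"

definition wedge12 :: "('m, 'e) form1 \<Rightarrow> ('m, 'e) form2 \<Rightarrow> ('m, 'e) form3" where
  "wedge12 \<alpha> \<beta> x u v w = \<alpha> x u * \<beta> x v w - \<alpha> x v * \<beta> x u w + \<alpha> x w * \<beta> x u v"

text \<open>The twisted differential \<open>\<alpha> \<mapsto> d\<alpha> - \<eta> \<and> \<alpha>\<close> in degrees 0 and 2.\<close>

definition lee_d_fun ::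
  "('m, 'e::euclidean_space) atlas \<Rightarrow> ('m, 'e) form1 \<Rightarrow> ('m \<Rightarrow> real) \<Rightarrow> ('m, 'e) form1" where
  "lee_d_fun A \<eta> f x u = d_fun A f x u - f x * \<eta> x u"

definition lee_d_form2 ::
  "('m, 'e::euclidean_space) atlas \<Rightarrow> ('m, 'e) form1 \<Rightarrow> ('m, 'e) form2 \<Rightarrow> ('m, 'e) form3" where
  "lee_d_form2 A \<eta> \<beta> x u v w = d_form2 A \<beta> x u v w - wedge12 \<eta> \<beta> x u v w"

definition conformal_symplectic ::
  "('m, 'e::euclidean_space) atlas \<Rightarrow> ('m, 'e) form1 \<Rightarrow> ('m, 'e) form2 \<Rightarrow> bool" where
  "conformal_symplectic A \<eta> \<omega> \<longleftrightarrow>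
     manifold A \<and> even DIM('e) \<and>
     smooth_form1 A \<eta> \<and> (\<forall>x\<in>points A. \<forall>u v. d_form1 A \<eta> x u v = 0) \<and>
     smooth_form2 A \<omega> \<and> (\<forall>x\<in>points A. \<forall>u. (\<forall>v. \<omega> x u v = 0) \<longrightarrow> u = 0) \<and>
     (\<forall>x\<in>points A. \<forall>u v w. lee_d_form2 A \<eta> \<omega> x u v w = 0)"

definition hamiltonian_vector_field ::
  "('m, 'e::euclidean_space) atlas \<Rightarrow> ('m, 'e) form1 \<Rightarrow> ('m, 'e) form2 \<Rightarrow> ('m \<Rightarrow> real) \<Rightarrow> ('m \<Rightarrow> 'e) \<Rightarrow> bool"
  where
  "hamiltonian_vector_field A \<eta> \<omega> H X \<longleftrightarrow>
     vector_field A X \<and> (\<forall>x\<in>points A. \<forall>v. \<omega> x (X x) v = lee_d_fun A \<eta> H x v)"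

definition flow_of ::
  "('m, 'e::euclidean_space) atlas \<Rightarrow> ('m \<Rightarrow> 'e) \<Rightarrow> (real \<Rightarrow> 'm \<Rightarrow> 'm) \<Rightarrow> bool" where
  "flow_of A X \<phi> \<longleftrightarrow>
     smooth_map (prod_atlas real_atlas A) A (\<lambda>(t, x). \<phi> t x) \<and>
     (\<forall>x\<in>points A. \<phi> 0 x = x) \<and>
     (\<forall>s t. \<forall>x\<in>points A. \<phi> (s + t) x = \<phi> s (\<phi> t x)) \<and>
     (\<forall>t. \<forall>x\<in>points A.
        ((\<lambda>s. coord (chart_at A (\<phi> t x)) (\<phi> s x)) has_vector_derivative X (\<phi> t x)) (at t))"

text \<open>The interval integral is oriented: \<open>LBINT s=0..t\<close> is minus the integral over \<open>[t, 0]\<close>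
  when \<open>t < 0\<close>.\<close>

definition winding ::
  "('m, 'e::euclidean_space) form1 \<Rightarrow> ('m \<Rightarrow> 'e) \<Rightarrow> (real \<Rightarrow> 'm \<Rightarrow> 'm) \<Rightarrow> real \<Rightarrow> 'm \<Rightarrow> real" where
  "winding \<eta> X \<phi> t x = (LBINT s=0..ereal t. \<eta> (\<phi> s x) (X (\<phi> s x)))"

definition pos_conservative ::
  "('m, 'e::euclidean_space) atlas \<Rightarrow> ('m, 'e) form1 \<Rightarrow> ('m \<Rightarrow> 'e) \<Rightarrow> (real \<Rightarrow> 'm \<Rightarrow> 'm) \<Rightarrow> 'm set" where
  "pos_conservative A \<eta> X \<phi> =
     {x \<in> points A. Liminf at_top (\<lambda>t. ereal \<bar>winding \<eta> X \<phi> t x\<bar>) < \<infinity>}"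

definition neg_conservative ::
  "('m, 'e::euclidean_space) atlas \<Rightarrow> ('m, 'e) form1 \<Rightarrow> ('m \<Rightarrow> 'e) \<Rightarrow> (real \<Rightarrow> 'm \<Rightarrow> 'm) \<Rightarrow> 'm set" where
  "neg_conservative A \<eta> X \<phi> =
     {x \<in> points A. Liminf at_bot (\<lambda>t. ereal \<bar>winding \<eta> X \<phi> t x\<bar>) < \<infinity>}"

definition invariant_distribution ::
  "('m, 'e::euclidean_space) atlas \<Rightarrow> ('m, 'e) form1 \<Rightarrow> ('m \<Rightarrow> real) \<Rightarrow> 'm \<Rightarrow> 'e set" where
  "invariant_distribution A \<eta> H x = {v. lee_d_fun A \<eta> H x v = 0}"

definition regular_set ::
  "('m, 'e::euclidean_space) atlas \<Rightarrow> ('m, 'e) form1 \<Rightarrow> ('m \<Rightarrow> real) \<Rightarrow> 'm set" where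
  "regular_set A \<eta> H = {x \<in> points A. \<exists>v. lee_d_fun A \<eta> H x v \<noteq> 0}"

text \<open>An integral manifold is an injectively immersed manifold: a subset of the ambient
  manifold with a manifold structure \<open>B\<close> of its own, possibly with a finer topology than the
  induced one, for which the inclusion is an immersion tangent to the distribution.\<close>

definition connected_integral_manifold ::
  "('m, 'e::euclidean_space) atlas \<Rightarrow> ('m, 'e) form1 \<Rightarrow> ('m \<Rightarrow> real) \<Rightarrow>
     ('m, 'f::euclidean_space) atlas \<Rightarrow> bool" where
  "connected_integral_manifold A \<eta> H B \<longleftrightarrow>
     manifold B \<and> points B \<noteq> {} \<and> connected_space (atlas_topology B) \<and>
     points B \<subseteq> regular_set A \<eta> H \<and>
     smooth_map B A (\<lambda>x. x) \<and>
     (\<forall>x\<in>points B. inj (tangent_map B A (\<lambda>x. x) x) \<and>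
        range (tangent_map B A (\<lambda>x. x) x) = invariant_distribution A \<eta> H x)"

definition leaf ::
  "('m, 'e::euclidean_space) atlas \<Rightarrow> ('m, 'e) form1 \<Rightarrow> ('m \<Rightarrow> real) \<Rightarrow>
     ('m, 'f::euclidean_space) atlas \<Rightarrow> bool" where
  "leaf A \<eta> H B \<longleftrightarrow> connected_integral_manifold A \<eta> H B \<and>
     (\<forall>B' :: ('m, 'f) atlas. connected_integral_manifold A \<eta> H B' \<and> points B \<subseteq> points B' \<longrightarrow>
        points B' = points B)"

definition embedded_leaf ::
  "('m, 'e::euclidean_space) atlas \<Rightarrow> ('m, 'e) form1 \<Rightarrow> ('m \<Rightarrow> real) \<Rightarrow>
     ('m, 'f::euclidean_space) atlas \<Rightarrow> bool" where
  "embedded_leaf A \<eta> H B \<longleftrightarrow> leaf A \<eta> H B \<and>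
     embedding_map (atlas_topology B) (atlas_topology A) (\<lambda>x. x)"

end

theory Submission
  imports Defs
begin

text \<open>Write \<open>r\<^sub>t\<close> for the winding. The Lie derivative of \<open>\<omega>\<close> along \<open>X\<close> is \<open>\<eta>(X) \<omega>\<close>, because \<open>d\<omega> = \<eta> \<and> \<omega>\<close>
and \<open>\<omega>(X, \<cdot>) = dH - H\<eta>\<close> with \<open>\<eta>\<close> closed. Hence the flow multiplies \<open>\<omega>\<close> by \<open>exp r\<^sub>t\<close>
(\<open>pullback_\<omega>\<close>), and it multiplies volume on \<open>M\<close> by a fixed power of \<open>exp r\<^sub>t\<close>
(\<open>scaling_flow_ambient\<close>). Inserting \<open>X\<close>, which the flow preserves, shows that \<open>dH - H\<eta>\<close> is multiplied
by \<open>exp r\<^sub>t\<close> as well (\<open>pullback_lee_d_H\<close>), and so is \<open>H\<close> (\<open>H_along_flow\<close>). The field \<open>X\<close> is tangent to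
the leaves. A leaf that is closed in \<open>{H \<noteq> 0}\<close> is therefore invariant (\<open>flow_invariant\<close>), and the quotient
of the volume of \<open>M\<close> by the one-form \<open>dH - H\<eta>\<close> is a volume on the leaf that the flow again multiplies by a
power of \<open>exp r\<^sub>t\<close> (\<open>leaf_jacobian\<close>).

Both assertions now follow from one statement about a flow and a cocycle \<open>r\<close> that controls the distortion of
volume (\<open>zero_volume_escaping_recurrent\<close>): almost every point with \<open>\<bar>r\<^sub>k\<bar> \<longlonglongrightarrow> \<infinity>\<close> as \<open>k \<longlonglongrightarrow> \<infinity>\<close> also has
\<open>\<bar>r\<^sub>-\<^sub>k\<bar> \<longlonglongrightarrow> \<infinity>\<close>. Since \<open>\<eta>(X)\<close> is bounded on a compact manifold, integer times decide whether a point
is conservative (\<open>pos_conservative_iff\<close>, \<open>neg_conservative_iff\<close>), and reversing time gives the other half.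

The statement about cocycles is a Borel--Cantelli argument. If \<open>\<bar>r\<^sub>k(x)\<bar> \<longlonglongrightarrow> \<infinity>\<close>, let \<open>k\<close> be the last integer time
at which \<open>r\<close> vanishes along the orbit of \<open>x\<close>; the point \<open>y = \<phi>\<^sub>k(x)\<close> then satisfies \<open>\<bar>r\<^sub>j(y)\<bar> > \<delta>\<close> for all
\<open>j \<ge> 1\<close> and some \<open>\<delta> > 0\<close>. Let \<open>W\<close> be the set of all such points for a fixed \<open>\<delta>\<close>. Fix \<open>L\<close>, and let \<open>P\<^sub>k\<close> consist of
those points of \<open>W\<close> in a small ball at which \<open>\<bar>r\<^sub>-\<^sub>k\<bar> \<le> L\<close>. If \<open>\<phi>\<^sub>k(z)\<close> lies in \<open>P\<^sub>k\<close>, then \<open>\<bar>r\<^sub>k(z)\<bar> \<le> L\<close>, and for two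
times \<open>k < l\<close> of this kind the numbers \<open>r\<^sub>k(z)\<close> and \<open>r\<^sub>l(z)\<close> differ by \<open>r\<^sub>l\<^sub>-\<^sub>k(\<phi>\<^sub>k(z))\<close>, thus by more than \<open>\<delta>\<close>.
So at most \<open>2L/\<delta> + 1\<close> of the sets \<open>\<phi>\<^sub>-\<^sub>k(P\<^sub>k)\<close> contain \<open>z\<close>. These sets stay in a compact set, on which the
distortion of volume by \<open>\<phi>\<^sub>k\<close> is bounded as long as \<open>\<bar>r\<^sub>k\<bar> \<le> L\<close>. Hence the volumes of the \<open>P\<^sub>k\<close> have a finite sum
and almost every point of \<open>W\<close> in the ball lies in only finitely many \<open>P\<^sub>k\<close>.

The compact set is \<open>M\<close> itself in the first case. On a leaf in \<open>{H \<noteq> 0}\<close> a bound on \<open>\<bar>r\<^sub>t\<bar>\<close> keeps \<open>\<bar>H\<bar>\<close> away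
from \<open>0\<close> along the orbit, and the part of the leaf where \<open>\<bar>H\<bar> \<ge> \<epsilon>\<close> is compact because the inclusion of the leaf
is proper (\<open>leaf_exhaustion\<close>).

All volumes are computed in charts. The square of a density is the determinant of the Gram matrix of \<open>\<omega>\<close> in a basis; its
transformation rule is \<open>det (J\<^sup>T G J) = (det J)\<^sup>2 det G\<close>; this avoids top exterior powers.\<close>

section \<open>Determinants and volumes in Euclidean spaces\<close>

text \<open>The change of variables formula for Lebesgue measure is about \<open>real ^ 'n\<close> with \<open>'n\<close> finite and well-ordered. An
index type made from the standard basis identifies every Euclidean space with such a space; the order is
arbitrary.\<close>

typedef (overloaded) 'a basis_index = "Basis :: 'a::euclidean_space set"
  by (rule exI[of _ "SOME b. b \<in> Basis"]) (simp add: SOME_Basis)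

instance basis_index :: (euclidean_space) finite
proof
  have "(UNIV :: 'a basis_index set) = Abs_basis_index ` Basis"
    by (metis (no_types, lifting) Abs_basis_index_cases UNIV_eq_I image_eqI)
  then show "finite (UNIV :: 'a basis_index set)"
    by (metis finite_Basis finite_imageI)
qed

instantiation basis_index :: (euclidean_space) wellorder
begin

definition index_rank :: "'a basis_index \<Rightarrow> nat" where
  "index_rank = (SOME f. inj f)"

lemma inj_index_rank: "inj index_rank"
proof -
  have "\<exists>f :: 'a basis_index \<Rightarrow> nat. inj f"
    using finite_imp_inj_to_nat_seg[of "UNIV :: 'a basis_index set"] by auto
  then show ?thesis unfolding index_rank_def by (rule someI_ex)
qed

definition less_eq_basis_index :: "'a basis_index \<Rightarrow> 'a basis_index \<Rightarrow> bool" where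
  "i \<le> j \<longleftrightarrow> index_rank i \<le> index_rank j"

definition less_basis_index :: "'a basis_index \<Rightarrow> 'a basis_index \<Rightarrow> bool" where
  "i < j \<longleftrightarrow> index_rank i < index_rank j"

instance
proof
  fix P and i :: "'a basis_index"
  assume step: "\<And>i :: 'a basis_index. (\<And>j. j < i \<Longrightarrow> P j) \<Longrightarrow> P i"
  show "P i"
    by (induction i rule: measure_induct_rule[of index_rank])
      (auto intro: step simp: less_basis_index_def)
qed (auto simp: less_eq_basis_index_def less_basis_index_def intro: injD[OF inj_index_rank])

end

definition to_cart :: "'a::euclidean_space \<Rightarrow> real ^ 'a basis_index" where
  "to_cart x = (\<chi> i. x \<bullet> Rep_basis_index i)"

definition of_cart :: "real ^ 'a basis_index \<Rightarrow> 'a::euclidean_space" where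
  "of_cart v = (\<Sum>i\<in>UNIV. v $ i *\<^sub>R Rep_basis_index i)"

lemma sum_basis_index: "(\<Sum>i\<in>UNIV. f (Rep_basis_index i)) = (\<Sum>b\<in>Basis. f b)"
  by (rule sum.reindex_bij_betw)
    (auto simp: bij_betw_def inj_on_def Rep_basis_index_inject type_definition.Rep_range[OF type_definition_basis_index])

lemma prod_basis_index: "(\<Prod>i\<in>UNIV. f (Rep_basis_index i)) = (\<Prod>b\<in>Basis. f b)"
  by (rule prod.reindex_bij_betw)
    (auto simp: bij_betw_def inj_on_def Rep_basis_index_inject type_definition.Rep_range[OF type_definition_basis_index])

lemma inner_Rep_basis_index:
  "Rep_basis_index i \<bullet> Rep_basis_index j = (if i = j then 1 else 0)"
  using Rep_basis_index[of i] Rep_basis_index[of j]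
  by (auto simp: inner_Basis Rep_basis_index_inject)

lemma card_UNIV_basis_index: "CARD('a basis_index) = DIM('a::euclidean_space)"
  by (metis type_definition.card[OF type_definition_basis_index])

lemma of_cart_to_cart [simp]: "of_cart (to_cart x) = x"
  using sum_basis_index[of "\<lambda>b. (x \<bullet> b) *\<^sub>R b"]
  by (simp add: to_cart_def of_cart_def euclidean_representation)

lemma to_cart_of_cart [simp]: "to_cart (of_cart v) = v"
  by (simp add: to_cart_def of_cart_def vec_eq_iff inner_sum_left inner_Rep_basis_index if_distrib
      sum.delta cong: if_cong)

lemma of_cart_component: "of_cart v \<bullet> Rep_basis_index i = v $ i"
  using arg_cong[OF to_cart_of_cart[of v], of "\<lambda>w. w $ i"] by (simp add: to_cart_def)

lemma linear_to_cart: "linear to_cart"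
  by (auto intro!: linearI simp: to_cart_def vec_eq_iff inner_add_left)

lemma linear_of_cart: "linear of_cart"
  by (auto intro!: linearI simp: of_cart_def scaleR_add_left sum.distrib scaleR_sum_right)

lemma bij_to_cart: "bij to_cart"
  by (rule o_bij[of of_cart]) (auto simp: o_def)

lemma to_cart_image: "to_cart ` S = of_cart -` S"
  by (auto simp: image_iff) (metis to_cart_of_cart)

lemma of_cart_image: "of_cart ` S = to_cart -` S"
  by (auto simp: image_iff) (metis of_cart_to_cart)

lemma vimage_to_cart_box: "to_cart -` box l u = box (of_cart l) (of_cart u)"
proof -
  have "(\<forall>i. P (Rep_basis_index i)) \<longleftrightarrow> (\<forall>b\<in>Basis. P b)" for P :: "'a \<Rightarrow> bool"
    by (metis Rep_basis_index Rep_basis_index_cases)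
  from this[of "\<lambda>b. of_cart l \<bullet> b < x \<bullet> b \<and> x \<bullet> b < of_cart u \<bullet> b" for x] show ?thesis
    by (auto simp: box_def to_cart_def Basis_vec_def inner_axis of_cart_component)
qed

text \<open>The identification sends boxes to boxes with the same side lengths, which determines Lebesgue measure.\<close>

lemma distr_to_cart: "distr lborel borel to_cart = (lborel :: (real ^ 'a::euclidean_space basis_index) measure)"
proof (rule lborel_eqI[symmetric])
  have meas: "to_cart \<in> borel_measurable (borel :: 'a measure)"
    by (intro borel_measurable_continuous_onI linear_continuous_on linear_conv_bounded_linear[THEN iffD1] linear_to_cart)
  fix l u :: "real ^ 'a basis_index"
  assume le: "\<And>b. b \<in> Basis \<Longrightarrow> l \<bullet> b \<le> u \<bullet> b"
  have le': "l $ i \<le> u $ i" for i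
    using le[of "axis i 1"] by (simp add: inner_axis axis_in_Basis_iff)
  have "of_cart l \<bullet> b \<le> of_cart u \<bullet> b" if "b \<in> Basis" for b
    using of_cart_component le' that by (metis Rep_basis_index_cases)
  then have "emeasure lborel (box (of_cart l) (of_cart u)) = (\<Prod>b\<in>Basis. (of_cart u - of_cart l) \<bullet> b)"
    by simp
  also have "(\<Prod>b\<in>Basis. (of_cart u - of_cart l) \<bullet> b) = (\<Prod>i\<in>UNIV. (u - l) $ i)"
    by (subst prod_basis_index[symmetric]) (simp add: of_cart_component inner_diff_left)
  also have "\<dots> = (\<Prod>b\<in>Basis. (u - l) \<bullet> b)"
  proof -
    have "bij_betw (\<lambda>i. axis i 1) UNIV (Basis :: (real ^ 'a basis_index) set)"
      by (auto simp: bij_betw_def inj_on_def Basis_vec_def axis_eq_axis)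
    from prod.reindex_bij_betw[OF this, of "\<lambda>b. (u - l) \<bullet> b"] show ?thesis
      by (simp add: inner_axis)
  qed
  finally show "emeasure (distr lborel borel to_cart) (box l u) = (\<Prod>b\<in>Basis. (u - l) \<bullet> b)"
    using meas by (subst emeasure_distr) (auto simp: vimage_to_cart_box)
qed simp


lemma continuous_on_cart: "continuous_on S to_cart" "continuous_on T of_cart"
  by (intro linear_continuous_on linear_conv_bounded_linear[THEN iffD1] linear_to_cart linear_of_cart)+

lemma borel_measurable_cart: "to_cart \<in> borel_measurable borel" "of_cart \<in> borel_measurable borel"
  by (intro borel_measurable_continuous_onI continuous_on_cart)+

lemma emeasure_vimage_to_cart:
  assumes "C \<in> sets borel"
  shows "emeasure lborel (to_cart -` C) = emeasure lborel C"
  by (subst distr_to_cart[symmetric], subst emeasure_distr) (simp_all add: assms borel_measurable_cart)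

text \<open>A Lebesgue measurable set is a Borel set up to a null set, and linear maps that do not lower the dimension
preserve null sets; it is therefore enough to know the measures of images of Borel sets.\<close>

lemma lmeasurable_measure_preserving_image:
  fixes f :: "'a::euclidean_space \<Rightarrow> 'b::euclidean_space"
  assumes f: "linear f" "DIM('a) \<le> DIM('b)"
    and borel: "\<And>C. C \<in> sets borel \<Longrightarrow> f ` C \<in> sets borel \<and> emeasure lborel (f ` C) = emeasure lborel C"
    and S: "S \<in> lmeasurable"
  shows "f ` S \<in> lmeasurable" "measure lebesgue (f ` S) = measure lebesgue S"
proof -
  have S': "S \<in> sets lebesgue" using S by (simp add: fmeasurableD)
  obtain C N N' where SCN: "S = C \<union> N" "N \<subseteq> N'" "N' \<in> null_sets lborel" "C \<in> sets lborel"
    using sets_completionE[OF S'] .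
  have N: "negligible N"
    using SCN by (metis negligible_iff_null_sets null_sets_completionI completion.complete2)
  have neg: "negligible (f ` N)"
    by (rule negligible_differentiable_image_negligible[OF f(2) N linear_imp_differentiable_on[OF f(1)]])
  have C: "f ` C \<in> sets borel" "emeasure lborel (f ` C) = emeasure lborel C"
    using borel SCN(4) by simp_all
  have eq: "emeasure lebesgue (f ` S) = emeasure lebesgue S"
    unfolding SCN(1) image_Un using neg N C SCN(4)
    by (simp add: emeasure_Un_null_set negligible_iff_null_sets)
  have "f ` S \<in> sets lebesgue"
    unfolding SCN(1) image_Un using C neg by (auto simp: negligible_iff_null_sets)
  then show "f ` S \<in> lmeasurable"
    using S eq by (simp add: fmeasurable_def del: emeasure_completion)
  show "measure lebesgue (f ` S) = measure lebesgue S"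
    using eq by (simp add: measure_def)
qed

lemma lmeasurable_to_cart_image:
  assumes "S \<in> lmeasurable"
  shows "to_cart ` S \<in> lmeasurable" "measure lebesgue (to_cart ` S) = measure lebesgue S"
proof -
  have "to_cart ` C \<in> sets borel \<and> emeasure lborel (to_cart ` C) = emeasure lborel C"
    if C: "C \<in> sets borel" for C :: "'a set"
  proof -
    have "to_cart ` C \<in> sets borel"
      unfolding to_cart_image by (rule measurable_sets_borel[OF borel_measurable_cart(2) C])
    then show ?thesis
      using emeasure_vimage_to_cart[of "to_cart ` C"] by (simp add: inj_vimage_image_eq bij_is_inj[OF bij_to_cart])
  qed
  then show "to_cart ` S \<in> lmeasurable" "measure lebesgue (to_cart ` S) = measure lebesgue S"
    using lmeasurable_measure_preserving_image[OF linear_to_cart _ _ assms] by (simp_all add: card_UNIV_basis_index)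
qed

lemma lmeasurable_of_cart_image:
  assumes "S \<in> lmeasurable"
  shows "of_cart ` S \<in> lmeasurable" "measure lebesgue (of_cart ` S) = measure lebesgue S"
proof -
  have "of_cart ` C \<in> sets borel \<and> emeasure lborel (of_cart ` C) = emeasure lborel C"
    if C: "C \<in> sets borel" for C :: "(real ^ 'a basis_index) set"
    unfolding of_cart_image
    using emeasure_vimage_to_cart[OF C] measurable_sets_borel[OF borel_measurable_cart(1) C] by simp
  then show "of_cart ` S \<in> lmeasurable" "measure lebesgue (of_cart ` S) = measure lebesgue S"
    using lmeasurable_measure_preserving_image[OF linear_of_cart _ _ assms] by (simp_all add: card_UNIV_basis_index)
qed

definition ldet :: "('a::euclidean_space \<Rightarrow> 'a) \<Rightarrow> real" where
  "ldet f = det (matrix (to_cart \<circ> f \<circ> of_cart))"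

lemma linear_cart_conj: "linear f \<Longrightarrow> linear (to_cart \<circ> f \<circ> of_cart)"
  by (intro linear_compose linear_to_cart linear_of_cart)

lemma ldet_compose:
  assumes "linear f" "linear g"
  shows "ldet (f \<circ> g) = ldet f * ldet g"
proof -
  have "to_cart \<circ> (f \<circ> g) \<circ> of_cart = (to_cart \<circ> f \<circ> of_cart) \<circ> (to_cart \<circ> g \<circ> of_cart)"
    by (auto simp: fun_eq_iff)
  then show ?thesis
    unfolding ldet_def using matrix_compose[OF linear_cart_conj[OF assms(2)] linear_cart_conj[OF assms(1)]]
    by (simp add: det_mul)
qed

lemma ldet_id: "ldet (\<lambda>x. x) = 1"
proof -
  have "to_cart \<circ> (\<lambda>x. x :: 'a) \<circ> of_cart = id" by (auto simp: fun_eq_iff)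
  then show ?thesis by (simp add: ldet_def)
qed

lemma measure_ldet_image:
  assumes "linear f" and S: "S \<in> lmeasurable"
  shows "measure lebesgue (f ` S) = \<bar>ldet f\<bar> * measure lebesgue S"
proof -
  let ?g = "to_cart \<circ> f \<circ> of_cart"
  have "f ` S = of_cart ` (?g ` (to_cart ` S))"
    by (simp add: image_comp o_def)
  moreover have "?g ` (to_cart ` S) \<in> lmeasurable"
    by (rule measurable_linear_image[OF linear_cart_conj[OF assms(1)] lmeasurable_to_cart_image(1)[OF S]])
  moreover have "measure lebesgue (?g ` (to_cart ` S)) = \<bar>ldet f\<bar> * measure lebesgue S"
    using measure_linear_image[OF linear_cart_conj[OF assms(1)] lmeasurable_to_cart_image(1)[OF S]]
    by (simp add: ldet_def lmeasurable_to_cart_image(2)[OF S])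
  ultimately show ?thesis by (simp add: lmeasurable_of_cart_image(2))
qed

text \<open>The form in which the change of variables formula enters the recurrence argument. The image may be covered several
times, so there is only an upper bound for its volume.\<close>

lemma
  fixes f :: "'a::euclidean_space \<Rightarrow> 'a"
  assumes S: "S \<in> lmeasurable"
    and deriv: "\<And>x. x \<in> S \<Longrightarrow> (f has_derivative f' x) (at x within S)"
    and bounded: "\<And>x. x \<in> S \<Longrightarrow> \<bar>ldet (f' x)\<bar> \<le> B"
  shows lmeasurable_image_bounded_ldet: "f ` S \<in> lmeasurable"
    and measure_image_bounded_ldet: "measure lebesgue (f ` S) \<le> B * measure lebesgue S"
proof -
  let ?g = "to_cart \<circ> f \<circ> of_cart" and ?g' = "\<lambda>y. to_cart \<circ> f' (of_cart y) \<circ> of_cart"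
  have meas: "to_cart ` S \<in> lmeasurable" by (rule lmeasurable_to_cart_image(1)[OF S])
  have der: "(?g has_derivative ?g' y) (at y within to_cart ` S)" if "y \<in> to_cart ` S" for y
  proof -
    have 1: "(of_cart has_derivative of_cart) (at y within to_cart ` S)"
      by (rule linear_imp_has_derivative[OF linear_of_cart])
    have "of_cart ` to_cart ` S = S" by (simp add: image_comp)
    then have 2: "(f has_derivative f' (of_cart y)) (at (of_cart y) within of_cart ` to_cart ` S)"
      using deriv that by auto
    show ?thesis
      unfolding comp_assoc
      by (rule diff_chain_within[OF diff_chain_within[OF 1 2]])
        (rule linear_imp_has_derivative[OF linear_to_cart])
  qed
  have bd: "\<bar>det (matrix (?g' y))\<bar> \<le> B" if "y \<in> to_cart ` S" for y
    using bounded that by (auto simp: ldet_def)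
  have int: "(\<lambda>y. \<bar>det (matrix (?g' y))\<bar>) integrable_on to_cart ` S"
  proof (rule measurable_bounded_by_integrable_imp_integrable)
    show "(\<lambda>y. \<bar>det (matrix (?g' y))\<bar>) \<in> borel_measurable (lebesgue_on (to_cart ` S))"
      by (intro borel_measurable_abs borel_measurable_det_Jacobian[OF _ der] fmeasurableD meas)
    show "(\<lambda>_. B) integrable_on to_cart ` S"
      using meas by (rule integrable_on_const)
    show "to_cart ` S \<in> sets lebesgue" using meas by (rule fmeasurableD)
  qed (use bd in auto)
  have eq: "f ` S = of_cart ` (?g ` (to_cart ` S))"
    by (simp add: image_comp o_def)
  show "f ` S \<in> lmeasurable"
    unfolding eq
    by (intro lmeasurable_of_cart_image(1) measurable_bounded_differentiable_image[OF meas der int bd])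
  have "measure lebesgue (f ` S) = measure lebesgue (?g ` (to_cart ` S))"
    unfolding eq
    by (intro lmeasurable_of_cart_image(2) measurable_bounded_differentiable_image[OF meas der int bd])
  also have "\<dots> \<le> B * measure lebesgue (to_cart ` S)"
    by (rule measure_bounded_differentiable_image[OF meas der int bd])
  finally show "measure lebesgue (f ` S) \<le> B * measure lebesgue S"
    by (simp add: lmeasurable_to_cart_image(2)[OF S])
qed

text \<open>The square of a volume density: for a symplectic form this is the square of the Pfaffian, that is, of the value of
the top exterior power on the standard basis up to a constant factor.\<close>

definition gram :: "('a::euclidean_space \<Rightarrow> 'a \<Rightarrow> real) \<Rightarrow> real" where
  "gram \<beta> = det (\<chi> i j. \<beta> (Rep_basis_index i) (Rep_basis_index j))"

lemma gram_compose:
  assumes \<beta>: "bilinear \<beta>" and L: "linear L"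
  shows "gram (\<lambda>u v. \<beta> (L u) (L v)) = (ldet L)\<^sup>2 * gram \<beta>"
proof -
  let ?M = "matrix (to_cart \<circ> L \<circ> of_cart)"
  let ?G = "\<chi> i j. \<beta> (Rep_basis_index i) (Rep_basis_index j)"
  have ax: "of_cart (axis i 1) = Rep_basis_index i" for i :: "'a basis_index"
    by (simp add: of_cart_def axis_def if_distrib if_distribR sum.delta cong: if_cong)
  have col: "L (Rep_basis_index j) = (\<Sum>k\<in>UNIV. ?M $ k $ j *\<^sub>R Rep_basis_index k)" for j
    using of_cart_def[of "to_cart (L (Rep_basis_index j))"] by (simp add: matrix_def ax)
  have "\<beta> (L (Rep_basis_index i)) (L (Rep_basis_index j)) = (transpose ?M ** ?G ** ?M) $ i $ j" for i j
  proof -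
    have "\<beta> (L (Rep_basis_index i)) (L (Rep_basis_index j)) =
      (\<Sum>k\<in>UNIV. \<Sum>l\<in>UNIV. ?M $ k $ i * (?M $ l $ j * ?G $ k $ l))"
      unfolding col[of i] col[of j]
      by (subst bilinear_sum[OF \<beta>]) 
        (simp add: sum.cartesian_product split_def bilinear_lmul[OF \<beta>] bilinear_rmul[OF \<beta>] mult.left_commute)
    also have "\<dots> = (transpose ?M ** ?G ** ?M) $ i $ j"
      by (simp add: matrix_matrix_mult_def transpose_def sum_distrib_right)
        (subst sum.swap, simp add: ac_simps)
    finally show ?thesis .
  qed
  then have "(\<chi> i j. \<beta> (L (Rep_basis_index i)) (L (Rep_basis_index j))) = transpose ?M ** ?G ** ?M"
    by (simp add: vec_eq_iff)
  then show ?thesis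
    by (simp add: gram_def ldet_def det_mul det_transpose power2_eq_square)
qed

lemma gram_scale: "gram (\<lambda>u v. c * \<beta> u v) = c ^ CARD('a basis_index) * gram (\<beta> :: 'a::euclidean_space \<Rightarrow> _)"
  using det_rows_mul[of "\<lambda>_. c" "\<lambda>i. \<chi> j. \<beta> (Rep_basis_index i) (Rep_basis_index j)"]
  by (simp add: gram_def vector_scalar_mult_def)

lemma gram_nonzero:
  assumes \<beta>: "bilinear \<beta>" and nondeg: "\<And>u. (\<And>v. \<beta> u v = 0) \<Longrightarrow> u = 0"
  shows "gram \<beta> \<noteq> 0"
proof -
  let ?G = "\<chi> i j. \<beta> (Rep_basis_index i) (Rep_basis_index j)"
  have "x = 0" if x: "transpose ?G *v x = 0" for x
  proof -
    have "\<beta> (of_cart x) (Rep_basis_index j) = 0" for j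
    proof -
      have "\<beta> (of_cart x) (Rep_basis_index j) = (\<Sum>i\<in>UNIV. x $ i * \<beta> (Rep_basis_index i) (Rep_basis_index j))"
        using \<beta> by (simp add: of_cart_def bilinear_def linear_sum[where f = "\<lambda>u. \<beta> u _"] linear_cmul[where f = "\<lambda>u. \<beta> u _"])
      also have "\<dots> = (transpose ?G *v x) $ j"
        by (simp add: matrix_vector_mult_def transpose_def mult.commute)
      finally show ?thesis using x by simp
    qed
    then have "\<beta> (of_cart x) b = 0" if "b \<in> Basis" for b
      using that by (metis Rep_basis_index_cases)
    then have "\<beta> (of_cart x) v = 0" for v
      using linear_eq_stdbasis[of "\<beta> (of_cart x)" "\<lambda>_. 0"] \<beta>
      by (auto simp: bilinear_def module_hom_zero linear_zero)
    then have "of_cart x = 0" by (rule nondeg)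
    then have "to_cart (of_cart x) = to_cart 0" by simp
    then show ?thesis using linear_0[OF linear_to_cart] by simp
  qed
  then have "det (transpose ?G) \<noteq> 0"
    unfolding invertible_det_nz[symmetric] invertible_left_inverse matrix_left_invertible_ker
    by blast
  then show ?thesis by (simp add: gram_def det_transpose)
qed

lemma continuous_on_gram:
  assumes "\<And>a b. a \<in> Basis \<Longrightarrow> b \<in> Basis \<Longrightarrow> continuous_on S (\<lambda>x. \<beta> x a b)"
  shows "continuous_on S (\<lambda>x. gram (\<beta> x))"
  unfolding gram_def det_def
  using assms Rep_basis_index by (intro continuous_intros) auto

lemma abs_ldet_prod:
  fixes B :: "'f::euclidean_space \<Rightarrow> 'f"
  assumes B: "linear B"
  shows "\<bar>ldet (\<lambda>(s :: real, u). (c * s, B u))\<bar> = \<bar>c\<bar> * \<bar>ldet B\<bar>"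
proof -
  let ?P = "\<lambda>(s :: real, u). (c * s, B u)" and ?C = "cbox 0 One :: 'f set"
  have meas: "measure lebesgue (K \<times> L) = measure lebesgue K * measure lebesgue L"
    if "compact K" "compact L" for K :: "real set" and L :: "'f set"
    using that lborel.emeasure_pair_measure_Times[of K lborel L]
    by (simp add: lborel_prod measure_def compact_imp_closed enn2real_mult borel_compact compact_Times)
  have P: "linear ?P"
    using B by (auto intro!: linearI simp: linear_add linear_cmul algebra_simps)
  have c1: "compact ((\<lambda>s. c * s) ` {0..1})"
    by (intro compact_continuous_image continuous_intros) auto
  have c2: "compact (B ` ?C)"
    using B by (intro compact_continuous_image linear_continuous_on linear_conv_bounded_linear[THEN iffD1]) auto
  have C: "measure lebesgue ?C = 1"
    by (simp add: content_unit)
  have "\<bar>ldet ?P\<bar> * measure lebesgue ({0..1 :: real} \<times> ?C) = measure lebesgue (?P ` ({0..1} \<times> ?C))"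
  proof -
    have "compact ({0..1 :: real} \<times> ?C)" by (intro compact_Times) auto
    from measure_ldet_image[OF P lmeasurable_compact[OF this]] show ?thesis by simp
  qed
  also have "?P ` ({0..1} \<times> ?C) = ((\<lambda>s. c * s) ` {0..1}) \<times> B ` ?C"
    by auto
  also have "measure lebesgue \<dots> = \<bar>c\<bar> * measure lebesgue (B ` ?C)"
    using meas[OF c1 c2] by (simp add: image_mult_atLeastAtMost_if)
  also have "\<dots> = \<bar>c\<bar> * \<bar>ldet B\<bar>"
    using measure_ldet_image[OF B, of ?C] C by simp
  finally show ?thesis
    using meas[of "{0..1 :: real}" ?C] C by simp
qed

text \<open>The shears form a group and the shear by \<open>2v\<close> is conjugate to the shear by \<open>v\<close> under a dilation of the second factor.
So the determinant \<open>D\<close> of a shear satisfies \<open>D\<^sup>2 = D\<close>, and it is not \<open>0\<close>.\<close>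

lemma ldet_shear:
  fixes v :: "'f::euclidean_space"
  shows "ldet (\<lambda>(s :: real, u). (s, u + s *\<^sub>R v)) = 1"
proof -
  let ?S = "\<lambda>v :: 'f. \<lambda>(s :: real, u). (s, u + s *\<^sub>R v)" and ?D = "\<lambda>(s :: real, u :: 'f). (s, 2 *\<^sub>R u)"
  have lin: "linear (?S v)" for v :: 'f
    by (auto intro!: linearI simp: algebra_simps)
  have linD: "linear ?D" "linear (\<lambda>(s :: real, u :: 'f). (s, (1/2) *\<^sub>R u))"
    by (auto intro!: linearI simp: algebra_simps)
  have nz: "ldet (?S v) \<noteq> 0"
    using ldet_compose[OF lin lin, of v "- v"] ldet_id[where 'a = "real \<times> 'f"] by (auto simp: o_def split_def)
  have nzD: "ldet ?D \<noteq> 0"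
    using ldet_compose[OF linD] ldet_id[where 'a = "real \<times> 'f"] by (auto simp: o_def split_def)
  have "ldet (?S v) * ldet (?S v) = ldet (?S (2 *\<^sub>R v))"
    by (subst ldet_compose[OF lin lin, symmetric]) 
      (simp add: o_def split_def algebra_simps scaleR_2)
  moreover have "ldet (?S (2 *\<^sub>R v)) * ldet ?D = ldet ?D * ldet (?S v)"
    unfolding ldet_compose[OF lin linD(1), symmetric] ldet_compose[OF linD(1) lin, symmetric]
    by (simp add: o_def split_def algebra_simps)
  ultimately show ?thesis using nz nzD by simp
qed

lemma abs_ldet_block_triangular:
  fixes B :: "'f::euclidean_space \<Rightarrow> 'f"
  assumes B: "linear B"
  shows "\<bar>ldet (\<lambda>(s :: real, u). (c * s, B u + s *\<^sub>R v))\<bar> = \<bar>c\<bar> * \<bar>ldet B\<bar>"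
proof -
  let ?L = "\<lambda>(s :: real, u :: 'f). (c * s, u)" and ?S = "\<lambda>(s :: real, u). (s, u + s *\<^sub>R v)"
    and ?B = "\<lambda>(s :: real, u). (s, B u)"
  have lin: "linear ?L" "linear ?S" "linear ?B"
    using B by (auto intro!: linearI simp: linear_add linear_cmul algebra_simps)
  have "(\<lambda>(s :: real, u). (c * s, B u + s *\<^sub>R v)) = ?L \<circ> (?S \<circ> ?B)"
    by (auto simp: fun_eq_iff)
  then have "ldet (\<lambda>(s :: real, u). (c * s, B u + s *\<^sub>R v)) = ldet ?L * ldet ?B"
    by (simp add: ldet_compose lin linear_compose ldet_shear)
  moreover have "\<bar>ldet ?L\<bar> = \<bar>c\<bar>" "\<bar>ldet ?B\<bar> = \<bar>ldet B\<bar>"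
    using abs_ldet_prod[of "\<lambda>u :: 'f. u" c] abs_ldet_prod[OF B, of 1] ldet_id[where 'a = 'f]
    by (simp_all add: linear_ident)
  ultimately show ?thesis by (simp add: abs_mult)
qed

section \<open>Calculus in charts\<close>

lemma smooth_on_differentiable:
  assumes "smooth_on S f" "x \<in> S"
  shows "f differentiable (at x)"
  using assms unfolding smooth_on_def by (metis Ck_on.simps(2))

lemma smooth_on_continuous: "smooth_on S f \<Longrightarrow> continuous_on S f"
  unfolding smooth_on_def by (metis Ck_on.simps(1))

lemma smooth_on_derivative:
  "smooth_on S f \<Longrightarrow> smooth_on S (\<lambda>x. frechet_derivative f (at x) v)"
  unfolding smooth_on_def by (metis Ck_on.simps(2))

lemma smooth_on_has_derivative:
  "smooth_on S f \<Longrightarrow> x \<in> S \<Longrightarrow> (f has_derivative frechet_derivative f (at x)) (at x)"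
  using smooth_on_differentiable frechet_derivative_works by blast

lemma coord_chart_inv [simp]:
  "y \<in> coord c ` chart_domain c \<Longrightarrow> coord c (chart_inv c y) = y"
  "y \<in> coord c ` chart_domain c \<Longrightarrow> chart_inv c y \<in> chart_domain c"
  by (auto simp: chart_inv_def f_inv_into_f inv_into_into)

lemma chart_inv_coord [simp]:
  "smooth_atlas A \<Longrightarrow> c \<in> A \<Longrightarrow> x \<in> chart_domain c \<Longrightarrow> chart_inv c (coord c x) = x"
  by (auto simp: smooth_atlas_def chart_inv_def)

lemma open_chart_image: "smooth_atlas A \<Longrightarrow> c \<in> A \<Longrightarrow> open (coord c ` chart_domain c)"
  unfolding smooth_atlas_def by (metis Int_absorb)

lemma chart_domain_points: "c \<in> A \<Longrightarrow> x \<in> chart_domain c \<Longrightarrow> x \<in> points A"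
  by (auto simp: points_def)

lemma chart_at:
  assumes "x \<in> points A"
  shows "chart_at A x \<in> A" "x \<in> chart_domain (chart_at A x)"
proof -
  have "\<exists>c. c \<in> A \<and> x \<in> chart_domain c" using assms by (auto simp: points_def)
  from someI_ex[OF this] show "chart_at A x \<in> A" "x \<in> chart_domain (chart_at A x)"
    by (auto simp: chart_at_def)
qed

text \<open>Transition maps, local representatives of maps, and the three operators \<open>tangent_of_coords\<close>, \<open>coords_of_tangent\<close>
and \<open>tangent_map\<close> are all instances of the same construction, so that one chain rule (\<open>rep_deriv_compose\<close>)
covers them.\<close>

definition local_rep :: "('m, 'e) chart \<Rightarrow> ('m \<Rightarrow> 'p) \<Rightarrow> ('p, 'f) chart \<Rightarrow> 'e \<Rightarrow> 'f" where
  "local_rep c f d = coord d \<circ> f \<circ> chart_inv c"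

definition rep_deriv ::
  "('m, 'e::euclidean_space) chart \<Rightarrow> ('m \<Rightarrow> 'p) \<Rightarrow> ('p, 'f::euclidean_space) chart \<Rightarrow> 'm \<Rightarrow> 'e \<Rightarrow> 'f" where
  "rep_deriv c f d x = frechet_derivative (local_rep c f d) (at (coord c x))"

lemma local_rep_apply: "local_rep c f d y = coord d (f (chart_inv c y))"
  by (simp add: local_rep_def)

lemma transition_eq: "transition c d = local_rep c (\<lambda>x. x) d"
  by (auto simp: transition_def local_rep_def)

lemma tangent_of_coords_eq: "tangent_of_coords A c x = rep_deriv c (\<lambda>x. x) (chart_at A x) x"
  by (simp add: tangent_of_coords_def transition_eq rep_deriv_def)

lemma coords_of_tangent_eq: "coords_of_tangent A c x = rep_deriv (chart_at A x) (\<lambda>x. x) c x"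
  by (simp add: coords_of_tangent_def transition_eq rep_deriv_def)

lemma tangent_map_eq: "tangent_map A B f x = rep_deriv (chart_at A x) f (chart_at B (f x)) x"
  by (simp add: tangent_map_def local_rep_def rep_deriv_def)

text \<open>The regularity at which maps are transported to coordinates: it suffices for the change of variables formula, and the
inverse function theorem supplies it for the flow restricted to a leaf.\<close>

definition differentiable_map ::
  "('m, 'e::euclidean_space) atlas \<Rightarrow> ('p, 'f::euclidean_space) atlas \<Rightarrow> ('m \<Rightarrow> 'p) \<Rightarrow> bool" where
  "differentiable_map A B f \<longleftrightarrow> f \<in> points A \<rightarrow> points B \<and>
     (\<forall>c\<in>A. \<forall>d\<in>B. open (coord c ` {x \<in> chart_domain c. f x \<in> chart_domain d}) \<and>
        (\<forall>x\<in>chart_domain c. f x \<in> chart_domain d \<longrightarrow> local_rep c f d differentiable (at (coord c x))))"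

lemma smooth_map_imp_differentiable_map: "smooth_map A B f \<Longrightarrow> differentiable_map A B f"
  by (auto simp: smooth_map_def differentiable_map_def Let_def local_rep_def
      intro!: smooth_on_differentiable)

lemma differentiable_map_ident: "smooth_atlas A \<Longrightarrow> differentiable_map A A (\<lambda>x. x)"
  by (auto simp: smooth_atlas_def differentiable_map_def transition_eq Int_def
      intro!: smooth_on_differentiable)

lemma differentiable_mapD:
  assumes "differentiable_map A B f" "c \<in> A" "d \<in> B"
  shows "open (coord c ` {x \<in> chart_domain c. f x \<in> chart_domain d})"
    and "x \<in> chart_domain c \<Longrightarrow> f x \<in> chart_domain d \<Longrightarrow>
      (local_rep c f d has_derivative rep_deriv c f d x) (at (coord c x))"
  using assms by (auto simp: differentiable_map_def rep_deriv_def frechet_derivative_works)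

lemma linear_rep_deriv:
  assumes "differentiable_map A B f" "c \<in> A" "d \<in> B" "x \<in> chart_domain c" "f x \<in> chart_domain d"
  shows "linear (rep_deriv c f d x)"
  using differentiable_mapD(2)[OF assms] by (rule has_derivative_linear)

lemma local_rep_has_derivative_compose:
  assumes A: "smooth_atlas A" and B: "smooth_atlas B"
    and f: "differentiable_map A B f" and g: "differentiable_map B C g"
    and c: "c \<in> A" "x \<in> chart_domain c" and d: "d \<in> B" "f x \<in> chart_domain d"
    and e: "e \<in> C" "g (f x) \<in> chart_domain e"
  shows "(local_rep c (\<lambda>x. g (f x)) e has_derivative (\<lambda>u. rep_deriv d g e (f x) (rep_deriv c f d x u)))
    (at (coord c x))"
proof -
  let ?W = "coord c ` {x \<in> chart_domain c. f x \<in> chart_domain d}"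
  have x: "coord c x \<in> ?W" using c d by auto
  have eq: "local_rep c f d (coord c x) = coord d (f x)"
    using A c by (simp add: local_rep_apply)
  have "((local_rep d g e \<circ> local_rep c f d) has_derivative (rep_deriv d g e (f x) \<circ> rep_deriv c f d x))
    (at (coord c x))"
    using differentiable_mapD(2)[OF f c(1) d(1) c(2) d(2)] differentiable_mapD(2)[OF g d(1) e(1) d(2) e(2)]
    by (intro diff_chain_at) (simp_all add: eq)
  then have "(local_rep c (\<lambda>x. g (f x)) e has_derivative (rep_deriv d g e (f x) \<circ> rep_deriv c f d x))
    (at (coord c x))"
    by (rule has_derivative_transform_within_open[OF _ differentiable_mapD(1)[OF f c(1) d(1)] x])
      (use A B c d in \<open>auto simp: local_rep_apply\<close>)
  then show ?thesis by (simp add: o_def)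
qed

lemma rep_deriv_compose:
  assumes A: "smooth_atlas A" and B: "smooth_atlas B"
    and f: "differentiable_map A B f" and g: "differentiable_map B C g"
    and c: "c \<in> A" "x \<in> chart_domain c" and d: "d \<in> B" "f x \<in> chart_domain d"
    and e: "e \<in> C" "g (f x) \<in> chart_domain e"
  shows "rep_deriv c (\<lambda>x. g (f x)) e x u = rep_deriv d g e (f x) (rep_deriv c f d x u)"
  using frechet_derivative_at[OF local_rep_has_derivative_compose[OF assms], symmetric]
  by (simp add: rep_deriv_def)

lemma rep_deriv_ident:
  assumes A: "smooth_atlas A" "c \<in> A" "x \<in> chart_domain c"
  shows "rep_deriv c (\<lambda>x. x) c x u = u"
proof -
  have "((\<lambda>y. y) has_derivative (\<lambda>y. y)) (at (coord c x))" by (rule has_derivative_ident)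
  then have "(local_rep c (\<lambda>x. x) c has_derivative (\<lambda>y. y)) (at (coord c x))"
    by (rule has_derivative_transform_within_open[OF _ open_chart_image[OF A(1,2)]])
      (use A in \<open>auto simp: local_rep_apply\<close>)
  from frechet_derivative_at[OF this, symmetric] show ?thesis by (simp add: rep_deriv_def)
qed

lemma rep_deriv_ident_inverse:
  assumes A: "smooth_atlas A" and "c \<in> A" "x \<in> chart_domain c" "d \<in> A" "x \<in> chart_domain d"
  shows "rep_deriv d (\<lambda>x. x) c x (rep_deriv c (\<lambda>x. x) d x u) = u"
  using rep_deriv_compose[OF A A differentiable_map_ident[OF A] differentiable_map_ident[OF A], of c x d c]
    rep_deriv_ident[OF A] assms by simp

lemma tangent_coords_inverse:
  assumes A: "smooth_atlas A" and c: "c \<in> A" "x \<in> chart_domain c"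
  shows "tangent_of_coords A c x (coords_of_tangent A c x u) = u"
    and "coords_of_tangent A c x (tangent_of_coords A c x u) = u"
  using rep_deriv_ident_inverse[OF A] c chart_at[OF chart_domain_points[OF c]]
  by (simp_all add: tangent_of_coords_eq coords_of_tangent_eq)

lemma linear_tangent_of_coords:
  assumes A: "smooth_atlas A" and c: "c \<in> A" "x \<in> chart_domain c"
  shows "linear (tangent_of_coords A c x)"
  unfolding tangent_of_coords_eq
  by (rule linear_rep_deriv[OF differentiable_map_ident[OF A]])
    (use c chart_at[OF chart_domain_points[OF c]] in auto)

lemma linear_coords_of_tangent:
  assumes A: "smooth_atlas A" and c: "c \<in> A" "x \<in> chart_domain c"
  shows "linear (coords_of_tangent A c x)"
  unfolding coords_of_tangent_eq
  by (rule linear_rep_deriv[OF differentiable_map_ident[OF A]])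
    (use c chart_at[OF chart_domain_points[OF c]] in auto)

lemma tangent_of_coords_chart_at:
  "smooth_atlas A \<Longrightarrow> x \<in> points A \<Longrightarrow> tangent_of_coords A (chart_at A x) x u = u"
  by (simp add: tangent_of_coords_eq rep_deriv_ident chart_at)

lemma tangent_map_tangent_of_coords:
  assumes A: "smooth_atlas A" and B: "smooth_atlas B" and f: "differentiable_map A B f"
    and c: "c \<in> A" "x \<in> chart_domain c" and d: "d \<in> B" "f x \<in> chart_domain d"
  shows "tangent_map A B f x (tangent_of_coords A c x u) = tangent_of_coords B d (f x) (rep_deriv c f d x u)"
proof -
  note a = chart_at[OF chart_domain_points[OF c]] and b = chart_at[OF chart_domain_points[OF d]]
  have "tangent_map A B f x (tangent_of_coords A c x u) = rep_deriv c f (chart_at B (f x)) x u"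
    using rep_deriv_compose[OF A A differentiable_map_ident[OF A] f c a b]
    by (simp add: tangent_map_eq tangent_of_coords_eq)
  also have "\<dots> = tangent_of_coords B d (f x) (rep_deriv c f d x u)"
    using rep_deriv_compose[OF A B f differentiable_map_ident[OF B] c d b]
    by (simp add: tangent_of_coords_eq)
  finally show ?thesis .
qed

lemma tangent_map_compose:
  assumes A: "smooth_atlas A" and B: "smooth_atlas B" 
    and f: "differentiable_map A B f" and g: "differentiable_map B C g" and x: "x \<in> points A"
  shows "tangent_map A C (\<lambda>x. g (f x)) x u = tangent_map B C g (f x) (tangent_map A B f x u)"
proof -
  have "f x \<in> points B" "g (f x) \<in> points C" using f g x by (auto simp: differentiable_map_def)
  note this [simp]
  show ?thesis
    unfolding tangent_map_eq by (rule rep_deriv_compose[OF A B f g]) (simp_all add: chart_at x)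
qed

lemma atlas_open_chart_preimage:
  assumes A: "smooth_atlas A" and c: "c \<in> A" and V: "open V"
  shows "atlas_open A {x \<in> chart_domain c. coord c x \<in> V}"
  unfolding atlas_open_def
proof (intro conjI ballI)
  show "{x \<in> chart_domain c. coord c x \<in> V} \<subseteq> points A" using c by (auto simp: points_def)
  fix d assume d: "d \<in> A"
  let ?W = "coord d ` (chart_domain d \<inter> chart_domain c)"
  have "open ?W" "continuous_on ?W (transition d c)"
    using A c d by (auto simp: smooth_atlas_def intro: smooth_on_continuous)
  then have "open (?W \<inter> transition d c -` V)"
    using V by (simp add: continuous_on_open_vimage Int_commute)
  also have "?W \<inter> transition d c -` V = coord d ` ({x \<in> chart_domain c. coord c x \<in> V} \<inter> chart_domain d)"
    using A c d by (auto simp: transition_eq local_rep_apply)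
  finally show "open (coord d ` ({x \<in> chart_domain c. coord c x \<in> V} \<inter> chart_domain d))" .
qed

lemma atlas_open_chart_domain: "smooth_atlas A \<Longrightarrow> c \<in> A \<Longrightarrow> atlas_open A (chart_domain c)"
  using atlas_open_chart_preimage[of A c UNIV] by simp

lemma topspace_atlas: "smooth_atlas A \<Longrightarrow> topspace (atlas_topology A) = points A"
proof (intro antisym subsetI)
  fix x assume "smooth_atlas A" "x \<in> topspace (atlas_topology A)"
  then show "x \<in> points A"
    using openin_atlas_topology[of A] openin_topspace[of "atlas_topology A"] unfolding atlas_open_def by blast
next
  fix x assume A: "smooth_atlas A" "x \<in> points A"
  then show "x \<in> topspace (atlas_topology A)"
    using atlas_open_chart_domain[of A "chart_at A x"] chart_at[of x A]
    by (metis openin_atlas_topology openin_subset subsetD)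
qed

lemma atlas_open_Int_chart_image:
  "smooth_atlas A \<Longrightarrow> atlas_open A U \<Longrightarrow> c \<in> A \<Longrightarrow> open (coord c ` {x \<in> chart_domain c. x \<in> U})"
  by (simp add: atlas_open_def Int_def conj_commute)

lemma differentiable_map_imp_continuous_map:
  assumes A: "smooth_atlas A" and B: "smooth_atlas B" and f: "differentiable_map A B f"
  shows "continuous_map (atlas_topology A) (atlas_topology B) f"
  unfolding continuous_map_def topspace_atlas[OF A] topspace_atlas[OF B]
proof (intro conjI allI impI)
  show "f \<in> points A \<rightarrow> points B" using f by (simp add: differentiable_map_def)
  fix U assume "openin (atlas_topology B) U"
  then have U: "atlas_open B U" using B by (simp add: openin_atlas_topology)
  have "open (coord c ` ({x \<in> points A. f x \<in> U} \<inter> chart_domain c))" if c: "c \<in> A" for c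
  proof -
    have "open (coord c ` {x \<in> chart_domain c. f x \<in> chart_domain d \<and> f x \<in> U})" if d: "d \<in> B" for d
    proof -
      let ?W = "coord c ` {x \<in> chart_domain c. f x \<in> chart_domain d}"
      have "continuous_on ?W (local_rep c f d)"
        using differentiable_mapD(2)[OF f c d] 
        by (intro continuous_at_imp_continuous_on) (auto dest: has_derivative_continuous)
      then have "open (?W \<inter> local_rep c f d -` (coord d ` (U \<inter> chart_domain d)))"
        using U d differentiable_mapD(1)[OF f c d]
        by (simp add: continuous_on_open_vimage Int_commute atlas_open_def)
      also have "?W \<inter> local_rep c f d -` (coord d ` (U \<inter> chart_domain d)) =
          coord c ` {x \<in> chart_domain c. f x \<in> chart_domain d \<and> f x \<in> U}"
      proof -
        have "f x \<in> U" if "f x \<in> chart_domain d" "coord d (f x) = coord d z" "z \<in> U" "z \<in> chart_domain d" for x z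
          using that B d by (metis chart_inv_coord)
        then show ?thesis using A c by (auto simp: local_rep_apply image_iff)
      qed
      finally show ?thesis .
    qed
    then have "open (\<Union>d\<in>B. coord c ` {x \<in> chart_domain c. f x \<in> chart_domain d \<and> f x \<in> U})"
      by auto
    also have "\<dots> = coord c ` ({x \<in> points A. f x \<in> U} \<inter> chart_domain c)"
      using U c by (fastforce simp: atlas_open_def points_def)
    finally show ?thesis .
  qed
  then show "openin (atlas_topology A) {x \<in> points A. f x \<in> U}"
    using A by (auto simp: openin_atlas_topology atlas_open_def)
qed

lemma continuous_map_atlas_real:
  fixes F :: "'m \<Rightarrow> 'b::euclidean_space"
  assumes A: "smooth_atlas A" and F: "\<And>c. c \<in> A \<Longrightarrow> continuous_on (coord c ` chart_domain c) (F \<circ> chart_inv c)"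
  shows "continuous_map (atlas_topology A) euclidean F"
  unfolding continuous_map_def topspace_atlas[OF A]
proof (intro conjI allI impI)
  fix U :: "'b set" assume "openin euclidean U"
  then have U: "open U" by simp
  have "open (coord c ` ({x \<in> points A. F x \<in> U} \<inter> chart_domain c))" if c: "c \<in> A" for c
  proof -
    have "open (coord c ` chart_domain c \<inter> (F \<circ> chart_inv c) -` U)"
      by (rule continuous_open_preimage[OF F[OF c] open_chart_image[OF A c] U])
    also have "coord c ` chart_domain c \<inter> (F \<circ> chart_inv c) -` U =
        coord c ` ({x \<in> points A. F x \<in> U} \<inter> chart_domain c)"
      using A c by (auto simp: points_def)
    finally show ?thesis .
  qed
  then show "openin (atlas_topology A) {x \<in> points A. F x \<in> U}"
    using A by (auto simp: openin_atlas_topology atlas_open_def)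
qed simp

lemma differentiable_map_compose:
  assumes A: "smooth_atlas A" and B: "smooth_atlas B" and C: "smooth_atlas C"
    and f: "differentiable_map A B f" and g: "differentiable_map B C g"
  shows "differentiable_map A C (\<lambda>x. g (f x))"
  unfolding differentiable_map_def
proof (intro conjI ballI impI)
  show "(\<lambda>x. g (f x)) \<in> points A \<rightarrow> points C" using f g by (auto simp: differentiable_map_def)
  fix c e assume c: "c \<in> A" and e: "e \<in> C"
  have "continuous_map (atlas_topology A) (atlas_topology C) (g \<circ> f)"
    by (rule continuous_map_compose[OF differentiable_map_imp_continuous_map[OF A B f]
        differentiable_map_imp_continuous_map[OF B C g]])
  then have "openin (atlas_topology A) {x \<in> topspace (atlas_topology A). (g \<circ> f) x \<in> chart_domain e}"
    by (rule openin_continuous_map_preimage) (simp add: openin_atlas_topology[OF C] atlas_open_chart_domain[OF C e])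
  then have "atlas_open A {x \<in> points A. g (f x) \<in> chart_domain e}"
    by (simp add: openin_atlas_topology[OF A] topspace_atlas[OF A])
  from atlas_open_Int_chart_image[OF A this c]
  have "open (coord c ` {x \<in> chart_domain c. x \<in> {x \<in> points A. g (f x) \<in> chart_domain e}})" .
  also have "{x \<in> chart_domain c. x \<in> {x \<in> points A. g (f x) \<in> chart_domain e}} = {x \<in> chart_domain c. g (f x) \<in> chart_domain e}"
    using chart_domain_points[OF c] by auto
  finally show "open (coord c ` {x \<in> chart_domain c. g (f x) \<in> chart_domain e})" .
  fix x assume x: "x \<in> chart_domain c" "g (f x) \<in> chart_domain e"
  have "f x \<in> points B" using f chart_domain_points[OF c x(1)] by (auto simp: differentiable_map_def)
  from local_rep_has_derivative_compose[OF A B f g c x(1) chart_at[OF this] e x(2)]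
  show "local_rep c (\<lambda>x. g (f x)) e differentiable (at (coord c x))" by (auto simp: differentiable_def)
qed

lemma continuous_map_atlas_chart:
  fixes F :: "'m \<Rightarrow> 'b::euclidean_space"
  assumes A: "smooth_atlas A" and F: "continuous_map (atlas_topology A) euclidean F" and c: "c \<in> A"
  shows "continuous_on (coord c ` chart_domain c) (F \<circ> chart_inv c)"
  unfolding continuous_on_open_vimage[OF open_chart_image[OF A c]]
proof (intro allI impI)
  fix U :: "'b set" assume "open U"
  then have "openin (atlas_topology A) {x \<in> topspace (atlas_topology A). F x \<in> U}"
    by (intro openin_continuous_map_preimage[OF F]) simp
  then have "atlas_open A {x \<in> points A. F x \<in> U}"
    by (simp add: openin_atlas_topology[OF A] topspace_atlas[OF A])
  from atlas_open_Int_chart_image[OF A this c]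
  have "open (coord c ` {x \<in> chart_domain c. x \<in> {x \<in> points A. F x \<in> U}})" .
  also have "coord c ` {x \<in> chart_domain c. x \<in> {x \<in> points A. F x \<in> U}} = (F \<circ> chart_inv c) -` U \<inter> coord c ` chart_domain c"
    using A c chart_domain_points[OF c] by auto
  finally show "open ((F \<circ> chart_inv c) -` U \<inter> coord c ` chart_domain c)" .
qed

section \<open>Null sets of a manifold\<close>

lemma zero_volume_iff: "zero_volume A S \<longleftrightarrow> (\<forall>c\<in>A. negligible (coord c ` (S \<inter> chart_domain c)))"
  by (simp add: zero_volume_def negligible_iff_null_sets)

lemma zero_volume_subset: "zero_volume A T \<Longrightarrow> S \<subseteq> T \<Longrightarrow> zero_volume A S"
  unfolding zero_volume_iff by (meson Int_mono image_mono negligible_subset order_refl)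

lemma zero_volume_countable_Union:
  assumes "countable K" "\<And>S. S \<in> K \<Longrightarrow> zero_volume A S"
  shows "zero_volume A (\<Union>K)"
  unfolding zero_volume_iff
proof
  fix c assume "c \<in> A"
  then have "negligible (\<Union>((\<lambda>S. coord c ` (S \<inter> chart_domain c)) ` K))"
    using assms by (intro negligible_countable_Union) (auto simp: zero_volume_iff)
  then show "negligible (coord c ` (\<Union>K \<inter> chart_domain c))"
    by (rule negligible_subset) auto
qed

lemma zero_volume_Un: "zero_volume A S \<Longrightarrow> zero_volume A T \<Longrightarrow> zero_volume A (S \<union> T)"
  using zero_volume_countable_Union[of "{S, T}" A] by auto

text \<open>By second countability, countably many of the neighbourhoods already cover the set.\<close>

lemma zero_volume_local:
  assumes A: "smooth_atlas A" "second_countable (atlas_topology A)"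
    and loc: "\<And>x. x \<in> S \<Longrightarrow> \<exists>U. atlas_open A U \<and> x \<in> U \<and> zero_volume A (S \<inter> U)"
  shows "zero_volume A S"
proof -
  obtain \<B> where \<B>: "countable \<B>"
    and base: "\<And>U x. atlas_open A U \<Longrightarrow> x \<in> U \<Longrightarrow> \<exists>V\<in>\<B>. x \<in> V \<and> V \<subseteq> U"
    using A by (auto simp: second_countable_def openin_atlas_topology)
  let ?K = "(\<lambda>V. S \<inter> V) ` {V \<in> \<B>. zero_volume A (S \<inter> V)}"
  have "zero_volume A (\<Union>?K)"
    using \<B> by (intro zero_volume_countable_Union) auto
  moreover have "S \<subseteq> \<Union>?K"
  proof
    fix x assume x: "x \<in> S"
    obtain U where U: "atlas_open A U" "x \<in> U" "zero_volume A (S \<inter> U)" using loc[OF x] by auto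
    obtain V where "V \<in> \<B>" "x \<in> V" "V \<subseteq> U" using base[OF U(1,2)] by auto
    moreover from this have "zero_volume A (S \<inter> V)" using U(3) by (meson Int_mono order_refl zero_volume_subset)
    ultimately show "x \<in> \<Union>?K" using x by auto
  qed
  ultimately show ?thesis by (rule zero_volume_subset)
qed

lemma zero_volume_image_chart:
  fixes f :: "'m \<Rightarrow> 'p" and A :: "('m, 'e::euclidean_space) atlas" and B :: "('p, 'e) atlas"
  assumes A: "smooth_atlas A" and f: "differentiable_map A B f" and c: "c \<in> A" "S \<subseteq> chart_domain c"
    and S: "negligible (coord c ` S)"
  shows "zero_volume B (f ` S)"
  unfolding zero_volume_iff
proof
  fix d assume d: "d \<in> B"
  let ?S = "coord c ` {x \<in> S. f x \<in> chart_domain d}"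
  have "negligible (local_rep c f d ` ?S)"
  proof (rule negligible_differentiable_image_negligible)
    show "negligible ?S" using S by (rule negligible_subset) auto
    show "local_rep c f d differentiable_on ?S"
      unfolding differentiable_on_def
      using differentiable_mapD(2)[OF f c(1) d] c(2)
      by (auto simp: differentiable_def intro: has_derivative_at_withinI)
  qed simp
  moreover have "coord d ` (f ` S \<inter> chart_domain d) \<subseteq> local_rep c f d ` ?S"
    using A c by (fastforce simp: local_rep_apply image_iff)
  ultimately show "negligible (coord d ` (f ` S \<inter> chart_domain d))"
    by (rule negligible_subset)
qed

lemma zero_volume_chart:
  assumes "smooth_atlas A" "c \<in> A" "S \<subseteq> chart_domain c" "negligible (coord c ` S)"
  shows "zero_volume A S"
  using zero_volume_image_chart[OF assms(1) differentiable_map_ident[OF assms(1)] assms(2-4)] by simp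

lemma countable_chart_cover:
  assumes A: "smooth_atlas A" "second_countable (atlas_topology A)"
  obtains C where "countable C" "C \<subseteq> A" "points A = (\<Union>c\<in>C. chart_domain c)"
proof -
  obtain \<B> where \<B>: "countable \<B>"
    and base: "\<And>U x. atlas_open A U \<Longrightarrow> x \<in> U \<Longrightarrow> \<exists>V\<in>\<B>. x \<in> V \<and> V \<subseteq> U"
    using A by (auto simp: second_countable_def openin_atlas_topology)
  define g where "g V = (SOME c. c \<in> A \<and> V \<subseteq> chart_domain c)" for V
  let ?B = "{V \<in> \<B>. \<exists>c\<in>A. V \<subseteq> chart_domain c}"
  have g: "g V \<in> A \<and> V \<subseteq> chart_domain (g V)" if "V \<in> ?B" for V
    unfolding g_def by (rule someI_ex) (use that in auto)
  show ?thesis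
  proof (rule that[of "g ` ?B"])
    show "countable (g ` ?B)" using \<B> by auto
    show "g ` ?B \<subseteq> A" using g by auto
    have "x \<in> (\<Union>c\<in>g ` ?B. chart_domain c)" if x: "x \<in> points A" for x
    proof -
      note c = chart_at[OF x]
      obtain V where V: "V \<in> \<B>" "x \<in> V" "V \<subseteq> chart_domain (chart_at A x)"
        using base[OF atlas_open_chart_domain[OF A(1) c(1)] c(2)] by auto
      then have "V \<in> ?B" using c by auto
      then show ?thesis using g[of V] V by auto
    qed
    then show "points A = (\<Union>c\<in>g ` ?B. chart_domain c)"
      using g by (fastforce simp: points_def)
  qed
qed

lemma zero_volume_image:
  fixes f :: "'m \<Rightarrow> 'p" and A :: "('m, 'e::euclidean_space) atlas" and B :: "('p, 'e) atlas"
  assumes A: "smooth_atlas A" "second_countable (atlas_topology A)"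
    and f: "differentiable_map A B f" and S: "S \<subseteq> points A" "zero_volume A S"
  shows "zero_volume B (f ` S)"
proof -
  obtain C where C: "countable C" "C \<subseteq> A" "points A = (\<Union>c\<in>C. chart_domain c)"
    using countable_chart_cover[OF A] .
  have "zero_volume B (\<Union>((\<lambda>c. f ` (S \<inter> chart_domain c)) ` C))"
  proof (rule zero_volume_countable_Union)
    fix T assume "T \<in> (\<lambda>c. f ` (S \<inter> chart_domain c)) ` C"
    then obtain c where "c \<in> A" "T = f ` (S \<inter> chart_domain c)" using C by auto
    then show "zero_volume B T"
      using S(2) by (auto intro!: zero_volume_image_chart[OF A(1) f] dest: zero_volume_iff[THEN iffD1])
  qed (use C in auto)
  then show ?thesis by (rule zero_volume_subset) (use C S in blast)
qed

section \<open>Flows whose distortion of volume is a cocycle\<close>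

text \<open>Different points of the set have different images under \<open>k \<mapsto> \<lfloor>(a k + L) / \<delta>\<rfloor>\<close>.\<close>

lemma card_separated_le:
  fixes a :: "'i \<Rightarrow> real"
  assumes A: "finite A" "\<And>k. k \<in> A \<Longrightarrow> \<bar>a k\<bar> \<le> L" and \<delta>: "\<delta> > 0"
    and sep: "\<And>k l. k \<in> A \<Longrightarrow> l \<in> A \<Longrightarrow> k \<noteq> l \<Longrightarrow> \<bar>a k - a l\<bar> > \<delta>"
  shows "card A \<le> nat (\<lfloor>2 * L / \<delta>\<rfloor> + 1)"
proof -
  let ?g = "\<lambda>k. \<lfloor>(a k + L) / \<delta>\<rfloor>"
  have "inj_on ?g A"
  proof (rule inj_onI, rule ccontr)
    fix k l assume kl: "k \<in> A" "l \<in> A" "?g k = ?g l" "k \<noteq> l"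
    then have "\<bar>(a k + L) / \<delta> - (a l + L) / \<delta>\<bar> < 1" by linarith
    moreover have "(a k + L) / \<delta> - (a l + L) / \<delta> = (a k - a l) / \<delta>"
      by (simp add: diff_divide_distrib[symmetric])
    ultimately have "\<bar>a k - a l\<bar> < \<delta>" using \<delta> by (simp add: abs_divide)
    then show False using sep[OF kl(1,2,4)] by simp
  qed
  moreover have "?g ` A \<subseteq> {0..\<lfloor>2 * L / \<delta>\<rfloor>}"
  proof
    fix i assume "i \<in> ?g ` A"
    then obtain k where k: "k \<in> A" "i = ?g k" by auto
    have "0 \<le> (a k + L) / \<delta>" "(a k + L) / \<delta> \<le> 2 * L / \<delta>"
      using A(2)[OF k(1)] \<delta> by (auto intro!: divide_right_mono)
    then show "i \<in> {0..\<lfloor>2 * L / \<delta>\<rfloor>}"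
      by (auto simp: k(2) intro: floor_mono)
  qed
  ultimately have "card A \<le> card {0..\<lfloor>2 * L / \<delta>\<rfloor>}"
    by (metis card_image card_mono finite_atLeastAtMost_int)
  then show ?thesis by simp
qed

lemma sum_measure_le_multiplicity:
  fixes Q :: "nat \<Rightarrow> 'a::euclidean_space set"
  assumes Q: "\<And>k. Q k \<in> lmeasurable" "\<And>k. Q k \<subseteq> C" and C: "C \<in> lmeasurable"
    and mult: "\<And>y. y \<in> C \<Longrightarrow> card {k \<in> {..<n}. y \<in> Q k} \<le> M"
  shows "(\<Sum>k<n. measure lebesgue (Q k)) \<le> real M * measure lebesgue C"
proof -
  have int: "integrable lebesgue (indicat_real S)" if "S \<in> lmeasurable" for S :: "'a set"
    using that by (intro integrable_real_indicator) (auto simp: fmeasurable_def simp del: emeasure_completion)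
  have "(\<Sum>k<n. measure lebesgue (Q k)) = (\<Sum>k<n. \<integral>y. indicat_real (Q k) y \<partial>lebesgue)"
    by simp
  also have "\<dots> = (\<integral>y. (\<Sum>k<n. indicat_real (Q k) y) \<partial>lebesgue)"
    by (rule Bochner_Integration.integral_sum[symmetric]) (rule int[OF Q(1)])
  also have "\<dots> \<le> (\<integral>y. real M * indicat_real C y \<partial>lebesgue)"
  proof (rule integral_mono)
    fix y :: 'a
    have "(\<Sum>k<n. indicat_real (Q k) y) = real (card {k \<in> {..<n}. y \<in> Q k})"
      by (simp add: indicator_def sum.If_cases Int_def)
    then show "(\<Sum>k<n. indicat_real (Q k) y) \<le> real M * indicat_real C y"
      using mult[of y] Q(2) by (cases "y \<in> C") (auto simp: subset_iff)
  qed (use int Q C in auto)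
  also have "\<dots> = real M * measure lebesgue C" by simp
  finally show ?thesis .
qed

lemma negligible_infinitely_often:
  fixes P :: "nat \<Rightarrow> 'a::euclidean_space set"
  assumes P: "\<And>k. P k \<in> lmeasurable" and bdd: "\<And>n. (\<Sum>k<n. measure lebesgue (P k)) \<le> C"
  shows "negligible {y. \<exists>\<^sub>\<infinity>k. y \<in> P k}"
proof -
  have "AE y in lebesgue. eventually (\<lambda>k. y \<in> space lebesgue - P k) sequentially"
  proof (rule borel_cantelli_AE1)
    show "summable (\<lambda>k. measure lebesgue (P k))"
      using bdd by (intro summableI_nonneg_bounded) auto
  qed (use P in \<open>auto simp: fmeasurable_def simp del: emeasure_completion\<close>)
  then have "AE y in lebesgue. y \<notin> {y. \<exists>\<^sub>\<infinity>k. y \<in> P k}"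
    by eventually_elim (auto simp: cofinite_eq_sequentially frequently_def elim: eventually_mono)
  then show ?thesis
    by (simp add: negligible_iff_null_sets AE_iff_null_sets completion.AE_iff_null_sets eventually_ae_filter)
       (metis (no_types, lifting) completion.complete2 mem_Collect_eq null_sets_completionI subsetI)
qed

text \<open>The common abstraction of the flow on the ambient manifold and of its restriction to a leaf. The density \<open>\<rho> p\<close> is
the square of a volume density in the coordinates \<open>chart_at B p\<close>, defined on a neighbourhood \<open>N p\<close> of the
coordinates of \<open>p\<close>; the densities at different points are related only by the Jacobian condition. The last
condition is a substitute for compactness: while the cocycle stays bounded, orbits do not leave a
compact set.\<close>

locale scaling_flow =
  fixes B :: "('m, 'f::euclidean_space) atlas" and \<phi> :: "real \<Rightarrow> 'm \<Rightarrow> 'm" and r :: "real \<Rightarrow> 'm \<Rightarrow> real"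
    and N :: "'m \<Rightarrow> 'f set" and \<rho> :: "'m \<Rightarrow> 'f \<Rightarrow> real" and \<kappa> :: real
  assumes atlas: "smooth_atlas B" "second_countable (atlas_topology B)"
    and flow_0: "\<And>x. x \<in> points B \<Longrightarrow> \<phi> 0 x = x"
    and flow_add: "\<And>s t x. x \<in> points B \<Longrightarrow> \<phi> (s + t) x = \<phi> s (\<phi> t x)"
    and flow_diff: "\<And>t. differentiable_map B B (\<phi> t)"
    and r_add: "\<And>s t x. x \<in> points B \<Longrightarrow> r (s + t) x = r s (\<phi> t x) + r t x"
    and r_cont: "\<And>t c. c \<in> B \<Longrightarrow> continuous_on (coord c ` chart_domain c) (r t \<circ> chart_inv c)"
    and N: "\<And>p. p \<in> points B \<Longrightarrow> open (N p)" 
      "\<And>p. p \<in> points B \<Longrightarrow> coord (chart_at B p) p \<in> N p"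
      "\<And>p. p \<in> points B \<Longrightarrow> N p \<subseteq> coord (chart_at B p) ` chart_domain (chart_at B p)"
    and \<rho>_cont: "\<And>p. p \<in> points B \<Longrightarrow> continuous_on (N p) (\<rho> p)"
    and \<rho>_pos: "\<And>p y. p \<in> points B \<Longrightarrow> y \<in> N p \<Longrightarrow> \<rho> p y > 0"
    and jacobian: "\<And>p q t x. p \<in> points B \<Longrightarrow> q \<in> points B \<Longrightarrow>
        x \<in> chart_domain (chart_at B p) \<Longrightarrow> coord (chart_at B p) x \<in> N p \<Longrightarrow>
        \<phi> t x \<in> chart_domain (chart_at B q) \<Longrightarrow> coord (chart_at B q) (\<phi> t x) \<in> N q \<Longrightarrow>
        (ldet (rep_deriv (chart_at B p) (\<phi> t) (chart_at B q) x))\<^sup>2 * \<rho> q (coord (chart_at B q) (\<phi> t x)) =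
          exp (\<kappa> * r t x) * \<rho> p (coord (chart_at B p) x)"
    and exhaustion: "\<And>p L. p \<in> points B \<Longrightarrow> \<exists>U K. atlas_open B U \<and> p \<in> U \<and>
        compactin (atlas_topology B) K \<and> (\<forall>x\<in>U. \<forall>t. \<bar>r t x\<bar> \<le> L \<longrightarrow> \<phi> t x \<in> K)"
begin

lemma flow_points: "x \<in> points B \<Longrightarrow> \<phi> t x \<in> points B"
  using flow_diff[of t] by (auto simp: differentiable_map_def)

lemma r_0: "x \<in> points B \<Longrightarrow> r 0 x = 0"
  using r_add[of x 0 0] flow_0 by simp

lemma flow_inverse: "x \<in> points B \<Longrightarrow> \<phi> (- t) (\<phi> t x) = x" "x \<in> points B \<Longrightarrow> \<phi> t (\<phi> (- t) x) = x"
  using flow_add[of x "-t" t] flow_add[of x t "-t"] flow_0 by auto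

lemma r_inverse: "x \<in> points B \<Longrightarrow> r t (\<phi> (- t) x) = - r (- t) x"
  using r_add[of x t "- t"] r_0 by simp

definition separated_set :: "real \<Rightarrow> 'm set" where
  "separated_set \<delta> = {x \<in> points B. \<forall>j::nat. j \<ge> 1 \<longrightarrow> \<bar>r (real j) x\<bar> > \<delta>}"

text \<open>In the coordinates around \<open>z\<close>, the part in \<open>E\<close> of the set \<open>\<phi>\<^sub>-\<^sub>k(P\<^sub>k)\<close> of starting points in the Borel--Cantelli argument. The
corresponding part of \<open>P\<^sub>k\<close> is its image under the local representative of the time-\<open>k\<close> map.\<close>

definition hits :: "'m \<Rightarrow> 'f set \<Rightarrow> real \<Rightarrow> real \<Rightarrow> 'm \<Rightarrow> 'f set \<Rightarrow> nat \<Rightarrow> 'f set" where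
  "hits p D \<delta> L z E k = {y \<in> E. \<phi> k (chart_inv (chart_at B z) y) \<in> separated_set \<delta> \<and>
     \<bar>r k (chart_inv (chart_at B z) y)\<bar> \<le> L \<and>
     \<phi> k (chart_inv (chart_at B z) y) \<in> chart_domain (chart_at B p) \<and>
     local_rep (chart_at B z) (\<phi> k) (chart_at B p) y \<in> D}"

lemma lmeasurable_hits:
  assumes p: "p \<in> points B" and z: "z \<in> points B" and D: "closed D"
    and E: "compact E" "E \<subseteq> coord (chart_at B z) ` chart_domain (chart_at B z)"
  shows "hits p D \<delta> L z E k \<in> lmeasurable"
proof -
  let ?c = "chart_at B p" and ?d = "chart_at B z"
  let ?im = "coord ?d ` chart_domain ?d"
  let ?W = "coord ?d ` {x \<in> chart_domain ?d. \<phi> k x \<in> chart_domain ?c}"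
  note c = chart_at[OF p] and d = chart_at[OF z]
  have im: "open ?im" by (rule open_chart_image[OF atlas(1) d(1)])
  have W: "open ?W" by (rule differentiable_mapD(1)[OF flow_diff d(1) c(1)])
  have cont: "continuous_on ?W (local_rep ?d (\<phi> k) ?c)"
    using differentiable_mapD(2)[OF flow_diff d(1) c(1)]
    by (intro continuous_at_imp_continuous_on) (auto dest: has_derivative_continuous)
  have 1: "?W - (?W \<inter> local_rep ?d (\<phi> k) ?c -` (- D)) \<in> sets borel"
    using continuous_open_preimage[OF cont W, of "- D"] W D by (intro sets.Diff borel_open) auto
  have rc: "continuous_on ?im (r t \<circ> chart_inv ?d)" for t by (rule r_cont[OF d(1)])
  have 2: "?im \<inter> (\<lambda>y. \<bar>r (j + k) (chart_inv ?d y) - r k (chart_inv ?d y)\<bar>) -` {\<delta><..} \<in> sets borel" for j :: real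
    by (intro borel_open continuous_open_preimage im continuous_intros rc[unfolded o_def])
  have 3: "?im - (?im \<inter> (\<lambda>y. \<bar>r k (chart_inv ?d y)\<bar>) -` {L<..}) \<in> sets borel"
    by (intro sets.Diff borel_open continuous_open_preimage im continuous_intros rc[unfolded o_def])
  have "hits p D \<delta> L z E k = E \<inter> (?W - (?W \<inter> local_rep ?d (\<phi> k) ?c -` (- D))) \<inter>
      (\<Inter>j\<in>{1::nat..}. ?im \<inter> (\<lambda>y. \<bar>r (real j + k) (chart_inv ?d y) - r k (chart_inv ?d y)\<bar>) -` {\<delta><..}) \<inter>
      (?im - (?im \<inter> (\<lambda>y. \<bar>r k (chart_inv ?d y)\<bar>) -` {L<..}))" (is "_ = ?R")
  proof (intro set_eqI)
    fix y
    show "y \<in> hits p D \<delta> L z E k \<longleftrightarrow> y \<in> ?R"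
    proof (cases "y \<in> E")
      case True
      then obtain x where x: "x \<in> chart_domain ?d" "y = coord ?d x" using E by auto
      then have xB: "x \<in> points B" using chart_domain_points d by metis
      have y: "chart_inv ?d y = x" "y \<in> ?im" using x d atlas by auto
      have "y \<in> ?W \<longleftrightarrow> \<phi> k x \<in> chart_domain ?c"
      proof
        assume "y \<in> ?W"
        then obtain x' where x': "x' \<in> chart_domain ?d" "y = coord ?d x'" "\<phi> k x' \<in> chart_domain ?c" by auto
        then have "x' = x" using y(1) chart_inv_coord[OF atlas(1) d(1)] by metis
        then show "\<phi> k x \<in> chart_domain ?c" using x' by simp
      qed (use x in auto)
      moreover have "\<phi> k x \<in> separated_set \<delta> \<longleftrightarrow> (\<forall>j\<ge>1. \<bar>r (real j + k) x - r k x\<bar> > \<delta>)"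
        using flow_points[OF xB] r_add[OF xB] by (simp add: separated_set_def)
      ultimately show ?thesis using True y by (auto simp: hits_def)
    qed (auto simp: hits_def)
  qed
  moreover have "?R \<in> sets borel"
  proof (intro sets.Int[OF sets.Int[OF sets.Int[OF borel_compact[OF E(1)] 1] sets.countable_INT''] 3])
    show "?im \<inter> (\<lambda>y. \<bar>r (real j + k) (chart_inv ?d y) - r k (chart_inv ?d y)\<bar>) -` {\<delta><..} \<in> sets borel" for j
      by (rule 2)
  qed auto
  ultimately have "hits p D \<delta> L z E k \<in> sets lebesgue" by simp
  moreover have "bounded (hits p D \<delta> L z E k)"
    using E(1) by (rule bounded_subset[OF compact_imp_bounded]) (auto simp: hits_def)
  ultimately show ?thesis by (intro bounded_set_imp_lmeasurable)
qed

text \<open>At two hitting times \<open>l < k\<close> the values of the cocycle differ by its value at time \<open>k - l\<close> at a point of the separated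
set, hence by more than \<open>\<delta>\<close>.\<close>

lemma hits_multiplicity:
  assumes z: "z \<in> points B" and \<delta>: "\<delta> > 0"
    and E: "E \<subseteq> coord (chart_at B z) ` chart_domain (chart_at B z)" "y \<in> E"
  shows "card {k \<in> {..<n}. y \<in> hits p D \<delta> L z E k} \<le> nat (\<lfloor>2 * L / \<delta>\<rfloor> + 1)"
proof (rule card_separated_le[where a = "\<lambda>k. r (real k) (chart_inv (chart_at B z) y)"])
  let ?x = "chart_inv (chart_at B z) y"
  have x: "?x \<in> points B"
    using E chart_at[OF z] by (intro chart_domain_points[of "chart_at B z"] coord_chart_inv(2)) auto
  have lt: "\<bar>r (real k) ?x - r (real l) ?x\<bar> > \<delta>"
    if "k \<in> {k \<in> {..<n}. y \<in> hits p D \<delta> L z E k}" "l < k" "l \<in> {k \<in> {..<n}. y \<in> hits p D \<delta> L z E k}" for k l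
  proof -
    have "\<phi> l ?x \<in> separated_set \<delta>" "1 \<le> k - l" using that by (auto simp: hits_def)
    then have "\<bar>r (real (k - l)) (\<phi> l ?x)\<bar> > \<delta>"
      unfolding separated_set_def by blast
    moreover have "r (real (k - l)) (\<phi> l ?x) = r (real k) ?x - r (real l) ?x"
      using r_add[OF x, of "real (k - l)" l] that by (simp add: of_nat_diff)
    ultimately show ?thesis by simp
  qed
  show "\<bar>r (real k) ?x - r (real l) ?x\<bar> > \<delta>"
    if "k \<in> {k \<in> {..<n}. y \<in> hits p D \<delta> L z E k}" "l \<in> {k \<in> {..<n}. y \<in> hits p D \<delta> L z E k}" "k \<noteq> l" for k l
    using lt[of k l] lt[of l k] that by (cases "l < k") (auto simp: abs_minus_commute)
qed (use \<delta> in \<open>auto simp: hits_def\<close>)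

text \<open>On the compact sets \<open>D\<close> and \<open>E\<close> the densities are bounded away from \<open>0\<close> and \<open>\<infinity>\<close>, and \<open>\<bar>r\<^sub>k\<bar> \<le> L\<close> at hitting times;
so the Jacobian determinants of all the time-\<open>k\<close> maps involved have a common bound \<open>b\<close>. Together with the bounded
multiplicity, the images of the hitting sets have summable measures.\<close>

lemma negligible_hits:
  assumes p: "p \<in> points B" and z: "z \<in> points B" and \<delta>: "\<delta> > 0"
    and D: "compact D" "D \<subseteq> N p" and E: "compact E" "E \<subseteq> N z"
  shows "negligible {v. \<exists>\<^sub>\<infinity>k. v \<in> local_rep (chart_at B z) (\<phi> (real k)) (chart_at B p) ` hits p D \<delta> L z E k}"
proof -
  let ?c = "chart_at B p" and ?d = "chart_at B z"
  let ?f = "\<lambda>k::nat. local_rep ?d (\<phi> (real k)) ?c" and ?Q = "hits p D \<delta> L z E"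
  note c = chart_at[OF p] and d = chart_at[OF z]
  have E': "E \<subseteq> coord ?d ` chart_domain ?d" using E(2) N(3)[OF z] by simp
  have meas: "?Q k \<in> lmeasurable" for k
    using lmeasurable_hits[OF p z compact_imp_closed[OF D(1)] E(1) E'] .
  obtain M where M: "\<And>y. y \<in> E \<Longrightarrow> \<rho> z y \<le> M" "M > 0"
  proof -
    have "bounded (\<rho> z ` E)"
      by (intro compact_imp_bounded compact_continuous_image continuous_on_subset[OF \<rho>_cont[OF z]] E)
    then obtain M where "\<forall>y\<in>E. \<bar>\<rho> z y\<bar> \<le> M" by (auto simp: bounded_iff)
    then have "\<rho> z y \<le> max M 1" if "y \<in> E" for y using that by fastforce
    then show ?thesis using that[of "max M 1"] by auto
  qed
  obtain m where m: "\<And>y. y \<in> D \<Longrightarrow> m \<le> \<rho> p y" "m > 0"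
  proof (cases "D = {}")
    case False
    obtain y0 where "y0 \<in> D" "\<forall>y\<in>D. \<rho> p y0 \<le> \<rho> p y"
      using continuous_attains_inf[OF D(1) False continuous_on_subset[OF \<rho>_cont[OF p] D(2)]] by auto
    then show ?thesis using \<rho>_pos[OF p] D by (intro that[of "\<rho> p y0"]) auto
  qed (use that[of 1] in auto)
  define b where "b = sqrt (exp (\<bar>\<kappa>\<bar> * L) * M / m)"
  have der: "(?f k has_derivative rep_deriv ?d (\<phi> k) ?c (chart_inv ?d y)) (at y within ?Q k)" 
    and jac: "\<bar>ldet (rep_deriv ?d (\<phi> k) ?c (chart_inv ?d y))\<bar> \<le> b" if y: "y \<in> ?Q k" for k y
  proof -
    let ?x = "chart_inv ?d y"
    have yE: "y \<in> E" and x: "?x \<in> chart_domain ?d" "coord ?d ?x = y" using y E' by (auto simp: hits_def)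
    have px: "\<phi> k ?x \<in> chart_domain ?c" "coord ?c (\<phi> k ?x) \<in> D" "\<bar>r k ?x\<bar> \<le> L"
      using y by (auto simp: hits_def local_rep_apply)
    show "(?f k has_derivative rep_deriv ?d (\<phi> k) ?c ?x) (at y within ?Q k)"
      using differentiable_mapD(2)[OF flow_diff d(1) c(1) x(1) px(1)] x(2)
      by (auto intro: has_derivative_at_withinI)
    let ?J = "ldet (rep_deriv ?d (\<phi> k) ?c ?x)"
    have "?J\<^sup>2 * m \<le> ?J\<^sup>2 * \<rho> p (coord ?c (\<phi> k ?x))"
      using m(1)[OF px(2)] by (intro mult_left_mono) auto
    also have "\<dots> = exp (\<kappa> * r k ?x) * \<rho> z y"
      using jacobian[OF z p x(1) _ px(1)] px(2) D(2) E(2) yE x(2) by auto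
    also have "\<dots> \<le> exp (\<bar>\<kappa>\<bar> * L) * M"
    proof (rule mult_mono)
      have "\<kappa> * r k ?x \<le> \<bar>\<kappa>\<bar> * \<bar>r k ?x\<bar>" by (metis abs_ge_self abs_mult)
      also have "\<dots> \<le> \<bar>\<kappa>\<bar> * L" using px(3) by (intro mult_left_mono) auto
      finally show "exp (\<kappa> * r k ?x) \<le> exp (\<bar>\<kappa>\<bar> * L)" by simp
      show "0 \<le> \<rho> z y" using \<rho>_pos[OF z, of y] E(2) yE by auto
    qed (use M yE in auto)
    finally have "?J\<^sup>2 \<le> exp (\<bar>\<kappa>\<bar> * L) * M / m" using m(2) by (simp add: pos_le_divide_eq)
    then show "\<bar>?J\<bar> \<le> b" unfolding b_def by (metis real_sqrt_abs real_sqrt_le_iff)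
  qed
  show ?thesis
  proof (rule negligible_infinitely_often)
    show "?f k ` ?Q k \<in> lmeasurable" for k
      by (rule lmeasurable_image_bounded_ldet[OF meas der jac])
    fix n
    have "(\<Sum>k<n. measure lebesgue (?f k ` ?Q k)) \<le> (\<Sum>k<n. b * measure lebesgue (?Q k))"
      by (intro sum_mono measure_image_bounded_ldet[OF meas der jac])
    also have "\<dots> \<le> b * (real (nat (\<lfloor>2 * L / \<delta>\<rfloor> + 1)) * measure lebesgue E)"
      unfolding sum_distrib_left[symmetric]
    proof (rule mult_left_mono)
      show "(\<Sum>k<n. measure lebesgue (?Q k)) \<le> real (nat (\<lfloor>2 * L / \<delta>\<rfloor> + 1)) * measure lebesgue E"
        using E(1) by (intro sum_measure_le_multiplicity meas hits_multiplicity[OF z \<delta> E'] lmeasurable_compact)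
          (auto simp: hits_def)
      show "0 \<le> b" using m(2) M(2) by (simp add: b_def)
    qed
    finally show "(\<Sum>k<n. measure lebesgue (?f k ` ?Q k)) \<le> b * (real (nat (\<lfloor>2 * L / \<delta>\<rfloor> + 1)) * measure lebesgue E)" .
  qed
qed

text \<open>If \<open>\<bar>r\<^sub>-\<^sub>k(x)\<bar> \<le> L\<close>, then \<open>\<phi>\<^sub>-\<^sub>k(x)\<close> lies in a compact set. Finitely many coordinate balls cover that set, and one of
them contains \<open>\<phi>\<^sub>-\<^sub>k(x)\<close> for infinitely many of these \<open>k\<close>; so \<open>x\<close> is hit infinitely often from that
ball.\<close>

lemma zero_volume_separated_recurrent:
  assumes \<delta>: "\<delta> > 0"
  shows "zero_volume B {x \<in> separated_set \<delta>. \<exists>\<^sub>\<infinity>k. \<bar>r (- real k) x\<bar> \<le> L}" (is "zero_volume B ?S")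
proof (rule zero_volume_local[OF atlas])
  fix p assume "p \<in> ?S"
  then have p: "p \<in> points B" by (simp add: separated_set_def)
  let ?c = "chart_at B p"
  note c = chart_at[OF p]
  obtain U K where U: "atlas_open B U" "p \<in> U" and K: "compactin (atlas_topology B) K"
    and UK: "\<And>x t. x \<in> U \<Longrightarrow> \<bar>r t x\<bar> \<le> L \<Longrightarrow> \<phi> t x \<in> K"
    using exhaustion[OF p] by metis
  have "\<exists>e. q \<in> points B \<longrightarrow> e > 0 \<and> cball (coord (chart_at B q) q) e \<subseteq> N q" for q
    using N(1,2)[of q] by (meson open_contains_cball)
  then obtain e where e: "\<And>q. q \<in> points B \<Longrightarrow> e q > 0"
      "\<And>q. q \<in> points B \<Longrightarrow> cball (coord (chart_at B q) q) (e q) \<subseteq> N q"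
    by metis
  let ?E = "\<lambda>q. cball (coord (chart_at B q) q) (e q)"
  define O' where "O' q = {x \<in> chart_domain (chart_at B q). coord (chart_at B q) x \<in> ball (coord (chart_at B q) q) (e q)}" for q
  have O': "atlas_open B (O' q)" "q \<in> O' q" if "q \<in> points B" for q
    using that e(1)[OF that] atlas_open_chart_preimage[OF atlas(1) chart_at(1)[OF that] open_ball] chart_at[OF that]
    by (auto simp: O'_def)
  have KB: "K \<subseteq> points B" using K topspace_atlas[OF atlas(1)] by (auto simp: compactin_def)
  obtain Z where Z: "finite Z" "Z \<subseteq> K" "K \<subseteq> (\<Union>q\<in>Z. O' q)"
  proof -
    have "\<exists>F. finite F \<and> F \<subseteq> O' ` K \<and> K \<subseteq> \<Union>F"
    proof (rule compactinD[OF K])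
      show "openin (atlas_topology B) T" if "T \<in> O' ` K" for T
        using that O'(1) KB by (auto simp: openin_atlas_topology[OF atlas(1)])
      show "K \<subseteq> \<Union>(O' ` K)" using O'(2) KB by blast
    qed
    then show ?thesis using that by (metis finite_subset_image)
  qed
  let ?bad = "\<lambda>q. {v. \<exists>\<^sub>\<infinity>k. v \<in> local_rep (chart_at B q) (\<phi> (real k)) ?c ` hits p (?E p) \<delta> L q (?E q) k}"
  have neg: "negligible (\<Union>(?bad ` Z))"
  proof (intro negligible_Union finite_imageI Z(1))
    fix T assume "T \<in> ?bad ` Z"
    then obtain q where q: "q \<in> points B" and T: "T = ?bad q" using Z(2) KB by auto
    show "negligible T"
      unfolding T by (rule negligible_hits[OF p q \<delta> compact_cball e(2)[OF p] compact_cball e(2)[OF q]])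
  qed
  have "coord ?c x \<in> \<Union>(?bad ` Z)" if x: "x \<in> ?S" "x \<in> U" "x \<in> O' p" for x
  proof -
    have xB: "x \<in> points B" using x by (simp add: separated_set_def)
    have inf: "infinite {k. \<bar>r (- real k) x\<bar> \<le> L}" using x by (simp add: INFM_iff_infinite)
    have "\<phi> (- real k) x \<in> K" if "\<bar>r (- real k) x\<bar> \<le> L" for k
      using UK[OF x(2) that] .
    then have "{k. \<bar>r (- real k) x\<bar> \<le> L} \<subseteq> (\<Union>q\<in>Z. {k. \<bar>r (- real k) x\<bar> \<le> L \<and> \<phi> (- real k) x \<in> O' q})"
      using Z(3) by auto
    then obtain q where q: "q \<in> Z" "infinite {k. \<bar>r (- real k) x\<bar> \<le> L \<and> \<phi> (- real k) x \<in> O' q}"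
      using inf Z(1) by (meson finite_UN_I finite_subset)
    have qB: "q \<in> points B" using q Z KB by auto
    note d = chart_at[OF qB]
    have "coord ?c x \<in> local_rep (chart_at B q) (\<phi> (real k)) ?c ` hits p (?E p) \<delta> L q (?E q) k"
      if k: "\<bar>r (- real k) x\<bar> \<le> L" "\<phi> (- real k) x \<in> O' q" for k
    proof (rule image_eqI[where x = "coord (chart_at B q) (\<phi> (- real k) x)"])
      let ?y = "coord (chart_at B q) (\<phi> (- real k) x)"
      have inv: "chart_inv (chart_at B q) ?y = \<phi> (- real k) x"
        using k d atlas by (auto simp: O'_def)
      show "coord ?c x = local_rep (chart_at B q) (\<phi> (real k)) ?c ?y"
        by (simp add: local_rep_apply inv flow_inverse[OF xB])
      show "?y \<in> hits p (?E p) \<delta> L q (?E q) k"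
        using k x by (auto simp: hits_def local_rep_apply inv flow_inverse[OF xB] r_inverse[OF xB] O'_def less_imp_le)
    qed
    then have "\<exists>\<^sub>\<infinity>k. coord ?c x \<in> local_rep (chart_at B q) (\<phi> (real k)) ?c ` hits p (?E p) \<delta> L q (?E q) k"
      using q(2) unfolding INFM_iff_infinite by (metis (mono_tags, lifting) infinite_super mem_Collect_eq subsetI)
    then show ?thesis using q(1) by auto
  qed
  then have "negligible (coord ?c ` (?S \<inter> (U \<inter> O' p)))"
    by (intro negligible_subset[OF neg]) auto
  then have "zero_volume B (?S \<inter> (U \<inter> O' p))"
    by (intro zero_volume_chart[OF atlas(1) c(1)]) (auto simp: O'_def)
  moreover have "atlas_open B (U \<inter> O' p)"
    using U(1) O'(1)[OF p] atlas(1) by (metis openin_Int openin_atlas_topology)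
  ultimately show "\<exists>V. atlas_open B V \<and> p \<in> V \<and> zero_volume B (?S \<inter> V)"
    using U(2) O'(2)[OF p] by blast
qed

theorem zero_volume_escaping_recurrent:
  "zero_volume B {x \<in> points B. filterlim (\<lambda>k. \<bar>r (real k) x\<bar>) at_top sequentially \<and>
     \<not> filterlim (\<lambda>k. \<bar>r (- real k) x\<bar>) at_top sequentially}" (is "zero_volume B ?S")
proof -
  define R where "R m L = {x \<in> separated_set (1 / real (Suc m)). \<exists>\<^sub>\<infinity>k. \<bar>r (- real k) x\<bar> \<le> real L}" for m L :: nat
  let ?K = "(\<lambda>(k, m, L). \<phi> (- real k) ` R m L) ` (UNIV :: (nat \<times> nat \<times> nat) set)"
  have "zero_volume B (\<Union>?K)"
  proof (rule zero_volume_countable_Union)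
    fix T assume "T \<in> ?K"
    then obtain k m L where T: "T = \<phi> (- real k) ` R m L" by auto
    show "zero_volume B T"
      unfolding T
    proof (rule zero_volume_image[OF atlas flow_diff])
      show "zero_volume B (R m L)" unfolding R_def by (rule zero_volume_separated_recurrent) simp
    qed (auto simp: R_def separated_set_def)
  qed simp
  moreover have "?S \<subseteq> \<Union>?K"
  proof
    fix x assume "x \<in> ?S"
    then have x: "x \<in> points B" and lim: "filterlim (\<lambda>k. \<bar>r (real k) x\<bar>) at_top sequentially"
      and nlim: "\<not> filterlim (\<lambda>k. \<bar>r (- real k) x\<bar>) at_top sequentially" by auto
    have fin: "finite {k. \<bar>r (real k) x\<bar> \<le> a}" for a
    proof -
      have "eventually (\<lambda>k. \<bar>r (real k) x\<bar> \<ge> a + 1) sequentially"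
        using lim by (simp add: filterlim_at_top)
      then obtain n where "\<forall>k\<ge>n. \<bar>r (real k) x\<bar> \<ge> a + 1" by (auto simp: eventually_sequentially)
      then have "{k. \<bar>r (real k) x\<bar> \<le> a} \<subseteq> {..<n}" by (force simp: not_less[symmetric])
      then show ?thesis by (rule finite_subset) simp
    qed
    \<comment> \<open>the last zero of the cocycle: later values are nonzero and tend to infinity in absolute value, so
they are bounded away from zero\<close>
    have "0 \<in> {k. \<bar>r (real k) x\<bar> \<le> 0}" using r_0[OF x] by simp
    then obtain k0 where k0: "\<bar>r (real k0) x\<bar> \<le> 0" "\<And>k. \<bar>r (real k) x\<bar> \<le> 0 \<Longrightarrow> k \<le> k0"
      using fin[of 0] by (metis (mono_tags, lifting) Max_ge Max_in empty_iff mem_Collect_eq)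
    have rk0: "r (real k0) x = 0" using k0(1) by simp
    let ?x = "\<phi> k0 x"
    have rx: "r (real j) ?x = r (real (j + k0)) x" for j
      using r_add[OF x, of "real j" k0] rk0 by simp
    obtain m where m: "\<And>j. j \<ge> 1 \<Longrightarrow> \<bar>r (real j) ?x\<bar> > 1 / real (Suc m)"
    proof -
      let ?F = "(\<lambda>k. \<bar>r (real k) x\<bar>) ` ({k. \<bar>r (real k) x\<bar> \<le> 1} - {..k0})"
      have finF: "finite (insert 1 ?F)" using fin[of 1] by auto
      have "Min (insert 1 ?F) > 0"
      proof -
        have "a > 0" if "a \<in> insert 1 ?F" for a
          using that k0(2) by (force simp: not_le[symmetric])
        then show ?thesis using finF by (subst Min_gr_iff) auto
      qed
      then obtain m where m: "1 / real (Suc m) < Min (insert 1 ?F)"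
        using nat_approx_posE by blast
      have "\<bar>r (real j) ?x\<bar> > 1 / real (Suc m)" if "j \<ge> 1" for j
      proof (cases "\<bar>r (real (j + k0)) x\<bar> \<le> 1")
        case True
        then have "\<bar>r (real (j + k0)) x\<bar> \<in> ?F"
          using that by (intro imageI) auto
        then have "Min (insert 1 ?F) \<le> \<bar>r (real (j + k0)) x\<bar>"
          using finF by (intro Min_le) simp_all
        then show ?thesis using m rx by simp
      next
        case False
        have "Min (insert 1 ?F) \<le> 1" using finF by (intro Min_le) auto
        then show ?thesis using m rx False by simp
      qed
      then show ?thesis using that by blast
    qed
    have "\<exists>a. \<not> eventually (\<lambda>k. a \<le> \<bar>r (- real k) x\<bar>) sequentially"
      using nlim by (simp add: filterlim_at_top)
    then obtain a where a: "\<exists>\<^sub>\<infinity>k. \<bar>r (- real k) x\<bar> < a"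
      by (auto simp: not_eventually cofinite_eq_sequentially not_le)
    obtain L :: nat where L: "a \<le> real L" using real_arch_simple by blast
    have "\<exists>\<^sub>\<infinity>k. \<bar>r (- real k) ?x\<bar> \<le> real L"
    proof -
      have eq: "r (- real (k + k0)) ?x = r (- real k) x" for k
        using r_add[OF x, of "- real (k + k0)" k0] rk0 by simp
      have "infinite ((\<lambda>k. k + k0) ` {k. \<bar>r (- real k) x\<bar> < a})"
        using a by (simp add: INFM_iff_infinite finite_image_iff)
      moreover have "(\<lambda>k. k + k0) ` {k. \<bar>r (- real k) x\<bar> < a} \<subseteq> {k. \<bar>r (- real k) ?x\<bar> \<le> real L}"
        using L eq by auto
      ultimately show ?thesis unfolding INFM_iff_infinite using infinite_super by blast
    qed
    then have "?x \<in> R m L" using m flow_points[OF x] by (auto simp: R_def separated_set_def)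
    then have "x \<in> \<phi> (- real k0) ` R m L" by (intro image_eqI[of _ _ ?x]) (simp_all add: flow_inverse[OF x])
    then show "x \<in> \<Union>?K" by auto
  qed
  ultimately show ?thesis by (rule zero_volume_subset)
qed

lemma reversed: "scaling_flow B (\<lambda>t. \<phi> (- t)) (\<lambda>t. r (- t)) N \<rho> \<kappa>"
proof
  show "\<phi> (- (s + t)) x = \<phi> (- s) (\<phi> (- t) x)" "r (- (s + t)) x = r (- s) (\<phi> (- t) x) + r (- t) x"
    if "x \<in> points B" for s t x
    using flow_add[OF that, of "- s" "- t"] r_add[OF that, of "- s" "- t"] by simp_all
  show "\<exists>U K. atlas_open B U \<and> p \<in> U \<and> compactin (atlas_topology B) K \<and>
      (\<forall>x\<in>U. \<forall>t. \<bar>r (- t) x\<bar> \<le> L \<longrightarrow> \<phi> (- t) x \<in> K)" if "p \<in> points B" for p L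
    using exhaustion[OF that, of L] by metis
qed (use atlas flow_0 flow_diff r_cont N \<rho>_cont \<rho>_pos jacobian in auto)

theorem zero_volume_escape_times_differ:
  "zero_volume B {x \<in> points B. filterlim (\<lambda>k. \<bar>r (real k) x\<bar>) at_top sequentially \<noteq>
     filterlim (\<lambda>k. \<bar>r (- real k) x\<bar>) at_top sequentially}"
  by (rule zero_volume_subset[OF zero_volume_Un[OF zero_volume_escaping_recurrent
        scaling_flow.zero_volume_escaping_recurrent[OF reversed]]]) auto

end

section \<open>Second derivatives and scalar differential equations\<close>

lemma frechet_derivative_cong_open:
  assumes "open S" "x \<in> S" "\<And>y. y \<in> S \<Longrightarrow> f y = g y"
  shows "frechet_derivative f (at x) = frechet_derivative g (at x)"
proof -
  have "(f has_derivative D) (at x) \<longleftrightarrow> (g has_derivative D) (at x)" for D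
    using has_derivative_transform_within_open[OF _ assms(1,2), of f D UNIV g]
      has_derivative_transform_within_open[OF _ assms(1,2), of g D UNIV f] assms(3) by metis
  then show ?thesis by (simp add: frechet_derivative_def)
qed

lemma has_real_derivative_along_line:
  fixes f :: "'a::euclidean_space \<Rightarrow> real"
  assumes "f differentiable (at (x + t *\<^sub>R v))"
  shows "((\<lambda>t. f (x + t *\<^sub>R v)) has_real_derivative frechet_derivative f (at (x + t *\<^sub>R v)) v) (at t)"
proof -
  have "(f has_derivative frechet_derivative f (at (x + t *\<^sub>R v))) (at (x + t *\<^sub>R v))"
    using assms by (simp add: frechet_derivative_works)
  moreover have "((\<lambda>t. x + t *\<^sub>R v) has_derivative (\<lambda>h. h *\<^sub>R v)) (at t)"
    by (auto intro!: derivative_eq_intros)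
  ultimately have "((\<lambda>t. f (x + t *\<^sub>R v)) has_derivative
      (\<lambda>h. frechet_derivative f (at (x + t *\<^sub>R v)) (h *\<^sub>R v))) (at t)"
    using diff_chain_at[of "\<lambda>t. x + t *\<^sub>R v" _ t f] by (auto simp: o_def)
  moreover have "linear (frechet_derivative f (at (x + t *\<^sub>R v)))"
    using assms linear_frechet_derivative by blast
  ultimately show ?thesis
    by (simp add: has_field_derivative_def linear_cmul mult.commute[of _ "frechet_derivative _ _ _"])
qed

text \<open>Two applications of the mean value theorem. The left-hand side is symmetric in \<open>u\<close> and \<open>v\<close>, which gives the symmetry
of second derivatives by letting \<open>\<epsilon>\<close> tend to \<open>0\<close>.\<close>

lemma second_difference_mean_value:
  fixes f :: "'a::euclidean_space \<Rightarrow> real"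
  assumes \<epsilon>: "\<epsilon> > 0"
    and S: "\<And>s t. 0 \<le> s \<Longrightarrow> s \<le> \<epsilon> \<Longrightarrow> 0 \<le> t \<Longrightarrow> t \<le> \<epsilon> \<Longrightarrow> x + s *\<^sub>R u + t *\<^sub>R v \<in> S"
    and f: "\<And>y. y \<in> S \<Longrightarrow> f differentiable (at y)"
    and fu: "\<And>y. y \<in> S \<Longrightarrow> (\<lambda>y. frechet_derivative f (at y) u) differentiable (at y)"
  obtains s t where "0 \<le> s" "s \<le> \<epsilon>" "0 \<le> t" "t \<le> \<epsilon>"
    "f (x + \<epsilon> *\<^sub>R u + \<epsilon> *\<^sub>R v) - f (x + \<epsilon> *\<^sub>R u) - f (x + \<epsilon> *\<^sub>R v) + f x =
      \<epsilon> * \<epsilon> * frechet_derivative (\<lambda>y. frechet_derivative f (at y) u) (at (x + s *\<^sub>R u + t *\<^sub>R v)) v"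
proof -
  let ?g = "\<lambda>y. frechet_derivative f (at y) u"
  have d1: "((\<lambda>s. f (x + s *\<^sub>R u + t *\<^sub>R v)) has_real_derivative ?g (x + s *\<^sub>R u + t *\<^sub>R v)) (at s)"
    if "0 \<le> s" "s \<le> \<epsilon>" "0 \<le> t" "t \<le> \<epsilon>" for s t
    using has_real_derivative_along_line[of f "x + t *\<^sub>R v" s u] f[OF S[OF that]]
    by (simp add: add.assoc add.commute[of "t *\<^sub>R v"])
  let ?h = "\<lambda>s. f (x + s *\<^sub>R u + \<epsilon> *\<^sub>R v) - f (x + s *\<^sub>R u + 0 *\<^sub>R v)"
  have "\<exists>s>0. s < \<epsilon> \<and> ?h \<epsilon> - ?h 0 =
      (\<epsilon> - 0) * (?g (x + s *\<^sub>R u + \<epsilon> *\<^sub>R v) - ?g (x + s *\<^sub>R u + 0 *\<^sub>R v))"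
    using \<epsilon> by (intro MVT2 DERIV_diff d1) auto
  then obtain s where s: "0 < s" "s < \<epsilon>"
      "?h \<epsilon> - ?h 0 = \<epsilon> * (?g (x + s *\<^sub>R u + \<epsilon> *\<^sub>R v) - ?g (x + s *\<^sub>R u + 0 *\<^sub>R v))"
    by auto
  have "\<exists>t>0. t < \<epsilon> \<and> ?g (x + s *\<^sub>R u + \<epsilon> *\<^sub>R v) - ?g (x + s *\<^sub>R u + 0 *\<^sub>R v) =
      (\<epsilon> - 0) * frechet_derivative ?g (at (x + s *\<^sub>R u + t *\<^sub>R v)) v"
    using \<epsilon> s S by (intro MVT2 has_real_derivative_along_line fu) auto
  then obtain t where "0 < t" "t < \<epsilon>" "?g (x + s *\<^sub>R u + \<epsilon> *\<^sub>R v) - ?g (x + s *\<^sub>R u + 0 *\<^sub>R v) =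
      \<epsilon> * frechet_derivative ?g (at (x + s *\<^sub>R u + t *\<^sub>R v)) v"
    by auto
  with s show ?thesis by (intro that[of s t]) (auto simp: algebra_simps)
qed

lemma symmetric_second_derivative_real:
  fixes f :: "'a::euclidean_space \<Rightarrow> real"
  assumes S: "open S" "x \<in> S"
    and f: "\<And>y. y \<in> S \<Longrightarrow> f differentiable (at y)"
    and fd: "\<And>w y. y \<in> S \<Longrightarrow> (\<lambda>y. frechet_derivative f (at y) w) differentiable (at y)"
    and cont: "\<And>w w'. continuous_on S (\<lambda>y. frechet_derivative (\<lambda>y. frechet_derivative f (at y) w) (at y) w')"
  shows "frechet_derivative (\<lambda>y. frechet_derivative f (at y) u) (at x) v =
    frechet_derivative (\<lambda>y. frechet_derivative f (at y) v) (at x) u"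
proof (rule ccontr)
  let ?m = "\<lambda>w w' y. frechet_derivative (\<lambda>y. frechet_derivative f (at y) w) (at y) w'"
  assume neq: "?m u v x \<noteq> ?m v u x"
  define \<gamma> where "\<gamma> = \<bar>?m u v x - ?m v u x\<bar> / 2"
  have \<gamma>: "\<gamma> > 0" using neq by (simp add: \<gamma>_def)
  have "\<exists>d>0. \<forall>y. dist y x < d \<longrightarrow> y \<in> S \<and> \<bar>?m w w' y - ?m w w' x\<bar> < \<gamma>" for w w'
  proof -
    have "isCont (?m w w') x" using cont S continuous_on_eq_continuous_at by blast
    then obtain d1 where d1: "d1 > 0" "\<forall>y. dist y x < d1 \<longrightarrow> dist (?m w w' y) (?m w w' x) < \<gamma>"
      using \<gamma> by (auto simp: continuous_at_eps_delta dist_norm)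
    obtain d2 where d2: "d2 > 0" "\<forall>y. dist y x < d2 \<longrightarrow> y \<in> S"
      using S open_dist by blast
    show ?thesis using d1 d2 by (intro exI[of _ "min d1 d2"]) (auto simp: dist_real_def)
  qed
  from this[of u v] this[of v u] obtain d1 d2 where
    d: "d1 > 0" "d2 > 0" "\<And>y. dist y x < d1 \<Longrightarrow> y \<in> S \<and> \<bar>?m u v y - ?m u v x\<bar> < \<gamma>"
      "\<And>y. dist y x < d2 \<Longrightarrow> \<bar>?m v u y - ?m v u x\<bar> < \<gamma>"
    by blast
  define K where "K = norm u + norm v + 1"
  define \<epsilon> where "\<epsilon> = min d1 d2 / K / 2"
  have pos: "K > 0" unfolding K_def by (smt (verit) norm_ge_zero)
  have \<epsilon>: "\<epsilon> > 0" using d pos by (simp add: \<epsilon>_def)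
  have near: "dist (x + s *\<^sub>R u + t *\<^sub>R v) x < min d1 d2" if "0 \<le> s" "s \<le> \<epsilon>" "0 \<le> t" "t \<le> \<epsilon>" for s t
  proof -
    have "norm (s *\<^sub>R u + t *\<^sub>R v) \<le> s * norm u + t * norm v"
      using that norm_triangle_ineq[of "s *\<^sub>R u" "t *\<^sub>R v"] by simp
    also have "\<dots> \<le> \<epsilon> * norm u + \<epsilon> * norm v"
      using that by (intro add_mono mult_right_mono) auto
    also have "\<dots> \<le> \<epsilon> * K" using \<epsilon> by (simp add: K_def algebra_simps)
    also have "\<dots> = min d1 d2 / 2" using pos by (simp add: \<epsilon>_def)
    also have "\<dots> < min d1 d2" using d by auto
    finally show ?thesis by (simp add: dist_norm algebra_simps)
  qed
  obtain s t where 1: "0 \<le> s" "s \<le> \<epsilon>" "0 \<le> t" "t \<le> \<epsilon>"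
    "f (x + \<epsilon> *\<^sub>R u + \<epsilon> *\<^sub>R v) - f (x + \<epsilon> *\<^sub>R u) - f (x + \<epsilon> *\<^sub>R v) + f x = \<epsilon> * \<epsilon> * ?m u v (x + s *\<^sub>R u + t *\<^sub>R v)"
    by (rule second_difference_mean_value[of \<epsilon> x u v S f, OF \<epsilon> _ f fd]) (use near d in auto)
  obtain s' t' where 2: "0 \<le> s'" "s' \<le> \<epsilon>" "0 \<le> t'" "t' \<le> \<epsilon>"
    "f (x + \<epsilon> *\<^sub>R v + \<epsilon> *\<^sub>R u) - f (x + \<epsilon> *\<^sub>R v) - f (x + \<epsilon> *\<^sub>R u) + f x = \<epsilon> * \<epsilon> * ?m v u (x + s' *\<^sub>R v + t' *\<^sub>R u)"
  proof (rule second_difference_mean_value[of \<epsilon> x v u S f, OF \<epsilon> _ f fd])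
    fix s t assume "0 \<le> s" "s \<le> \<epsilon>" "0 \<le> t" "t \<le> \<epsilon>"
    then show "x + s *\<^sub>R v + t *\<^sub>R u \<in> S" using near[of t s] d(3)[of "x + t *\<^sub>R u + s *\<^sub>R v"] by (simp add: ac_simps)
  qed
  have "f (x + \<epsilon> *\<^sub>R u + \<epsilon> *\<^sub>R v) = f (x + \<epsilon> *\<^sub>R v + \<epsilon> *\<^sub>R u)" by (simp add: ac_simps)
  have "\<epsilon> * \<epsilon> * ?m u v (x + s *\<^sub>R u + t *\<^sub>R v) = \<epsilon> * \<epsilon> * ?m v u (x + t' *\<^sub>R u + s' *\<^sub>R v)"
  proof -
    have pt: "x + s' *\<^sub>R v + t' *\<^sub>R u = x + t' *\<^sub>R u + s' *\<^sub>R v" by simp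
    from \<open>f (x + \<epsilon> *\<^sub>R u + \<epsilon> *\<^sub>R v) = f (x + \<epsilon> *\<^sub>R v + \<epsilon> *\<^sub>R u)\<close> 1(5) 2(5)[unfolded pt] show ?thesis by linarith
  qed
  then have "?m u v (x + s *\<^sub>R u + t *\<^sub>R v) = ?m v u (x + t' *\<^sub>R u + s' *\<^sub>R v)" using \<epsilon> by simp
  moreover have "\<bar>?m u v (x + s *\<^sub>R u + t *\<^sub>R v) - ?m u v x\<bar> < \<gamma>"
    using d(3) near[OF 1(1-4)] by simp
  moreover have "\<bar>?m v u (x + t' *\<^sub>R u + s' *\<^sub>R v) - ?m v u x\<bar> < \<gamma>"
    using d(4) near[OF 2(3,4,1,2)] by simp
  moreover have "\<bar>a - b\<bar> < \<gamma> \<Longrightarrow> \<bar>a - c\<bar> < \<gamma> \<Longrightarrow> \<bar>b - c\<bar> < 2 * \<gamma>" for a b c :: real by linarith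
  ultimately have "\<bar>?m u v x - ?m v u x\<bar> < 2 * \<gamma>" by metis
  then show False by (simp add: \<gamma>_def)
qed

text \<open>Reduction to the real-valued case by taking components.\<close>

lemma smooth_on_symmetric_second_derivative:
  fixes f :: "'a::euclidean_space \<Rightarrow> 'b::euclidean_space"
  assumes f: "smooth_on S f" and S: "open S" "x \<in> S"
  shows "frechet_derivative (\<lambda>y. frechet_derivative f (at y) u) (at x) v =
    frechet_derivative (\<lambda>y. frechet_derivative f (at y) v) (at x) u"
proof (rule euclidean_eqI)
  fix b :: 'b assume "b \<in> Basis"
  have comp: "frechet_derivative (\<lambda>y. g y \<bullet> b) (at y) w = frechet_derivative g (at y) w \<bullet> b"
    "(\<lambda>y. g y \<bullet> b) differentiable (at y)"
    if "g differentiable (at y)" for g :: "'a \<Rightarrow> 'b" and y w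
  proof -
    have "((\<lambda>y. g y \<bullet> b) has_derivative (\<lambda>w. frechet_derivative g (at y) w \<bullet> b)) (at y)"
      using that by (intro has_derivative_inner_left) (simp add: frechet_derivative_works)
    then show "frechet_derivative (\<lambda>y. g y \<bullet> b) (at y) w = frechet_derivative g (at y) w \<bullet> b"
      "(\<lambda>y. g y \<bullet> b) differentiable (at y)"
      by (auto simp: frechet_derivative_at[symmetric] differentiable_def)
  qed
  let ?f = "\<lambda>y. f y \<bullet> b"
  note f0 = smooth_on_differentiable[OF f] and f1 = smooth_on_differentiable[OF smooth_on_derivative[OF f]]
  have e1: "frechet_derivative ?f (at y) w = frechet_derivative f (at y) w \<bullet> b" if "y \<in> S" for y w
    by (rule comp(1)[OF f0[OF that]])
  have e2: "frechet_derivative (\<lambda>y. frechet_derivative ?f (at y) w) (at y) w' =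
      frechet_derivative (\<lambda>y. frechet_derivative f (at y) w) (at y) w' \<bullet> b" if "y \<in> S" for y w w'
    using frechet_derivative_cong_open[OF S(1) that, of "\<lambda>y. frechet_derivative ?f (at y) w" "\<lambda>y. frechet_derivative f (at y) w \<bullet> b", OF e1]
      comp(1)[OF f1[OF that]] by simp
  have "frechet_derivative (\<lambda>y. frechet_derivative ?f (at y) u) (at x) v =
    frechet_derivative (\<lambda>y. frechet_derivative ?f (at y) v) (at x) u"
  proof (rule symmetric_second_derivative_real[OF S])
    show "?f differentiable (at y)" if "y \<in> S" for y by (rule comp(2)[OF f0[OF that]])
    show "(\<lambda>y. frechet_derivative ?f (at y) w) differentiable (at y)" if yS: "y \<in> S" for w y
    proof -
      obtain D where "((\<lambda>y. frechet_derivative f (at y) w \<bullet> b) has_derivative D) (at y)"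
        using comp(2)[OF f1[OF yS, of w]] unfolding differentiable_def by blast
      then have "((\<lambda>y. frechet_derivative ?f (at y) w) has_derivative D) (at y)"
        by (rule has_derivative_transform_within_open[OF _ S(1) yS]) (simp add: e1)
      then show ?thesis unfolding differentiable_def by blast
    qed
    fix w w'
    have "continuous_on S (\<lambda>y. frechet_derivative (\<lambda>y. frechet_derivative f (at y) w) (at y) w' \<bullet> b)"
      by (intro continuous_on_inner continuous_on_const smooth_on_continuous smooth_on_derivative f)
    then show "continuous_on S (\<lambda>y. frechet_derivative (\<lambda>y. frechet_derivative ?f (at y) w) (at y) w')"
      by (rule continuous_on_eq) (simp add: e2)
  qed
  then show "frechet_derivative (\<lambda>y. frechet_derivative f (at y) u) (at x) v \<bullet> b =
    frechet_derivative (\<lambda>y. frechet_derivative f (at y) v) (at x) u \<bullet> b"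
    by (simp add: e2 S(2))
qed

lemma Ck_on_cong:
  assumes "open S"
  shows "Ck_on k S f \<Longrightarrow> (\<And>x. x \<in> S \<Longrightarrow> f x = g x) \<Longrightarrow> Ck_on k S g"
proof (induction k arbitrary: f g)
  case 0
  then show ?case by (auto intro: continuous_on_eq)
next
  case (Suc k)
  have "g differentiable (at x)" if "x \<in> S" for x
  proof -
    have "f differentiable (at x)" using Suc.prems(1) \<open>x \<in> S\<close> unfolding Ck_on.simps by blast
    then obtain D where "(f has_derivative D) (at x)" unfolding differentiable_def by blast
    then have "(g has_derivative D) (at x)"
      by (rule has_derivative_transform_within_open[OF _ assms \<open>x \<in> S\<close>]) (rule Suc.prems(2))
    then show ?thesis unfolding differentiable_def by blast
  qed
  moreover have "Ck_on k S (\<lambda>x. frechet_derivative g (at x) v)" for v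
  proof (rule Suc.IH)
    show "Ck_on k S (\<lambda>x. frechet_derivative f (at x) v)" using Suc.prems(1) unfolding Ck_on.simps by blast
    show "frechet_derivative f (at x) v = frechet_derivative g (at x) v" if "x \<in> S" for x
      using frechet_derivative_cong_open[OF assms that Suc.prems(2)] by simp
  qed
  ultimately show ?case by simp
qed

lemma smooth_on_cong:
  "smooth_on S f \<Longrightarrow> open S \<Longrightarrow> (\<And>x. x \<in> S \<Longrightarrow> f x = g x) \<Longrightarrow> smooth_on S g"
  unfolding smooth_on_def using Ck_on_cong by metis

lemma bilinear_expand:
  fixes \<beta> :: "'a::euclidean_space \<Rightarrow> 'b::euclidean_space \<Rightarrow> real"
  assumes "bilinear \<beta>"
  shows "\<beta> u v = (\<Sum>i\<in>Basis. \<Sum>j\<in>Basis. (u \<bullet> i) * (v \<bullet> j) * \<beta> i j)"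
proof -
  have "\<beta> u v = \<beta> (\<Sum>i\<in>Basis. (u \<bullet> i) *\<^sub>R i) (\<Sum>j\<in>Basis. (v \<bullet> j) *\<^sub>R j)"
    by (simp add: euclidean_representation)
  also have "\<dots> = (\<Sum>i\<in>Basis. \<Sum>j\<in>Basis. (u \<bullet> i) * (v \<bullet> j) * \<beta> i j)"
    by (subst bilinear_sum[OF assms]) (simp add: sum.cartesian_product split_def bilinear_lmul[OF assms] bilinear_rmul[OF assms] mult.assoc mult.left_commute)
  finally show ?thesis .
qed

text \<open>The product rule for \<open>\<beta>(Y; U, V)\<close> when \<open>\<beta>\<close> is bilinear only for base points in \<open>S\<close>. In the first summand the vectors
\<open>U\<close> and \<open>V\<close> are frozen, which is how exterior derivatives are computed in coordinates.\<close>

lemma bilinear_family_has_derivative: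
  fixes \<beta> :: "'c::euclidean_space \<Rightarrow> 'a::euclidean_space \<Rightarrow> 'b::euclidean_space \<Rightarrow> real"
    and Y :: "'z::real_normed_vector \<Rightarrow> 'c"
  assumes S: "open S" "Y z \<in> S" and bil: "\<And>y. y \<in> S \<Longrightarrow> bilinear (\<beta> y)"
    and diff: "\<And>a b. (\<lambda>y. \<beta> y a b) differentiable (at (Y z))"
    and Y: "(Y has_derivative Y') (at z)" and U: "(U has_derivative U') (at z)"
    and V: "(V has_derivative V') (at z)"
  shows "((\<lambda>z. \<beta> (Y z) (U z) (V z)) has_derivative (\<lambda>w.
     frechet_derivative (\<lambda>y. \<beta> y (U z) (V z)) (at (Y z)) (Y' w) + \<beta> (Y z) (U' w) (V z) + \<beta> (Y z) (U z) (V' w))) (at z)"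
proof -
  let ?D = "\<lambda>a b. frechet_derivative (\<lambda>y. \<beta> y a b) (at (Y z))"
  have D: "((\<lambda>y. \<beta> y a b) has_derivative ?D a b) (at (Y z))" for a b
    using diff by (simp add: frechet_derivative_works)
  have Dexp: "?D a b w = (\<Sum>i\<in>Basis. \<Sum>j\<in>Basis. (a \<bullet> i) * (b \<bullet> j) * ?D i j w)" for a b w
  proof -
    have "((\<lambda>y. \<Sum>i\<in>Basis. \<Sum>j\<in>Basis. (a \<bullet> i) * (b \<bullet> j) * \<beta> y i j) has_derivative
        (\<lambda>w. \<Sum>i\<in>Basis. \<Sum>j\<in>Basis. (a \<bullet> i) * (b \<bullet> j) * ?D i j w)) (at (Y z))"
      by (intro has_derivative_sum has_derivative_mult_right D)
    then have "((\<lambda>y. \<beta> y a b) has_derivative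
        (\<lambda>w. \<Sum>i\<in>Basis. \<Sum>j\<in>Basis. (a \<bullet> i) * (b \<bullet> j) * ?D i j w)) (at (Y z))"
      by (rule has_derivative_transform_within_open[OF _ S]) (rule bilinear_expand[OF bil, symmetric])
    from frechet_derivative_at[OF this, symmetric] show ?thesis by simp
  qed
  have \<beta>Y: "((\<lambda>z. \<beta> (Y z) i j) has_derivative (\<lambda>w. ?D i j (Y' w))) (at z)" for i j
    using diff_chain_at[OF Y D] by (simp add: o_def)
  have 1: "((\<lambda>z. \<Sum>i\<in>Basis. \<Sum>j\<in>Basis. (U z \<bullet> i) * (V z \<bullet> j) * \<beta> (Y z) i j) has_derivative
    (\<lambda>w. \<Sum>i\<in>Basis. \<Sum>j\<in>Basis. (U z \<bullet> i) * (V z \<bullet> j) * ?D i j (Y' w) +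
      ((U z \<bullet> i) * (V' w \<bullet> j) + (U' w \<bullet> i) * (V z \<bullet> j)) * \<beta> (Y z) i j)) (at z)"
    by (intro has_derivative_sum has_derivative_mult \<beta>Y has_derivative_inner_left U V)
  have "continuous (at z) Y" using Y has_derivative_continuous by blast
  then have ev: "eventually (\<lambda>z. Y z \<in> S) (at z)"
    using S by (metis continuous_at topological_tendstoD)
  have 2: "((\<lambda>z. \<beta> (Y z) (U z) (V z)) has_derivative
    (\<lambda>w. \<Sum>i\<in>Basis. \<Sum>j\<in>Basis. (U z \<bullet> i) * (V z \<bullet> j) * ?D i j (Y' w) +
      ((U z \<bullet> i) * (V' w \<bullet> j) + (U' w \<bullet> i) * (V z \<bullet> j)) * \<beta> (Y z) i j)) (at z)"
    by (rule has_derivative_transform_eventually[OF 1])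
      (use ev S bilinear_expand[OF bil] in \<open>auto elim!: eventually_mono\<close>)
  show ?thesis
  proof (rule has_derivative_eq_rhs[OF 2], rule ext)
    fix w
    show "(\<Sum>i\<in>Basis. \<Sum>j\<in>Basis. (U z \<bullet> i) * (V z \<bullet> j) * ?D i j (Y' w) +
      ((U z \<bullet> i) * (V' w \<bullet> j) + (U' w \<bullet> i) * (V z \<bullet> j)) * \<beta> (Y z) i j) =
      ?D (U z) (V z) (Y' w) + \<beta> (Y z) (U' w) (V z) + \<beta> (Y z) (U z) (V' w)"
      unfolding Dexp[of "U z" "V z"] bilinear_expand[OF bil[OF S(2)], of "U' w" "V z"]
        bilinear_expand[OF bil[OF S(2)], of "U z" "V' w"]
      by (simp add: sum.distrib[symmetric] algebra_simps)
  qed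
qed

lemma exponential_solution:
  fixes g r F :: "real \<Rightarrow> real"
  assumes r: "\<And>t. (r has_real_derivative F t) (at t)" "r 0 = 0"
    and g: "\<And>t. (g has_real_derivative F t * g t) (at t)"
  shows "g t = exp (r t) * g 0"
proof -
  have "((\<lambda>t. exp (- r t) * g t) has_real_derivative 0) (at t)" for t
    by (rule derivative_eq_intros r g refl | simp add: algebra_simps)+
  then have "exp (- r t) * g t = exp (- r 0) * g 0"
    by (intro DERIV_const_ratio_const[of t 0 _ 0, THEN eq_reflection, THEN meta_eq_to_obj_eq] DERIV_isconst_all) auto
  then show ?thesis by (simp add: r(2) exp_minus field_simps)
qed

section \<open>The Hamiltonian flow of a conformal symplectic form\<close>

locale hamiltonian_flow =
  fixes A :: "('m, 'e::euclidean_space) atlas" and \<eta> :: "('m, 'e) form1" and \<omega> :: "('m, 'e) form2"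
    and H :: "'m \<Rightarrow> real" and X :: "'m \<Rightarrow> 'e" and \<phi> :: "real \<Rightarrow> 'm \<Rightarrow> 'm"
  assumes conformal: "conformal_symplectic A \<eta> \<omega>" and H_smooth: "smooth_map A real_atlas H"
    and hamiltonian: "hamiltonian_vector_field A \<eta> \<omega> H X" and flow: "flow_of A X \<phi>"
begin

lemma atlas: "smooth_atlas A" "second_countable (atlas_topology A)"
  using conformal by (auto simp: conformal_symplectic_def manifold_def)

lemma flow_0: "x \<in> points A \<Longrightarrow> \<phi> 0 x = x"
  and flow_add: "x \<in> points A \<Longrightarrow> \<phi> (s + t) x = \<phi> s (\<phi> t x)"
  using flow by (auto simp: flow_of_def)

definition time_domain :: "('m, 'e) chart \<Rightarrow> ('m, 'e) chart \<Rightarrow> (real \<times> 'e) set" where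
  "time_domain c d = {(t, y). y \<in> coord c ` chart_domain c \<and> \<phi> t (chart_inv c y) \<in> chart_domain d}"

definition flow_rep :: "('m, 'e) chart \<Rightarrow> ('m, 'e) chart \<Rightarrow> real \<times> 'e \<Rightarrow> 'e" where
  "flow_rep c d = (\<lambda>(t, y). coord d (\<phi> t (chart_inv c y)))"

lemma flow_points: "x \<in> points A \<Longrightarrow> \<phi> t x \<in> points A"
proof -
  assume "x \<in> points A"
  then have "(t, x) \<in> points (prod_atlas real_atlas A)"
    by (auto simp: points_def prod_atlas_def real_atlas_def)
  moreover have "(\<lambda>(t, x). \<phi> t x) \<in> points (prod_atlas real_atlas A) \<rightarrow> points A"
    using flow unfolding flow_of_def smooth_map_def by blast
  ultimately show ?thesis using funcset_mem by fastforce
qed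

lemma open_time_domain: "c \<in> A \<Longrightarrow> d \<in> A \<Longrightarrow> open (time_domain c d)"
  and smooth_flow_rep: "c \<in> A \<Longrightarrow> d \<in> A \<Longrightarrow> smooth_on (time_domain c d) (flow_rep c d)"
proof -
  assume c: "c \<in> A" and d: "d \<in> A"
  let ?C = "Chart (UNIV \<times> chart_domain c) (map_prod (\<lambda>t :: real. t) (coord c))"
  let ?W = "coord ?C ` {z \<in> chart_domain ?C. (\<lambda>(t, x). \<phi> t x) z \<in> chart_domain d}"
  have C: "?C \<in> prod_atlas real_atlas A"
    unfolding prod_atlas_def real_atlas_def using c
    by (intro CollectI exI[of _ "Chart UNIV (\<lambda>t. t)"] exI[of _ c]) simp
  have W: "?W = time_domain c d"
    using atlas c by (force simp: time_domain_def image_iff)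
  have inj: "inj_on (coord ?C) (chart_domain ?C)"
    using atlas(1) c by (auto simp: inj_on_def smooth_atlas_def)
  have inv: "chart_inv ?C (t, y) = (t, chart_inv c y)" if "y \<in> coord c ` chart_domain c" for t y
    unfolding chart_inv_def[of ?C] using that by (intro inv_into_f_eq[OF inj]) auto
  have "open ?W \<and> smooth_on ?W (coord d \<circ> (\<lambda>(t, x). \<phi> t x) \<circ> chart_inv ?C)"
    using flow C d unfolding flow_of_def smooth_map_def Let_def by blast
  then have *: "open (time_domain c d)"
    "smooth_on (time_domain c d) (coord d \<circ> (\<lambda>(t, x). \<phi> t x) \<circ> chart_inv ?C)"
    unfolding W by auto
  show "open (time_domain c d)" by (rule *)
  show "smooth_on (time_domain c d) (flow_rep c d)"
    by (rule smooth_on_cong[OF *(2,1)]) (auto simp: time_domain_def inv flow_rep_def)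
qed

lemma flow_rep_has_derivative:
  assumes "c \<in> A" "d \<in> A" "x \<in> chart_domain c" "\<phi> t x \<in> chart_domain d"
  shows "(flow_rep c d has_derivative frechet_derivative (flow_rep c d) (at (t, coord c x))) (at (t, coord c x))"
  using assms atlas by (intro smooth_on_has_derivative[OF smooth_flow_rep]) (auto simp: time_domain_def)

lemma differentiable_flow: "differentiable_map A A (\<phi> t)"
  and rep_deriv_flow: "c \<in> A \<Longrightarrow> d \<in> A \<Longrightarrow> x \<in> chart_domain c \<Longrightarrow> \<phi> t x \<in> chart_domain d \<Longrightarrow>
    rep_deriv c (\<phi> t) d x u = frechet_derivative (flow_rep c d) (at (t, coord c x)) (0, u)"
proof -
  have der: "(local_rep c (\<phi> t) d has_derivative (\<lambda>u. frechet_derivative (flow_rep c d) (at (t, coord c x)) (0, u)))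
      (at (coord c x))"
    if "c \<in> A" "d \<in> A" "x \<in> chart_domain c" "\<phi> t x \<in> chart_domain d" for c d x
  proof -
    have "((\<lambda>y. (t, y)) has_derivative (\<lambda>u. (0, u))) (at (coord c x))"
      by (auto intro!: derivative_eq_intros)
    from diff_chain_at[OF this] flow_rep_has_derivative[OF that]
    have "((flow_rep c d \<circ> (\<lambda>y. (t, y))) has_derivative
      (frechet_derivative (flow_rep c d) (at (t, coord c x)) \<circ> (\<lambda>u. (0, u)))) (at (coord c x))" by blast
    moreover have "flow_rep c d \<circ> (\<lambda>y. (t, y)) = local_rep c (\<phi> t) d"
      by (auto simp: flow_rep_def local_rep_apply)
    ultimately show ?thesis by (simp add: o_def)
  qed
  have "open (coord c ` {x \<in> chart_domain c. \<phi> t x \<in> chart_domain d})" if "c \<in> A" "d \<in> A" for c d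
  proof -
    have "open ((\<lambda>y. (t, y)) -` time_domain c d)"
      by (intro open_vimage open_time_domain that continuous_intros)
    also have "(\<lambda>y. (t, y)) -` time_domain c d = coord c ` {x \<in> chart_domain c. \<phi> t x \<in> chart_domain d}"
      using atlas that by (auto simp: time_domain_def)
    finally show ?thesis .
  qed
  with der show "differentiable_map A A (\<phi> t)"
    by (auto simp: differentiable_map_def flow_points differentiable_def)
  show "rep_deriv c (\<phi> t) d x u = frechet_derivative (flow_rep c d) (at (t, coord c x)) (0, u)"
    if "c \<in> A" "d \<in> A" "x \<in> chart_domain c" "\<phi> t x \<in> chart_domain d"
    using frechet_derivative_at[OF der[OF that], symmetric] by (simp add: rep_deriv_def)
qed

lemma open_flow_times:
  assumes x: "x \<in> points A" and d: "d \<in> A"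
  shows "open {s. \<phi> s x \<in> chart_domain d}"
proof -
  note b = chart_at[OF x]
  have "open ((\<lambda>s. (s, coord (chart_at A x) x)) -` time_domain (chart_at A x) d)"
    by (intro open_vimage open_time_domain b d continuous_intros)
  also have "(\<lambda>s. (s, coord (chart_at A x) x)) -` time_domain (chart_at A x) d = {s. \<phi> s x \<in> chart_domain d}"
    using atlas b by (auto simp: time_domain_def)
  finally show ?thesis .
qed

definition local_field :: "('m, 'e) chart \<Rightarrow> 'e \<Rightarrow> 'e" where
  "local_field c y = coords_of_tangent A c (chart_inv c y) (X (chart_inv c y))"

lemma smooth_local_field: "c \<in> A \<Longrightarrow> smooth_on (coord c ` chart_domain c) (local_field c)"
  using hamiltonian unfolding hamiltonian_vector_field_def vector_field_def local_field_def by blast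

lemma flow_chart_derivative:
  assumes x: "x \<in> points A" and c: "c \<in> A" "\<phi> t x \<in> chart_domain c"
  shows "((\<lambda>s. coord c (\<phi> s x)) has_vector_derivative local_field c (coord c (\<phi> t x))) (at t)"
proof -
  let ?d = "chart_at A (\<phi> t x)"
  note d = chart_at[OF flow_points[OF x, of t]]
  have "((\<lambda>s. coord ?d (\<phi> s x)) has_derivative (\<lambda>h. h *\<^sub>R X (\<phi> t x))) (at t)"
    using flow x by (simp add: flow_of_def has_vector_derivative_def)
  from diff_chain_at[OF this differentiable_mapD(2)[OF differentiable_map_ident[OF atlas(1)] d(1) c(1) d(2) c(2)]]
  have "((local_rep ?d (\<lambda>x. x) c \<circ> (\<lambda>s. coord ?d (\<phi> s x))) has_derivative
      (rep_deriv ?d (\<lambda>x. x) c (\<phi> t x) \<circ> (\<lambda>h. h *\<^sub>R X (\<phi> t x)))) (at t)" .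
  then have "((\<lambda>s. coord c (\<phi> s x)) has_derivative (rep_deriv ?d (\<lambda>x. x) c (\<phi> t x) \<circ> (\<lambda>h. h *\<^sub>R X (\<phi> t x)))) (at t)"
    by (rule has_derivative_transform_within_open[OF _ open_flow_times[OF x d(1)]])
      (use atlas d in \<open>auto simp: local_rep_apply\<close>)
  moreover have "rep_deriv ?d (\<lambda>x. x) c (\<phi> t x) \<circ> (\<lambda>h. h *\<^sub>R X (\<phi> t x)) = (\<lambda>h. h *\<^sub>R local_field c (coord c (\<phi> t x)))"
    using linear_rep_deriv[OF differentiable_map_ident[OF atlas(1)] d(1) c(1) d(2) c(2)] atlas c
    by (auto simp: local_field_def coords_of_tangent_eq linear_cmul)
  ultimately show ?thesis by (simp add: has_vector_derivative_def)
qed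

lemma flow_rep_time_derivative:
  assumes c: "c \<in> A" and d: "d \<in> A" and z: "z \<in> time_domain c d"
  shows "frechet_derivative (flow_rep c d) (at z) (1, 0) = local_field d (flow_rep c d z)"
proof -
  obtain t y where ty: "z = (t, y)" "y \<in> coord c ` chart_domain c" "\<phi> t (chart_inv c y) \<in> chart_domain d"
    using z by (auto simp: time_domain_def)
  let ?x = "chart_inv c y"
  have x: "?x \<in> chart_domain c" "coord c ?x = y" using ty by auto
  have "((\<lambda>s. (s, y)) has_derivative (\<lambda>h. (h, 0))) (at t)"
    by (auto intro!: derivative_eq_intros)
  from diff_chain_at[OF this] flow_rep_has_derivative[OF c d x(1) ty(3)]
  have "((flow_rep c d \<circ> (\<lambda>s. (s, y))) has_derivative (frechet_derivative (flow_rep c d) (at (t, y)) \<circ> (\<lambda>h. (h, 0)))) (at t)"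
    by (simp add: x(2))
  moreover have "flow_rep c d \<circ> (\<lambda>s. (s, y)) = (\<lambda>s. coord d (\<phi> s ?x))"
    by (auto simp: flow_rep_def)
  moreover have "((\<lambda>s. coord d (\<phi> s ?x)) has_derivative (\<lambda>h. h *\<^sub>R local_field d (coord d (\<phi> t ?x)))) (at t)"
    using flow_chart_derivative[OF chart_domain_points[OF c x(1)] d ty(3)] by (simp add: has_vector_derivative_def)
  ultimately have "(frechet_derivative (flow_rep c d) (at (t, y)) \<circ> (\<lambda>h. (h, 0))) =
      (\<lambda>h. h *\<^sub>R local_field d (coord d (\<phi> t ?x)))"
    by (metis has_derivative_unique)
  from fun_cong[OF this, of 1] show ?thesis by (simp add: ty flow_rep_def)
qed

lemma tangent_map_flow_0: "x \<in> points A \<Longrightarrow> tangent_map A A (\<phi> 0) x u = u"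
proof -
  assume x: "x \<in> points A"
  note c = chart_at[OF x]
  have "rep_deriv (chart_at A x) (\<phi> 0) (chart_at A x) x u = rep_deriv (chart_at A x) (\<lambda>x. x) (chart_at A x) x u"
    unfolding rep_deriv_def
    by (rule fun_cong, rule frechet_derivative_cong_open[OF open_chart_image[OF atlas(1) c(1)]])
      (use c flow_0 chart_domain_points[OF c(1)] atlas(1) in \<open>auto simp: local_rep_apply\<close>)
  then show ?thesis by (simp add: tangent_map_eq flow_0[OF x] rep_deriv_ident[OF atlas(1) c])
qed

text \<open>The derivative of the flow solves the linearised equation. At time \<open>0\<close> this says that the time derivative of
\<open>D\<phi>\<^sub>t u\<close> is \<open>DX u\<close>, by symmetry of the mixed second derivatives of the flow; other times follow from the group law.\<close>

lemma variational_equation: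
  assumes p: "p \<in> points A"
  shows "((\<lambda>t. frechet_derivative (flow_rep (chart_at A p) (chart_at A p)) (at (t, coord (chart_at A p) p)) (0, u))
      has_vector_derivative frechet_derivative (local_field (chart_at A p)) (at (coord (chart_at A p) p)) u) (at 0)"
    and "frechet_derivative (flow_rep (chart_at A p) (chart_at A p)) (at (0, coord (chart_at A p) p)) (0, u) = u"
proof -
  let ?c = "chart_at A p"
  let ?y = "coord ?c p" and ?G = "flow_rep ?c ?c" and ?W = "time_domain ?c ?c" and ?im = "coord ?c ` chart_domain ?c"
  note c = chart_at[OF p]
  have W: "open ?W" "(0, ?y) \<in> ?W" "smooth_on ?W ?G"
    using open_time_domain smooth_flow_rep c atlas flow_0 p by (auto simp: time_domain_def)
  have G0: "?G (0, ?y) = ?y" using c atlas flow_0[OF p] by (simp add: flow_rep_def)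
  show init: "frechet_derivative ?G (at (0, ?y)) (0, u) = u" for u
    using rep_deriv_flow[OF c(1) c(1) c(2), of 0 u] c tangent_map_flow_0[OF p, of u] by (simp add: tangent_map_eq flow_0[OF p])
  let ?DG = "\<lambda>w z. frechet_derivative ?G (at z) w"
  have "(?DG (0, u) has_derivative frechet_derivative (?DG (0, u)) (at (0, ?y))) (at (0, ?y))"
    by (rule smooth_on_has_derivative[OF smooth_on_derivative[OF W(3)] W(2)])
  moreover have "((\<lambda>t. (t, ?y)) has_derivative (\<lambda>h. (h, 0))) (at 0)"
    by (auto intro!: derivative_eq_intros)
  ultimately have "((?DG (0, u) \<circ> (\<lambda>t. (t, ?y))) has_derivative (frechet_derivative (?DG (0, u)) (at (0, ?y)) \<circ> (\<lambda>h. (h, 0)))) (at 0)"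
    by (intro diff_chain_at)
  moreover have "frechet_derivative (?DG (0, u)) (at (0, ?y)) (h, 0) = h *\<^sub>R frechet_derivative (local_field ?c) (at ?y) u" for h :: real
  proof -
    have "linear (frechet_derivative (?DG (0, u)) (at (0, ?y)))"
      using smooth_on_differentiable[OF smooth_on_derivative[OF W(3)] W(2)] by (rule linear_frechet_derivative)
    from linear_cmul[OF this, of h "(1, 0)"]
    have "frechet_derivative (?DG (0, u)) (at (0, ?y)) (h, 0) = h *\<^sub>R frechet_derivative (?DG (0, u)) (at (0, ?y)) (1, 0)"
      by simp
    also have "frechet_derivative (?DG (0, u)) (at (0, ?y)) (1, 0) = frechet_derivative (?DG (1, 0)) (at (0, ?y)) (0, u)"
      by (rule smooth_on_symmetric_second_derivative[OF W(3,1,2)])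
    also have "frechet_derivative (?DG (1, 0)) (at (0, ?y)) = frechet_derivative (local_field ?c \<circ> ?G) (at (0, ?y))"
      by (rule frechet_derivative_cong_open[OF W(1,2)]) (simp add: flow_rep_time_derivative[OF c(1) c(1)])
    also have "\<dots> = frechet_derivative (local_field ?c) (at ?y) \<circ> frechet_derivative ?G (at (0, ?y))"
    proof (rule frechet_derivative_at[symmetric], rule diff_chain_at)
      show "(?G has_derivative frechet_derivative ?G (at (0, ?y))) (at (0, ?y))"
        by (rule smooth_on_has_derivative[OF W(3,2)])
      show "(local_field ?c has_derivative frechet_derivative (local_field ?c) (at ?y)) (at (?G (0, ?y)))"
        unfolding G0 using c by (intro smooth_on_has_derivative[OF smooth_local_field]) auto
    qed
    finally show ?thesis by (simp add: init)
  qed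
  ultimately show "((\<lambda>t. ?DG (0, u) (t, ?y)) has_vector_derivative frechet_derivative (local_field ?c) (at ?y) u) (at 0)"
    by (simp add: has_vector_derivative_def o_def)
qed

lemma \<omega>_bilinear: "x \<in> points A \<Longrightarrow> bilinear (\<omega> x)"
  and \<omega>_antisym: "x \<in> points A \<Longrightarrow> \<omega> x u v = - \<omega> x v u"
proof -
  assume x: "x \<in> points A"
  have lin: "linear (\<omega> x u)" and anti: "\<omega> x u v = - \<omega> x v u" for u v
    using conformal x unfolding conformal_symplectic_def smooth_form2_def by blast+
  have "(\<lambda>u. \<omega> x u v) = (\<lambda>u. - \<omega> x v u)" for v using anti by blast
  then show "bilinear (\<omega> x)" using lin unfolding bilinear_def by (auto intro: linear_compose_neg)
  show "\<omega> x u v = - \<omega> x v u" by (rule anti)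
qed

lemma local2_bilinear:
  assumes "c \<in> A" "y \<in> coord c ` chart_domain c"
  shows "bilinear (local2 A \<omega> c y)"
proof -
  have x: "chart_inv c y \<in> chart_domain c" "chart_inv c y \<in> points A"
    using coord_chart_inv(2)[OF assms(2)] chart_domain_points[OF assms(1)] by auto
  note l = linear_tangent_of_coords[OF atlas(1) assms(1) x(1)] and b = \<omega>_bilinear[OF x(2)]
  show ?thesis
    unfolding bilinear_def local2_def Let_def
    using b l by (auto simp: bilinear_def intro!: linear_compose[OF l, unfolded o_def])
qed

lemma local2_differentiable:
  assumes "c \<in> A" "y \<in> coord c ` chart_domain c"
  shows "(\<lambda>y. local2 A \<omega> c y a b) differentiable (at y)"
  using conformal assms unfolding conformal_symplectic_def smooth_form2_def by (blast intro: smooth_on_differentiable)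

definition local_H :: "('m, 'e) chart \<Rightarrow> 'e \<Rightarrow> real" where
  "local_H c y = H (chart_inv c y)"

lemma smooth_local_H:
  assumes c: "c \<in> A"
  shows "smooth_on (coord c ` chart_domain c) (local_H c)"
proof -
  have "smooth_on (coord c ` {x \<in> chart_domain c. H x \<in> UNIV}) ((\<lambda>t. t) \<circ> H \<circ> chart_inv c)"
    using H_smooth c unfolding smooth_map_def real_atlas_def Let_def by force
  moreover have "(\<lambda>t. t) \<circ> H \<circ> chart_inv c = local_H c" by (auto simp: local_H_def)
  ultimately show ?thesis by simp
qed

lemma \<eta>_linear: "x \<in> points A \<Longrightarrow> linear (\<eta> x)"
  and smooth_local1: "c \<in> A \<Longrightarrow> smooth_on (coord c ` chart_domain c) (\<lambda>y. local1 A \<eta> c y u)"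
  using conformal unfolding conformal_symplectic_def smooth_form1_def by blast+

lemma d_fun_tangent_of_coords:
  assumes c: "c \<in> A" "x \<in> chart_domain c"
  shows "d_fun A H x (tangent_of_coords A c x u) = frechet_derivative (local_H c) (at (coord c x)) u"
proof -
  let ?R = "Chart UNIV (\<lambda>t :: real. t)"
  note d = chart_at[OF chart_domain_points[OF c]]
  have H: "differentiable_map A real_atlas H" by (rule smooth_map_imp_differentiable_map[OF H_smooth])
  have eq: "rep_deriv c H ?R x = frechet_derivative (local_H c) (at (coord c x))" for c
    by (simp add: rep_deriv_def local_rep_def local_H_def[abs_def] o_def)
  have "rep_deriv c H ?R x u = rep_deriv (chart_at A x) H ?R x (rep_deriv c (\<lambda>x. x) (chart_at A x) x u)"
    using rep_deriv_compose[OF atlas(1) atlas(1) differentiable_map_ident[OF atlas(1)] H c d, of ?R u]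
    by (simp add: real_atlas_def)
  then show ?thesis
    unfolding eq by (simp add: d_fun_def Let_def tangent_of_coords_eq local_H_def[abs_def] o_def)
qed

text \<open>The equation defining \<open>X\<close>, at all points of a chart, so that it can be differentiated.\<close>

lemma local_hamilton_equation:
  assumes c: "c \<in> A" and y: "y \<in> coord c ` chart_domain c"
  shows "local2 A \<omega> c y (local_field c y) b =
    frechet_derivative (local_H c) (at y) b - local_H c y * local1 A \<eta> c y b"
proof -
  let ?x = "chart_inv c y"
  have x: "?x \<in> chart_domain c" "coord c ?x = y" using y by auto
  then have "?x \<in> points A" using c chart_domain_points by metis
  then have "\<omega> ?x (X ?x) (tangent_of_coords A c ?x b) = lee_d_fun A \<eta> H ?x (tangent_of_coords A c ?x b)"
    using hamiltonian unfolding hamiltonian_vector_field_def by blast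
  then show ?thesis
    using tangent_coords_inverse(1)[OF atlas(1) c x(1)] d_fun_tangent_of_coords[OF c x(1), of b]
    by (simp add: local2_def local_field_def lee_d_fun_def local1_def local_H_def x(2) Let_def)
qed

lemma local_at_chart_at:
  assumes p: "p \<in> points A"
  shows "local2 A \<omega> (chart_at A p) (coord (chart_at A p) p) a b = \<omega> p a b"
    and "local1 A \<eta> (chart_at A p) (coord (chart_at A p) p) a = \<eta> p a"
    and "local_field (chart_at A p) (coord (chart_at A p) p) = X p"
  using chart_at[OF p] p atlas
  by (auto simp: local2_def local1_def local_field_def Let_def tangent_of_coords_chart_at
      coords_of_tangent_eq rep_deriv_ident)

text \<open>Cartan's formula for the Lie derivative of \<open>\<omega>\<close>, written out in coordinates. Differentiating Hamilton's equation in
the direction \<open>u\<close> expresses \<open>\<omega>(DX u, v)\<close>; the second derivatives of \<open>H\<close> and the derivatives of \<open>\<eta>\<close> are symmetric and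
cancel, and \<open>d\<omega> = \<eta> \<and> \<omega>\<close> turns what remains into \<open>\<eta>(X) \<omega>(u, v)\<close>. The computation takes place in \<open>chart_at A p\<close>,
because exterior derivatives at \<open>p\<close> are defined in that chart.\<close>

lemma lie_derivative_\<omega>:
  assumes p: "p \<in> points A"
  shows "frechet_derivative (\<lambda>y. local2 A \<omega> (chart_at A p) y u v) (at (coord (chart_at A p) p)) (X p) +
      \<omega> p (frechet_derivative (local_field (chart_at A p)) (at (coord (chart_at A p) p)) u) v +
      \<omega> p u (frechet_derivative (local_field (chart_at A p)) (at (coord (chart_at A p) p)) v) =
    \<eta> p (X p) * \<omega> p u v"
proof -
  let ?c = "chart_at A p"
  let ?y = "coord ?c p" and ?im = "coord ?c ` chart_domain ?c"
  note c = chart_at[OF p]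
  have y: "?y \<in> ?im" and im: "open ?im" using c open_chart_image[OF atlas(1)] by auto
  let ?DX = "frechet_derivative (local_field ?c) (at ?y)"
  let ?D\<omega> = "\<lambda>w a b. frechet_derivative (\<lambda>y. local2 A \<omega> ?c y a b) (at ?y) w"
  let ?D\<eta> = "\<lambda>w a. frechet_derivative (\<lambda>y. local1 A \<eta> ?c y a) (at ?y) w"
  let ?dH = "\<lambda>b y. frechet_derivative (local_H ?c) (at y) b"
  let ?DdH = "\<lambda>w b. frechet_derivative (?dH b) (at ?y) w"
  note at = local_at_chart_at[OF p]
  have hamilton: "?D\<omega> a (X p) b + \<omega> p (?DX a) b = ?DdH a b - (local_H ?c ?y * ?D\<eta> a b + ?dH a ?y * \<eta> p b)" for a b
  proof -
    have "((\<lambda>y. local2 A \<omega> ?c y (local_field ?c y) b) has_derivative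
        (\<lambda>w. frechet_derivative (\<lambda>y. local2 A \<omega> ?c y (local_field ?c ?y) b) (at ?y) w +
          local2 A \<omega> ?c ?y (?DX w) b + local2 A \<omega> ?c ?y (local_field ?c ?y) 0)) (at ?y)"
      by (rule bilinear_family_has_derivative[where Y = "\<lambda>y. y" and S = ?im and V = "\<lambda>_. b" and V' = "\<lambda>_. 0"])
        (use im y local2_bilinear[OF c(1)] local2_differentiable[OF c(1)]
          smooth_on_has_derivative[OF smooth_local_field[OF c(1)] y] in auto)
    moreover have "local2 A \<omega> ?c ?y (local_field ?c ?y) 0 = 0"
      using bilinear_rzero[OF local2_bilinear[OF c(1) y]] by simp
    ultimately have 1: "((\<lambda>y. local2 A \<omega> ?c y (local_field ?c y) b) has_derivative
        (\<lambda>w. ?D\<omega> w (X p) b + \<omega> p (?DX w) b)) (at ?y)"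
      by (simp add: at)
    have 2: "((\<lambda>y. ?dH b y - local_H ?c y * local1 A \<eta> ?c y b) has_derivative
        (\<lambda>w. ?DdH w b - (local_H ?c ?y * ?D\<eta> w b + ?dH w ?y * local1 A \<eta> ?c ?y b))) (at ?y)"
      by (intro has_derivative_diff has_derivative_mult smooth_on_has_derivative[OF _ y]
          smooth_on_derivative smooth_local_H smooth_local1 c)
    have "((\<lambda>y. local2 A \<omega> ?c y (local_field ?c y) b) has_derivative
        (\<lambda>w. ?DdH w b - (local_H ?c ?y * ?D\<eta> w b + ?dH w ?y * local1 A \<eta> ?c ?y b))) (at ?y)"
      by (rule has_derivative_transform_within_open[OF 2 im y])
        (simp add: local_hamilton_equation[OF c(1)])
    from fun_cong[OF has_derivative_unique[OF 1 this], of a] show ?thesis by (simp add: at)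
  qed
  have sym: "?DdH u v = ?DdH v u"
    by (rule smooth_on_symmetric_second_derivative[OF smooth_local_H[OF c(1)] im y])
  have closed: "?D\<eta> u v = ?D\<eta> v u"
    using conformal p by (simp add: conformal_symplectic_def d_form1_def Let_def)
  have twisted: "?D\<omega> (X p) u v - ?D\<omega> u (X p) v + ?D\<omega> v (X p) u =
      \<eta> p (X p) * \<omega> p u v - \<eta> p u * \<omega> p (X p) v + \<eta> p v * \<omega> p (X p) u"
    using conformal p
    by (simp add: conformal_symplectic_def lee_d_form2_def d_form2_def wedge12_def Let_def)
  have contr: "\<omega> p (X p) b = ?dH b ?y - local_H ?c ?y * \<eta> p b" for b
    using local_hamilton_equation[OF c(1) y, of b] by (simp add: at)
  have "\<omega> p u (?DX v) = - \<omega> p (?DX v) u" by (rule \<omega>_antisym[OF p])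
  then show ?thesis
    using hamilton[of u v] hamilton[of v u] twisted sym closed
    unfolding contr[of u] contr[of v] by (simp add: algebra_simps)
qed

lemma pullback_\<omega>_derivative_0:
  assumes p: "p \<in> points A"
  shows "((\<lambda>t. \<omega> (\<phi> t p) (tangent_map A A (\<phi> t) p u) (tangent_map A A (\<phi> t) p v))
    has_real_derivative \<eta> p (X p) * \<omega> p u v) (at 0)"
proof -
  let ?c = "chart_at A p"
  let ?y = "coord ?c p" and ?im = "coord ?c ` chart_domain ?c"
  note c = chart_at[OF p] and at = local_at_chart_at[OF p]
  let ?T = "{t. \<phi> t p \<in> chart_domain ?c}"
  let ?V = "\<lambda>u t. frechet_derivative (flow_rep ?c ?c) (at (t, ?y)) (0, u)"
  let ?DX = "frechet_derivative (local_field ?c) (at ?y)"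
  have T: "open ?T" "0 \<in> ?T" using open_flow_times[OF p c(1)] c flow_0[OF p] by auto
  have eq: "\<omega> (\<phi> t p) (tangent_map A A (\<phi> t) p u) (tangent_map A A (\<phi> t) p v) =
      local2 A \<omega> ?c (coord ?c (\<phi> t p)) (?V u t) (?V v t)" if t: "t \<in> ?T" for t
  proof -
    have "tangent_map A A (\<phi> t) p w = tangent_of_coords A ?c (\<phi> t p) (?V w t)" for w
      using tangent_map_tangent_of_coords[OF atlas(1) atlas(1) differentiable_flow c c(1), of t w] t
        rep_deriv_flow[OF c(1) c(1) c(2), of t w] tangent_of_coords_chart_at[OF atlas(1) p]
      by simp
    then show ?thesis using t atlas c by (simp add: local2_def Let_def)
  qed
  have var: "(?V w has_derivative (\<lambda>h. h *\<^sub>R ?DX w)) (at 0)" "?V w 0 = w" for w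
    using variational_equation[OF p, of w] by (simp_all add: has_vector_derivative_def)
  have curve: "((\<lambda>t. coord ?c (\<phi> t p)) has_derivative (\<lambda>h. h *\<^sub>R X p)) (at 0)"
    using flow_chart_derivative[OF p c(1), of 0] flow_0[OF p] c at by (simp add: has_vector_derivative_def)
  have 1: "((\<lambda>t. local2 A \<omega> ?c (coord ?c (\<phi> t p)) (?V u t) (?V v t)) has_derivative
      (\<lambda>h. frechet_derivative (\<lambda>y. local2 A \<omega> ?c y (?V u 0) (?V v 0)) (at (coord ?c (\<phi> 0 p))) (h *\<^sub>R X p) +
        local2 A \<omega> ?c (coord ?c (\<phi> 0 p)) (h *\<^sub>R ?DX u) (?V v 0) +
        local2 A \<omega> ?c (coord ?c (\<phi> 0 p)) (?V u 0) (h *\<^sub>R ?DX v))) (at 0)"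
    by (rule bilinear_family_has_derivative[where S = ?im])
      (use open_chart_image[OF atlas(1)] c flow_0[OF p] local2_bilinear[OF c(1)] local2_differentiable[OF c(1)]
        curve var in auto)
  have "linear (frechet_derivative (\<lambda>y. local2 A \<omega> ?c y u v) (at ?y))"
    using local2_differentiable[OF c(1)] c by (intro linear_frechet_derivative) auto
  then have 2: "(\<lambda>h. frechet_derivative (\<lambda>y. local2 A \<omega> ?c y (?V u 0) (?V v 0)) (at (coord ?c (\<phi> 0 p))) (h *\<^sub>R X p) +
        local2 A \<omega> ?c (coord ?c (\<phi> 0 p)) (h *\<^sub>R ?DX u) (?V v 0) +
        local2 A \<omega> ?c (coord ?c (\<phi> 0 p)) (?V u 0) (h *\<^sub>R ?DX v)) = (\<lambda>h. \<eta> p (X p) * \<omega> p u v * h)"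
    unfolding var(2) flow_0[OF p] at lie_derivative_\<omega>[OF p, symmetric]
    by (simp add: linear_cmul bilinear_lmul[OF \<omega>_bilinear[OF p]] bilinear_rmul[OF \<omega>_bilinear[OF p]] algebra_simps)
  have "((\<lambda>t. \<omega> (\<phi> t p) (tangent_map A A (\<phi> t) p u) (tangent_map A A (\<phi> t) p v))
      has_derivative (\<lambda>h. \<eta> p (X p) * \<omega> p u v * h)) (at 0)"
    by (rule has_derivative_transform_within_open[OF 1[unfolded 2] T]) (simp add: eq)
  then show ?thesis by (simp add: has_field_derivative_def)
qed

definition rate :: "'m \<Rightarrow> real" where "rate x = \<eta> x (X x)"

text \<open>By the group law, the derivative at time \<open>t\<close> is the derivative at time \<open>0\<close> at the point \<open>\<phi>\<^sub>t(x)\<close>.\<close>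

lemma pullback_\<omega>_derivative:
  assumes x: "x \<in> points A"
  shows "((\<lambda>t. \<omega> (\<phi> t x) (tangent_map A A (\<phi> t) x u) (tangent_map A A (\<phi> t) x v)) has_real_derivative
    rate (\<phi> t x) * \<omega> (\<phi> t x) (tangent_map A A (\<phi> t) x u) (tangent_map A A (\<phi> t) x v)) (at t)"
proof -
  let ?g = "\<lambda>t. \<omega> (\<phi> t x) (tangent_map A A (\<phi> t) x u) (tangent_map A A (\<phi> t) x v)"
  have tm: "tangent_map A A (\<phi> (s + t)) x w = tangent_map A A (\<phi> s) (\<phi> t x) (tangent_map A A (\<phi> t) x w)" for s w
  proof -
    have "tangent_map A A (\<phi> (s + t)) x w = tangent_map A A (\<lambda>x. \<phi> s (\<phi> t x)) x w"
      unfolding tangent_map_eq flow_add[OF x] rep_deriv_def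
      by (rule fun_cong, rule frechet_derivative_cong_open[OF open_chart_image[OF atlas(1) chart_at(1)[OF x]]])
        (use chart_at[OF x] chart_domain_points[OF chart_at(1)[OF x]] atlas flow_add in \<open>auto simp: local_rep_apply\<close>)
    then show ?thesis
      by (simp add: tangent_map_compose[OF atlas(1) atlas(1) differentiable_flow differentiable_flow x])
  qed
  have "((\<lambda>s. ?g (s + t)) has_real_derivative rate (\<phi> t x) * ?g t) (at 0)"
    using pullback_\<omega>_derivative_0[OF flow_points[OF x, of t], of "tangent_map A A (\<phi> t) x u" "tangent_map A A (\<phi> t) x v"]
    by (simp add: tm flow_add[OF x] rate_def)
  then have "(?g has_real_derivative rate (\<phi> t x) * ?g t) (at (0 + t))" by (rule DERIV_shift[THEN iffD2])
  then show ?thesis by simp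
qed

lemma rate_local:
  assumes c: "c \<in> A" and y: "y \<in> coord c ` chart_domain c"
  shows "rate (chart_inv c y) = (\<Sum>b\<in>Basis. (local_field c y \<bullet> b) * local1 A \<eta> c y b)"
proof -
  let ?x = "chart_inv c y"
  have x: "?x \<in> chart_domain c" "?x \<in> points A" using coord_chart_inv(2)[OF y] chart_domain_points[OF c] by auto
  have lin: "linear (\<lambda>u. local1 A \<eta> c y u)"
    unfolding local1_def Let_def
    by (rule linear_compose[OF linear_tangent_of_coords[OF atlas(1) c x(1)] \<eta>_linear[OF x(2)], unfolded o_def])
  have "rate ?x = local1 A \<eta> c y (local_field c y)"
    using tangent_coords_inverse(1)[OF atlas(1) c x(1)] by (simp add: rate_def local1_def local_field_def Let_def)
  also have "\<dots> = local1 A \<eta> c y (\<Sum>b\<in>Basis. (local_field c y \<bullet> b) *\<^sub>R b)"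
    by (simp add: euclidean_representation)
  also have "\<dots> = (\<Sum>b\<in>Basis. (local_field c y \<bullet> b) * local1 A \<eta> c y b)"
    by (simp add: linear_sum[OF lin] linear_cmul[OF lin])
  finally show ?thesis .
qed

lemma continuous_rate: "c \<in> A \<Longrightarrow> continuous_on (coord c ` chart_domain c) (rate \<circ> chart_inv c)"
proof -
  assume c: "c \<in> A"
  have "continuous_on (coord c ` chart_domain c) (\<lambda>y. \<Sum>b\<in>Basis. (local_field c y \<bullet> b) * local1 A \<eta> c y b)"
    by (intro continuous_intros smooth_on_continuous[OF smooth_local_field[OF c]] smooth_on_continuous[OF smooth_local1[OF c]])
  then show ?thesis by (rule continuous_on_eq) (simp add: rate_local[OF c])
qed

lemma continuous_along_flow:
  fixes f :: "'m \<Rightarrow> real"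
  assumes f: "\<And>c. c \<in> A \<Longrightarrow> continuous_on (coord c ` chart_domain c) (f \<circ> chart_inv c)" and c: "c \<in> A"
  shows "continuous_on ((coord c ` chart_domain c) \<times> UNIV) (\<lambda>(y, t). f (\<phi> t (chart_inv c y)))"
proof (intro continuous_at_imp_continuous_on ballI)
  fix z :: "'e \<times> real" assume "z \<in> (coord c ` chart_domain c) \<times> UNIV"
  then obtain y t where z: "z = (y, t)" and y: "y \<in> coord c ` chart_domain c" by auto
  let ?x = "chart_inv c y"
  have x: "?x \<in> points A" using coord_chart_inv(2)[OF y] chart_domain_points[OF c] by auto
  let ?d = "chart_at A (\<phi> t ?x)"
  note d = chart_at[OF flow_points[OF x, of t]]
  let ?W = "time_domain c ?d" and ?swap = "\<lambda>(y, t). (t, y)"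
  have W: "open ?W" "(t, y) \<in> ?W" using open_time_domain[OF c d(1)] y d by (auto simp: time_domain_def)
  have "continuous_on ?W ((f \<circ> chart_inv ?d) \<circ> flow_rep c ?d)"
    by (rule continuous_on_compose[OF smooth_on_continuous[OF smooth_flow_rep[OF c d(1)]]],
        rule continuous_on_subset[OF f[OF d(1)]]) (auto simp: time_domain_def flow_rep_def)
  then have "continuous_on ?W (\<lambda>(t, y). f (\<phi> t (chart_inv c y)))"
    by (rule continuous_on_eq) (use atlas d in \<open>auto simp: time_domain_def flow_rep_def\<close>)
  then have "isCont (\<lambda>(t, y). f (\<phi> t (chart_inv c y))) (t, y)"
    using W continuous_on_eq_continuous_at by blast
  then have 1: "isCont (\<lambda>(t, y). f (\<phi> t (chart_inv c y))) (?swap z)" by (simp add: z)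
  have 2: "isCont ?swap z" unfolding split_def by (intro continuous_intros)
  from isCont_o2[OF 2 1] show "isCont (\<lambda>(y, t). f (\<phi> t (chart_inv c y))) z" by (simp add: split_def)
qed

lemma continuous_orbit:
  fixes f :: "'m \<Rightarrow> real"
  assumes f: "\<And>c. c \<in> A \<Longrightarrow> continuous_on (coord c ` chart_domain c) (f \<circ> chart_inv c)" and x: "x \<in> points A"
  shows "continuous_on UNIV (\<lambda>t. f (\<phi> t x))"
proof -
  note c = chart_at[OF x]
  have "continuous_on UNIV ((\<lambda>(y, t). f (\<phi> t (chart_inv (chart_at A x) y))) \<circ> (\<lambda>t. (coord (chart_at A x) x, t)))"
    by (rule continuous_on_compose[OF _ continuous_on_subset[OF continuous_along_flow[OF f c(1)]]])
      (use c in \<open>auto intro!: continuous_intros\<close>)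
  then show ?thesis using atlas c by (simp add: o_def)
qed

abbreviation r :: "real \<Rightarrow> 'm \<Rightarrow> real" where "r \<equiv> winding \<eta> X \<phi>"

lemma winding_derivative:
  assumes x: "x \<in> points A"
  shows "((\<lambda>t. r t x) has_real_derivative rate (\<phi> t x)) (at t)"
proof -
  let ?b = "\<bar>t\<bar> + 1"
  have cont: "continuous_on {-?b..?b} (\<lambda>s. rate (\<phi> s x))"
    using continuous_orbit[OF continuous_rate x] by (rule continuous_on_subset) auto
  have "((\<lambda>u. LBINT s=ereal 0..ereal u. rate (\<phi> s x)) has_vector_derivative rate (\<phi> t x)) (at t within {-?b..?b})"
    by (rule interval_integral_FTC2[OF _ _ cont]) auto
  moreover have "at t within {-?b..?b} = at t" by (rule at_within_Icc_at) auto
  ultimately show ?thesis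
    by (simp add: winding_def rate_def has_real_derivative_iff_has_vector_derivative zero_ereal_def)
qed

lemma winding_eq: "r t x = (LBINT s=ereal 0..ereal t. rate (\<phi> s x))"
  by (simp add: winding_def rate_def zero_ereal_def)

lemma winding_0: "r 0 x = 0"
  by (simp add: winding_def zero_ereal_def[symmetric])

text \<open>Both sides have the same derivative in \<open>s\<close> and agree at \<open>s = 0\<close>.\<close>

lemma winding_add:
  assumes x: "x \<in> points A"
  shows "r (s + t) x = r s (\<phi> t x) + r t x"
proof -
  let ?f = "\<lambda>s. r (s + t) x - r s (\<phi> t x)"
  have "(?f has_real_derivative 0) (at s)" for s
  proof -
    have "((\<lambda>s. r (s + t) x) has_real_derivative rate (\<phi> (s + t) x)) (at s)"
      using winding_derivative[OF x, of "s + t"] by (simp add: DERIV_shift)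
    from DERIV_diff[OF this winding_derivative[OF flow_points[OF x], of t s]]
    show ?thesis by (simp add: flow_add[OF x])
  qed
  then have "?f s = ?f 0" by (intro DERIV_isconst_all) auto
  then show ?thesis by (simp add: winding_0)
qed

lemma winding_continuous:
  assumes c: "c \<in> A"
  shows "continuous_on (coord c ` chart_domain c) (r t \<circ> chart_inv c)"
proof -
  let ?im = "coord c ` chart_domain c"
  have int: "continuous_on ?im (\<lambda>y. integral {a..b} (\<lambda>s. rate (\<phi> s (chart_inv c y))))" for a b :: real
  proof -
    have "continuous_on (?im \<times> cbox a b) (\<lambda>(y, s). rate (\<phi> s (chart_inv c y)))"
      by (rule continuous_on_subset[OF continuous_along_flow[OF continuous_rate c]]) auto
    from integral_continuous_on_param[OF this] show ?thesis by (simp add: cbox_interval)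
  qed
  have eq: "(LBINT s=ereal a..ereal b. rate (\<phi> s (chart_inv c y))) = integral {a..b} (\<lambda>s. rate (\<phi> s (chart_inv c y)))"
    if "a \<le> b" "y \<in> ?im" for a b y
  proof (rule interval_integral_eq_integral)
    have "chart_inv c y \<in> points A" using coord_chart_inv(2)[OF that(2)] chart_domain_points[OF c] by auto
    from borel_integrable_atLeastAtMost'[OF continuous_on_subset[OF continuous_orbit[OF continuous_rate this] subset_UNIV]]
    show "set_integrable lborel {a..b} (\<lambda>s. rate (\<phi> s (chart_inv c y)))" .
  qed (use that in auto)
  show ?thesis
  proof (cases "t \<ge> 0")
    case True
    show ?thesis
      by (rule continuous_on_eq[OF int[of 0 t]]) (simp only: o_apply winding_eq eq[OF True])
  next
    case False
    then have le: "t \<le> 0" by simp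
    show ?thesis
      by (rule continuous_on_eq[OF continuous_on_minus[OF int[of t 0]]])
        (simp only: o_apply winding_eq eq[OF le] interval_integral_endpoints_reverse[of "ereal 0"])
  qed
qed

theorem pullback_\<omega>:
  assumes x: "x \<in> points A"
  shows "\<omega> (\<phi> t x) (tangent_map A A (\<phi> t) x u) (tangent_map A A (\<phi> t) x v) = exp (r t x) * \<omega> x u v"
  using exponential_solution[OF winding_derivative[OF x] winding_0 pullback_\<omega>_derivative[OF x]]
  by (simp add: flow_0[OF x] tangent_map_flow_0[OF x])

lemma \<omega>_diag: "x \<in> points A \<Longrightarrow> \<omega> x u u = 0"
  using \<omega>_antisym[of x u u] by simp

text \<open>Hamilton's equation and \<open>\<omega>(X, X) = 0\<close> give \<open>dH(X) = \<eta>(X) H\<close>, a linear equation along each orbit.\<close>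

lemma H_along_flow:
  assumes x: "x \<in> points A"
  shows "H (\<phi> t x) = exp (r t x) * H x"
proof -
  have "((\<lambda>t. H (\<phi> t x)) has_real_derivative rate (\<phi> t x) * H (\<phi> t x)) (at t)" for t
  proof -
    let ?q = "\<phi> t x"
    let ?c = "chart_at A ?q"
    note q = flow_points[OF x, of t] and c = chart_at[OF flow_points[OF x, of t]]
    let ?y = "coord ?c ?q"
    have y: "?y \<in> coord ?c ` chart_domain ?c" using c by auto
    have "((\<lambda>s. coord ?c (\<phi> s x)) has_derivative (\<lambda>h. h *\<^sub>R X ?q)) (at t)"
      using flow_chart_derivative[OF x c] local_at_chart_at[OF q] by (simp add: has_vector_derivative_def)
    from diff_chain_at[OF this smooth_on_has_derivative[OF smooth_local_H[OF c(1)] y]]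
    have "((local_H ?c \<circ> (\<lambda>s. coord ?c (\<phi> s x))) has_derivative
        (frechet_derivative (local_H ?c) (at ?y) \<circ> (\<lambda>h. h *\<^sub>R X ?q))) (at t)" .
    then have "((\<lambda>s. H (\<phi> s x)) has_derivative
        (frechet_derivative (local_H ?c) (at ?y) \<circ> (\<lambda>h. h *\<^sub>R X ?q))) (at t)"
      by (rule has_derivative_transform_within_open[OF _ open_flow_times[OF x c(1)]])
        (use atlas c in \<open>auto simp: local_H_def\<close>)
    moreover have "linear (frechet_derivative (local_H ?c) (at ?y))"
      using smooth_on_differentiable[OF smooth_local_H[OF c(1)] y] by (rule linear_frechet_derivative)
    moreover have "frechet_derivative (local_H ?c) (at ?y) (X ?q) = rate ?q * H ?q"
      using local_hamilton_equation[OF c(1) y, of "X ?q"] local_at_chart_at[OF q] \<omega>_diag[OF q] atlas c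
      by (simp add: rate_def local_H_def mult.commute)
    ultimately show ?thesis
      by (simp add: has_field_derivative_def o_def linear_cmul mult.commute mult_commute_abs)
  qed
  from exponential_solution[OF winding_derivative[OF x] winding_0 this] show ?thesis
    by (simp add: flow_0[OF x])
qed

lemma tangent_map_flow_field:
  assumes x: "x \<in> points A"
  shows "tangent_map A A (\<phi> t) x (X x) = X (\<phi> t x)"
proof -
  let ?c = "chart_at A x" and ?d = "chart_at A (\<phi> t x)"
  note c = chart_at[OF x] and q = flow_points[OF x, of t] and d = chart_at[OF flow_points[OF x, of t]]
  have "((\<lambda>s. coord ?c (\<phi> s x)) has_derivative (\<lambda>h. h *\<^sub>R X x)) (at 0)"
    using flow_chart_derivative[OF x c(1), of 0] flow_0[OF x] c local_at_chart_at[OF x]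
    by (simp add: has_vector_derivative_def)
  moreover have "(local_rep ?c (\<phi> t) ?d has_derivative rep_deriv ?c (\<phi> t) ?d x) (at (coord ?c (\<phi> 0 x)))"
    using differentiable_mapD(2)[OF differentiable_flow c(1) d(1) c(2) d(2)] flow_0[OF x] by simp
  ultimately have "((local_rep ?c (\<phi> t) ?d \<circ> (\<lambda>s. coord ?c (\<phi> s x))) has_derivative
      (rep_deriv ?c (\<phi> t) ?d x \<circ> (\<lambda>h. h *\<^sub>R X x))) (at 0)"
    by (rule diff_chain_at)
  then have 1: "((\<lambda>s. coord ?d (\<phi> t (\<phi> s x))) has_derivative (rep_deriv ?c (\<phi> t) ?d x \<circ> (\<lambda>h. h *\<^sub>R X x))) (at 0)"
    by (rule has_derivative_transform_within_open[OF _ open_flow_times[OF x c(1)]])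
      (use atlas c flow_0[OF x] in \<open>auto simp: local_rep_apply\<close>)
  have "((\<lambda>s. coord ?d (\<phi> s x)) has_vector_derivative X (\<phi> t x)) (at (0 + t))"
    using flow_chart_derivative[OF x d] local_at_chart_at[OF q] by simp
  moreover have "((\<lambda>s. s + t) has_derivative (\<lambda>h. h)) (at (0 :: real))"
    by (auto intro!: derivative_eq_intros)
  ultimately have "((\<lambda>s. coord ?d (\<phi> (s + t) x)) has_derivative (\<lambda>h. h *\<^sub>R X (\<phi> t x))) (at 0)"
    using diff_chain_at[of "\<lambda>s. s + t" "\<lambda>h. h" 0 "\<lambda>s. coord ?d (\<phi> s x)" "\<lambda>h. h *\<^sub>R X (\<phi> t x)"]
    by (simp add: has_vector_derivative_def o_def)
  then have 2: "((\<lambda>s. coord ?d (\<phi> t (\<phi> s x))) has_derivative (\<lambda>h. h *\<^sub>R X (\<phi> t x))) (at 0)"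
    by (simp add: flow_add[OF x, symmetric] add.commute)
  from fun_cong[OF has_derivative_unique[OF 1 2], of 1] show ?thesis by (simp add: tangent_map_eq)
qed

text \<open>The form is \<open>\<omega>(X, \<cdot>)\<close>, and the flow preserves \<open>X\<close>.\<close>

theorem pullback_lee_d_H:
  assumes x: "x \<in> points A"
  shows "lee_d_fun A \<eta> H (\<phi> t x) (tangent_map A A (\<phi> t) x v) = exp (r t x) * lee_d_fun A \<eta> H x v"
proof -
  have "lee_d_fun A \<eta> H y w = \<omega> y (X y) w" if "y \<in> points A" for y w
    using hamiltonian that by (simp add: hamiltonian_vector_field_def)
  then show ?thesis
    using x flow_points[OF x] pullback_\<omega>[OF x, of t "X x" v] by (simp add: tangent_map_flow_field)
qed

end

section \<open>Conservative points of a closed manifold\<close>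

text \<open>A Lipschitz function changes by a bounded amount between consecutive integers.\<close>

lemma Liminf_abs_finite_iff:
  fixes a :: "real \<Rightarrow> real"
  assumes lip: "\<And>s t. \<bar>a s - a t\<bar> \<le> C * \<bar>s - t\<bar>"
  shows "Liminf at_top (\<lambda>t. ereal \<bar>a t\<bar>) < \<infinity> \<longleftrightarrow> \<not> filterlim (\<lambda>k. \<bar>a (real k)\<bar>) at_top sequentially"
proof -
  have "filterlim (\<lambda>t. \<bar>a t\<bar>) at_top at_top" if lim: "filterlim (\<lambda>k. \<bar>a (real k)\<bar>) at_top sequentially"
    unfolding filterlim_at_top
  proof
    fix Z
    obtain n where n: "\<And>k. k \<ge> n \<Longrightarrow> Z + \<bar>C\<bar> \<le> \<bar>a (real k)\<bar>"
      using lim by (auto simp: filterlim_at_top eventually_sequentially)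
    have "Z \<le> \<bar>a t\<bar>" if t: "t \<ge> real n + 1" for t
    proof -
      let ?k = "nat \<lfloor>t\<rfloor>"
      have k: "?k \<ge> n" "\<bar>real ?k - t\<bar> \<le> 1" using t by linarith+
      have "\<bar>a (real ?k) - a t\<bar> \<le> C * \<bar>real ?k - t\<bar>" by (rule lip)
      also have "\<dots> \<le> \<bar>C\<bar> * \<bar>real ?k - t\<bar>" by (intro mult_right_mono) auto
      also have "\<dots> \<le> \<bar>C\<bar> * 1" by (intro mult_left_mono k(2)) auto
      finally show ?thesis using n[OF k(1)] by linarith
    qed
    then show "eventually (\<lambda>t. Z \<le> \<bar>a t\<bar>) at_top"
      unfolding eventually_at_top_linorder by blast
  qed
  then have "filterlim (\<lambda>k. \<bar>a (real k)\<bar>) at_top sequentially \<longleftrightarrow> filterlim (\<lambda>t. \<bar>a t\<bar>) at_top at_top"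
    using filterlim_compose[OF _ filterlim_real_sequentially, of "\<lambda>t. \<bar>a t\<bar>" at_top] by blast
  moreover have "Liminf at_top (\<lambda>t. ereal \<bar>a t\<bar>) = \<infinity> \<longleftrightarrow> filterlim (\<lambda>t. \<bar>a t\<bar>) at_top at_top"
    using Liminf_PInfty[of "at_top :: real filter" "\<lambda>t. ereal \<bar>a t\<bar>"]
      tendsto_PInfty_eq_at_top[of "\<lambda>t. \<bar>a t\<bar>" at_top] by auto
  ultimately show ?thesis by (metis ereal_infty_less(1))
qed

locale closed_hamiltonian_flow = hamiltonian_flow A \<eta> \<omega> H X \<phi>
  for A :: "('m, 'e::euclidean_space) atlas" and \<eta> \<omega> H X \<phi> +
  assumes compact: "compact_space (atlas_topology A)"
begin

lemma winding_Lipschitz: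
  obtains C where "\<And>x s t. x \<in> points A \<Longrightarrow> \<bar>r s x - r t x\<bar> \<le> C * \<bar>s - t\<bar>"
proof -
  have "compact (rate ` points A)"
    using image_compactin[OF compact[unfolded compact_space_def] continuous_map_atlas_real[OF atlas(1) continuous_rate]]
    by (simp add: topspace_atlas[OF atlas(1)])
  then obtain C where C: "\<And>x. x \<in> points A \<Longrightarrow> \<bar>rate x\<bar> \<le> C"
    by (metis (no_types, lifting) compact_imp_bounded bounded_iff image_eqI real_norm_def)
  have "\<bar>r s x - r t x\<bar> \<le> C * \<bar>s - t\<bar>" if x: "x \<in> points A" for x s t
    using field_differentiable_bound[of UNIV "\<lambda>t. r t x" "\<lambda>t. rate (\<phi> t x)" C s t]
      winding_derivative[OF x] C flow_points[OF x] by simp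
  then show ?thesis by (rule that)
qed

lemma pos_conservative_iff:
  "x \<in> points A \<Longrightarrow> x \<in> pos_conservative A \<eta> X \<phi> \<longleftrightarrow> \<not> filterlim (\<lambda>k. \<bar>r (real k) x\<bar>) at_top sequentially"
  and neg_conservative_iff:
  "x \<in> points A \<Longrightarrow> x \<in> neg_conservative A \<eta> X \<phi> \<longleftrightarrow> \<not> filterlim (\<lambda>k. \<bar>r (- real k) x\<bar>) at_top sequentially"
proof -
  assume x: "x \<in> points A"
  obtain C where C: "\<bar>r s x - r t x\<bar> \<le> C * \<bar>s - t\<bar>" for s t
    using winding_Lipschitz x by metis
  show "x \<in> pos_conservative A \<eta> X \<phi> \<longleftrightarrow> \<not> filterlim (\<lambda>k. \<bar>r (real k) x\<bar>) at_top sequentially"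
    using Liminf_abs_finite_iff[of "\<lambda>t. r t x", OF C] x by (simp add: pos_conservative_def)
  have C': "\<bar>r (- s) x - r (- t) x\<bar> \<le> C * \<bar>s - t\<bar>" for s t
    using C[of "- s" "- t"] by (simp add: abs_minus_commute)
  have "Liminf at_bot (\<lambda>t. ereal \<bar>r t x\<bar>) = Liminf at_top (\<lambda>t. ereal \<bar>r (- t) x\<bar>)"
    by (simp add: at_bot_mirror Liminf_filtermap_eq)
  then show "x \<in> neg_conservative A \<eta> X \<phi> \<longleftrightarrow> \<not> filterlim (\<lambda>k. \<bar>r (- real k) x\<bar>) at_top sequentially"
    using Liminf_abs_finite_iff[of "\<lambda>t. r (- t) x", OF C'] x by (simp add: neg_conservative_def)
qed

end

context hamiltonian_flow
begin

lemma pullback_local2: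
  assumes c: "c \<in> A" "x \<in> chart_domain c" and d: "d \<in> A" "\<phi> t x \<in> chart_domain d"
  shows "local2 A \<omega> d (coord d (\<phi> t x)) (rep_deriv c (\<phi> t) d x u) (rep_deriv c (\<phi> t) d x v) =
    exp (r t x) * local2 A \<omega> c (coord c x) u v"
  using pullback_\<omega>[OF chart_domain_points[OF c], of t "tangent_of_coords A c x u" "tangent_of_coords A c x v"]
    tangent_map_tangent_of_coords[OF atlas(1) atlas(1) differentiable_flow c d] atlas c d
  by (simp add: local2_def Let_def)

lemma local2_nondegenerate:
  assumes c: "c \<in> A" "y \<in> coord c ` chart_domain c" and u: "\<And>v. local2 A \<omega> c y u v = 0"
  shows "u = 0"
proof -
  let ?x = "chart_inv c y"
  have x: "?x \<in> chart_domain c" using c by simp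
  have xA: "?x \<in> points A" by (rule chart_domain_points[OF c(1) x])
  have "\<omega> ?x (tangent_of_coords A c ?x u) v = 0" for v
    using u[of "coords_of_tangent A c ?x v"] tangent_coords_inverse(1)[OF atlas(1) c(1) x]
    by (simp add: local2_def Let_def)
  then have "tangent_of_coords A c ?x u = 0"
    using conformal xA unfolding conformal_symplectic_def by blast
  then have "coords_of_tangent A c ?x (tangent_of_coords A c ?x u) = coords_of_tangent A c ?x 0" by simp
  then show ?thesis
    by (simp add: tangent_coords_inverse(2)[OF atlas(1) c(1) x] linear_0[OF linear_coords_of_tangent[OF atlas(1) c(1) x]])
qed

lemma smooth_local2: "c \<in> A \<Longrightarrow> smooth_on (coord c ` chart_domain c) (\<lambda>y. local2 A \<omega> c y a b)"
  using conformal unfolding conformal_symplectic_def smooth_form2_def by blast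

end

lemma (in closed_hamiltonian_flow) scaling_flow_ambient:
  "scaling_flow A \<phi> r (\<lambda>p. coord (chart_at A p) ` chart_domain (chart_at A p))
     (\<lambda>p y. \<bar>gram (local2 A \<omega> (chart_at A p) y)\<bar>) (real CARD('e basis_index))"
proof
  fix p assume p: "p \<in> points A"
  note c = chart_at[OF p]
  show "open (coord (chart_at A p) ` chart_domain (chart_at A p))"
    "coord (chart_at A p) p \<in> coord (chart_at A p) ` chart_domain (chart_at A p)"
    using open_chart_image[OF atlas(1)] c by auto
  show "continuous_on (coord (chart_at A p) ` chart_domain (chart_at A p)) (\<lambda>y. \<bar>gram (local2 A \<omega> (chart_at A p) y)\<bar>)"
    by (intro continuous_on_rabs continuous_on_gram smooth_on_continuous smooth_local2 c)
  show "0 < \<bar>gram (local2 A \<omega> (chart_at A p) y)\<bar>" if "y \<in> coord (chart_at A p) ` chart_domain (chart_at A p)" for y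
    using gram_nonzero[OF local2_bilinear[OF c(1) that]] local2_nondegenerate[OF c(1) that] by simp
  show "\<exists>U K. atlas_open A U \<and> p \<in> U \<and> compactin (atlas_topology A) K \<and>
      (\<forall>x\<in>U. \<forall>t. \<bar>r t x\<bar> \<le> L \<longrightarrow> \<phi> t x \<in> K)" for L
  proof (intro exI[of _ "points A"] conjI)
    show "atlas_open A (points A)" 
      using openin_topspace[of "atlas_topology A"] by (simp add: openin_atlas_topology[OF atlas(1)] topspace_atlas[OF atlas(1)])
    show "compactin (atlas_topology A) (points A)"
      using compact by (simp add: compact_space_def topspace_atlas[OF atlas(1)])
  qed (use p flow_points in auto)
  fix q t x assume q: "q \<in> points A" and x: "x \<in> chart_domain (chart_at A p)" and px: "\<phi> t x \<in> chart_domain (chart_at A q)"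
  let ?c = "chart_at A p" and ?d = "chart_at A q"
  note d = chart_at(1)[OF q]
  let ?R = "rep_deriv ?c (\<phi> t) ?d x"
  have lin: "linear ?R" by (rule linear_rep_deriv[OF differentiable_flow c(1) d x px])
  have "bilinear (local2 A \<omega> ?d (coord ?d (\<phi> t x)))" using px by (intro local2_bilinear[OF d]) auto
  from gram_compose[OF this lin]
  have "(ldet ?R)\<^sup>2 * gram (local2 A \<omega> ?d (coord ?d (\<phi> t x))) =
      gram (\<lambda>u v. exp (r t x) * local2 A \<omega> ?c (coord ?c x) u v)"
    by (simp add: pullback_local2[OF c(1) x d px])
  also have "\<dots> = exp (real CARD('e basis_index) * r t x) * gram (local2 A \<omega> ?c (coord ?c x))"
    by (simp add: gram_scale exp_of_nat_mult)
  finally have "\<bar>(ldet ?R)\<^sup>2 * gram (local2 A \<omega> ?d (coord ?d (\<phi> t x)))\<bar> =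
      \<bar>exp (real CARD('e basis_index) * r t x) * gram (local2 A \<omega> ?c (coord ?c x))\<bar>" by simp
  then show "(ldet ?R)\<^sup>2 * \<bar>gram (local2 A \<omega> ?d (coord ?d (\<phi> t x)))\<bar> =
      exp (real CARD('e basis_index) * r t x) * \<bar>gram (local2 A \<omega> ?c (coord ?c x))\<bar>"
    by (simp add: abs_mult)
qed (use atlas flow_0 flow_add differentiable_flow winding_add winding_continuous in auto)

section \<open>Coordinates transversal to a hypersurface\<close>

lemma gronwall_zero_right:
  fixes s :: "real \<Rightarrow> real"
  assumes der: "\<And>t. \<bar>t\<bar> < \<epsilon> \<Longrightarrow> (s has_real_derivative s' t) (at t)"
    and bound: "\<And>t. \<bar>t\<bar> < \<epsilon> \<Longrightarrow> \<bar>s' t\<bar> \<le> C * \<bar>s t\<bar>" and "s 0 = 0" "0 \<le> t" "t < \<epsilon>"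
  shows "s t = 0"
proof -
  let ?F = "\<lambda>t. s t * s t * exp (- 2 * C * t)"
  have "?F t \<le> ?F 0"
  proof (rule DERIV_nonpos_imp_nonincreasing[OF assms(4)])
    fix \<tau> assume "0 \<le> \<tau>" "\<tau> \<le> t"
    then have \<tau>: "\<bar>\<tau>\<bar> < \<epsilon>" using assms by auto
    have "s' \<tau> * s \<tau> \<le> \<bar>s' \<tau>\<bar> * \<bar>s \<tau>\<bar>" by (metis abs_ge_self abs_mult)
    also have "\<dots> \<le> C * \<bar>s \<tau>\<bar> * \<bar>s \<tau>\<bar>" by (intro mult_right_mono bound[OF \<tau>]) auto
    finally have le: "s' \<tau> * s \<tau> \<le> C * (s \<tau> * s \<tau>)" by (simp add: mult.assoc)
    have "(?F has_real_derivative 2 * (s' \<tau> * s \<tau> - C * (s \<tau> * s \<tau>)) * exp (- 2 * C * \<tau>)) (at \<tau>)"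
      by (rule derivative_eq_intros der[OF \<tau>] refl | simp add: algebra_simps)+
    moreover have "2 * (s' \<tau> * s \<tau> - C * (s \<tau> * s \<tau>)) * exp (- 2 * C * \<tau>) \<le> 0"
      by (intro mult_nonpos_nonneg mult_nonneg_nonpos) (use le in auto)
    ultimately show "\<exists>y. (?F has_real_derivative y) (at \<tau>) \<and> y \<le> 0" by blast
  qed
  then have "s t * s t \<le> 0" using assms(3) by (simp add: mult_le_0_iff)
  then show ?thesis by (metis mult_eq_0_iff not_square_less_zero order_antisym_conv not_less)
qed

lemma gronwall_zero:
  fixes s :: "real \<Rightarrow> real"
  assumes der: "\<And>t. \<bar>t\<bar> < \<epsilon> \<Longrightarrow> (s has_real_derivative s' t) (at t)"
    and bound: "\<And>t. \<bar>t\<bar> < \<epsilon> \<Longrightarrow> \<bar>s' t\<bar> \<le> C * \<bar>s t\<bar>" and s0: "s 0 = 0" and t: "\<bar>t\<bar> < \<epsilon>"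
  shows "s t = 0"
proof (cases "t \<ge> 0")
  case True
  then show ?thesis using gronwall_zero_right[of \<epsilon> s s' C t] assms by auto
next
  case False
  have "((\<lambda>t. s (- t)) has_real_derivative - s' (- t)) (at t)" if "\<bar>t\<bar> < \<epsilon>" for t
    using der[of "- t"] that by (simp add: DERIV_mirror)
  then have "s (- (- t)) = 0"
    using False bound s0 t by (intro gronwall_zero_right[of \<epsilon> "\<lambda>t. s (- t)" "\<lambda>t. - s' (- t)" C "- t"]) auto
  then show ?thesis by simp
qed

text \<open>A hypersurface parametrised by \<open>\<iota>\<close> is straightened by \<open>(s, u) \<mapsto> \<iota>(u) + s w\<close> for a vector \<open>w\<close> that is not tangent to it;
the derivative of this map in \<open>s\<close> is the constant \<open>w\<close>. The inverse function theorem concerns maps of a space to itself,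
so it is applied after composition with the inverse \<open>E\<close> of the derivative at the base point.\<close>

lemma transversal_chart:
  fixes \<iota> :: "'f::euclidean_space \<Rightarrow> 'e::euclidean_space"
  assumes dim: "DIM('e) = DIM('f) + 1"
    and W: "open W" "u0 \<in> W" and \<iota>: "smooth_on W \<iota>"
    and inj: "inj (\<lambda>(s :: real, u). s *\<^sub>R w + frechet_derivative \<iota> (at u0) u)"
    and V0: "open V0" "\<iota> u0 \<in> V0"
  obtains U V g where "open U" "(0 :: real, u0) \<in> U" "U \<subseteq> UNIV \<times> W" "open V" "V \<subseteq> V0" "\<iota> u0 \<in> V"
    "\<forall>z\<in>U. \<iota> (snd z) + fst z *\<^sub>R w \<in> V \<and> g (\<iota> (snd z) + fst z *\<^sub>R w) = z"
    "\<forall>y\<in>V. g y \<in> U \<and> \<iota> (snd (g y)) + fst (g y) *\<^sub>R w = y"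
    "\<forall>y\<in>V. g differentiable (at y)"
proof -
  let ?D = "\<lambda>u. frechet_derivative \<iota> (at u)"
  have linD: "linear (?D u)" if "u \<in> W" for u
    using smooth_on_differentiable[OF \<iota> that] by (rule linear_frechet_derivative)
  let ?J = "\<lambda>(s :: real, u). s *\<^sub>R w + ?D u0 u"
  have linJ: "linear ?J"
    using linD[OF W(2)] by (auto intro!: linearI simp: linear_add linear_cmul algebra_simps)
  obtain E where E: "linear E" "E \<circ> ?J = id"
    using linear_injective_left_inverse[OF linJ inj] by blast
  have "dim (range ?J) = DIM('e)"
    using dim_image_eq[OF linJ, of UNIV] inj dim by (simp add: inj_on_subset)
  then have "span (range ?J) = UNIV" by (simp add: dim_eq_full)
  then have "surj ?J"
    using linear_subspace_image[OF linJ subspace_UNIV] by (metis span_eq_iff)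
  then have JE: "?J (E y) = y" for y
  proof -
    obtain z where z: "y = ?J z" using \<open>surj ?J\<close> by (rule surjE)
    have "E (?J z) = z" using fun_cong[OF E(2), of z] by (simp add: o_def)
    then show ?thesis unfolding z by (rule arg_cong)
  qed
  have bE: "bounded_linear E" using E(1) linear_conv_bounded_linear by blast
  let ?\<Phi> = "\<lambda>z :: real \<times> 'f. \<iota> (snd z) + fst z *\<^sub>R w"
  let ?\<Phi>' = "\<lambda>z h :: real \<times> 'f. ?D (snd z) (snd h) + fst h *\<^sub>R w"
  let ?f = "\<lambda>z. E (?\<Phi> z)"
  define f' where "f' = (\<lambda>z :: real \<times> 'f. Blinfun (\<lambda>h. E (?\<Phi>' z h)))"
  let ?S = "UNIV \<times> W :: (real \<times> 'f) set"
  have der\<Phi>: "(?\<Phi> has_derivative ?\<Phi>' z) (at z)" if "z \<in> ?S" for z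
  proof -
    have "((\<iota> \<circ> snd) has_derivative (?D (snd z) \<circ> snd)) (at z)"
      using smooth_on_has_derivative[OF \<iota>, of "snd z"] that
      by (intro diff_chain_at has_derivative_snd has_derivative_ident) auto
    then show ?thesis
      by (auto intro!: derivative_eq_intros simp: o_def)
  qed
  have der: "(?f has_derivative (\<lambda>h. E (?\<Phi>' z h))) (at z)" if "z \<in> ?S" for z
    using bounded_linear.has_derivative[OF bE der\<Phi>[OF that]] .
  have f': "blinfun_apply (f' z) = (\<lambda>h. E (?\<Phi>' z h))" if "z \<in> ?S" for z
    unfolding f'_def using has_derivative_bounded_linear[OF der[OF that]] by (rule bounded_linear_Blinfun_apply)
  have cont: "continuous_on ?S f'"
  proof (rule continuous_on_blinfun_componentwise)
    fix i :: "real \<times> 'f" assume "i \<in> Basis"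
    have "continuous_on ?S ((\<lambda>u. ?D u (snd i)) \<circ> snd)"
      by (rule continuous_on_compose[OF _ continuous_on_subset[OF smooth_on_continuous[OF smooth_on_derivative[OF \<iota>]]]])
        (auto intro!: continuous_intros)
    then have "continuous_on ?S (\<lambda>z. E (?\<Phi>' z i))"
      by (intro bounded_linear.continuous_on[OF bE] continuous_intros) (simp add: o_def)
    then show "continuous_on ?S (\<lambda>z. blinfun_apply (f' z) i)"
      by (rule continuous_on_eq) (simp add: f')
  qed
  have S: "open ?S" "(0, u0) \<in> ?S" using W by (auto intro: open_Times)
  have id: "id_blinfun o\<^sub>L f' (0, u0) = id_blinfun"
  proof (rule blinfun_eqI)
    fix h :: "real \<times> 'f"
    have "E (?J h) = h" using E(2) by (metis comp_apply id_apply)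
    then show "blinfun_apply (id_blinfun o\<^sub>L f' (0, u0)) h = blinfun_apply id_blinfun h"
      using f'[OF S(2)] by (simp add: split_def add.commute)
  qed
  have der': "(?f has_derivative blinfun_apply (f' z)) (at z)" if "z \<in> ?S" for z
    using der[OF that] f'[OF that] by simp
  show ?thesis
  proof (rule inverse_function_theorem[OF S(1) der' cont S(2) id])
    fix U1 V1 g1 g'
    assume U1: "open U1" "U1 \<subseteq> ?S" "(0, u0) \<in> U1" and V1: "open V1" "?f (0, u0) \<in> V1"
      and hom: "homeomorphism U1 V1 ?f g1" and g': "\<And>y. y \<in> V1 \<Longrightarrow> (g1 has_derivative g' y) (at y)"
    define V where "V = V0 \<inter> E -` V1"
    define U where "U = U1 \<inter> ?\<Phi> -` V0"
    have J\<Phi>: "?J (?f z) = ?\<Phi> z" for z by (rule JE)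
    show ?thesis
    proof (rule that[of U V "g1 \<circ> E"])
      have "continuous_on U1 ?\<Phi>"
        using der\<Phi> U1(2) by (intro continuous_at_imp_continuous_on) (auto dest: has_derivative_continuous)
      then show "open U" unfolding U_def using U1(1) V0(1) by (rule continuous_open_preimage)
      show "(0, u0) \<in> U" "U \<subseteq> UNIV \<times> W" using U1 V0 by (auto simp: U_def)
      show "open V" unfolding V_def
        by (intro open_Int V0(1) open_vimage V1(1) linear_continuous_on bE)
      show "V \<subseteq> V0" "\<iota> u0 \<in> V" using V0 V1 by (auto simp: V_def)
      show "\<forall>z\<in>U. ?\<Phi> z \<in> V \<and> (g1 \<circ> E) (?\<Phi> z) = z"
      proof
        fix z assume "z \<in> U"
        then have z: "z \<in> U1" "?\<Phi> z \<in> V0" by (auto simp: U_def)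
        have "?f z \<in> V1" "g1 (?f z) = z"
          using z(1) homeomorphism_image1[OF hom] homeomorphism_apply1[OF hom] by blast+
        then show "?\<Phi> z \<in> V \<and> (g1 \<circ> E) (?\<Phi> z) = z" using z(2) by (simp add: V_def)
      qed
      show "\<forall>y\<in>V. (g1 \<circ> E) y \<in> U \<and> \<iota> (snd ((g1 \<circ> E) y)) + fst ((g1 \<circ> E) y) *\<^sub>R w = y"
      proof
        fix y assume "y \<in> V"
        then have y: "E y \<in> V1" "y \<in> V0" by (auto simp: V_def)
        then have 1: "g1 (E y) \<in> U1" "?f (g1 (E y)) = E y"
          using homeomorphism_image2[OF hom] homeomorphism_apply2[OF hom] by blast+
        have "?\<Phi> (g1 (E y)) = y" using J\<Phi>[of "g1 (E y)"] JE[of y] 1(2) by simp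
        then show "(g1 \<circ> E) y \<in> U \<and> \<iota> (snd ((g1 \<circ> E) y)) + fst ((g1 \<circ> E) y) *\<^sub>R w = y"
          using 1(1) y(2) by (simp add: U_def)
      qed
      show "\<forall>y\<in>V. (g1 \<circ> E) differentiable (at y)"
        using diff_chain_at[OF linear_imp_has_derivative[OF E(1)] g'] unfolding V_def differentiable_def by blast
    qed
  qed
qed

section \<open>The leaf and its volume density\<close>

text \<open>Properness of the inclusion implies that the leaf is closed in \<open>{H \<noteq> 0}\<close> and that its parts away from \<open>{H = 0}\<close>
are compact; embeddedness says that points of the leaf that are close in \<open>M\<close> are close in the leaf.\<close>

locale closed_leaf = closed_hamiltonian_flow A \<eta> \<omega> H X \<phi>
  for A :: "('m, 'e::euclidean_space) atlas" and \<eta> \<omega> H X \<phi> +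
  fixes B :: "('m, 'f::euclidean_space) atlas"
  assumes dim: "DIM('e) = DIM('f) + 1"
    and embedded: "embedded_leaf A \<eta> H B"
    and nonzero: "points B \<subseteq> {x \<in> points A. H x \<noteq> 0}"
    and proper: "proper_map (atlas_topology B) (subtopology (atlas_topology A) {x \<in> points A. H x \<noteq> 0}) (\<lambda>x. x)"
begin

lemma integral_manifold: "connected_integral_manifold A \<eta> H B"
  using embedded by (simp add: embedded_leaf_def leaf_def)

lemma B_atlas: "smooth_atlas B" "second_countable (atlas_topology B)"
  using integral_manifold by (auto simp: connected_integral_manifold_def manifold_def)

lemma points_B: "x \<in> points B \<Longrightarrow> x \<in> points A"
  using nonzero by auto

lemma inclusion: "differentiable_map B A (\<lambda>x. x)"
  using integral_manifold smooth_map_imp_differentiable_map by (auto simp: connected_integral_manifold_def)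

lemma inclusion_smooth:
  assumes "b \<in> B" "a \<in> A"
  shows "smooth_on (coord b ` {x \<in> chart_domain b. x \<in> chart_domain a}) (local_rep b (\<lambda>x. x) a)"
  using integral_manifold assms
  unfolding connected_integral_manifold_def smooth_map_def Let_def local_rep_def by blast

abbreviation lee :: "'m \<Rightarrow> 'e \<Rightarrow> real" where "lee \<equiv> lee_d_fun A \<eta> H"

definition local_lee :: "('m, 'e) chart \<Rightarrow> 'e \<Rightarrow> 'e \<Rightarrow> real" where
  "local_lee a y v = local2 A \<omega> a y (local_field a y) v"

lemma local_lee_eq:
  assumes a: "a \<in> A" "x \<in> chart_domain a"
  shows "local_lee a (coord a x) v = lee x (tangent_of_coords A a x v)"
  using hamiltonian chart_domain_points[OF a] atlas a tangent_coords_inverse(1)[OF atlas(1) a]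
  by (simp add: local_lee_def local2_def local_field_def Let_def hamiltonian_vector_field_def)

lemma local_lee_linear: "a \<in> A \<Longrightarrow> y \<in> coord a ` chart_domain a \<Longrightarrow> linear (local_lee a y)"
  using local2_bilinear[of a y] unfolding local_lee_def[abs_def] bilinear_def by blast

lemma local_lee_continuous: "a \<in> A \<Longrightarrow> continuous_on (coord a ` chart_domain a) (\<lambda>y. local_lee a y v)"
proof -
  assume a: "a \<in> A"
  have "continuous_on (coord a ` chart_domain a) (\<lambda>y. frechet_derivative (local_H a) (at y) v - local_H a y * local1 A \<eta> a y v)"
    by (intro continuous_intros smooth_on_continuous smooth_on_derivative smooth_local_H smooth_local1 a)
  then show ?thesis by (rule continuous_on_eq) (simp add: local_lee_def local_hamilton_equation[OF a])
qed

lemma local_lee_field: "a \<in> A \<Longrightarrow> y \<in> coord a ` chart_domain a \<Longrightarrow> local_lee a y (local_field a y) = 0"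
proof -
  assume "a \<in> A" "y \<in> coord a ` chart_domain a"
  then have "chart_inv a y \<in> points A" by (intro chart_domain_points[OF _ coord_chart_inv(2)])
  then show ?thesis by (simp add: local_lee_def local2_def Let_def \<omega>_diag)
qed

text \<open>An integral manifold is defined by means of one chosen chart at each point; coordinate changes transfer the condition to
all charts, as is necessary for computing near a point and not only at it.\<close>

lemma inclusion_derivative:
  assumes b: "b \<in> B" "x \<in> chart_domain b" and a: "a \<in> A" "x \<in> chart_domain a"
  shows "inj (rep_deriv b (\<lambda>x. x) a x)"
    and "range (rep_deriv b (\<lambda>x. x) a x) = {v. local_lee a (coord a x) v = 0}"
proof -
  let ?\<iota> = "rep_deriv b (\<lambda>x. x) a x" and ?T = "tangent_map B A (\<lambda>x. x) x"
  have x: "x \<in> points B" by (rule chart_domain_points[OF b])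
  have T: "inj ?T" "range ?T = {v. lee x v = 0}"
    using integral_manifold x by (auto simp: connected_integral_manifold_def invariant_distribution_def)
  have eq: "?T (tangent_of_coords B b x u) = tangent_of_coords A a x (?\<iota> u)" for u
    by (rule tangent_map_tangent_of_coords[OF B_atlas(1) atlas(1) inclusion b a])
  note invA = tangent_coords_inverse[OF atlas(1) a] and invB = tangent_coords_inverse[OF B_atlas(1) b]
  show "inj ?\<iota>"
  proof (rule injI)
    fix u v assume "?\<iota> u = ?\<iota> v"
    then have "tangent_of_coords B b x u = tangent_of_coords B b x v" using eq T(1) by (metis injD)
    then show "u = v" using invB(2) by metis
  qed
  show "range ?\<iota> = {v. local_lee a (coord a x) v = 0}"
  proof (intro set_eqI iffI)
    fix v assume "v \<in> range ?\<iota>"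
    then obtain u where "v = ?\<iota> u" by auto
    moreover have "lee x (?T (tangent_of_coords B b x u)) = 0" using T(2) by blast
    ultimately show "v \<in> {v. local_lee a (coord a x) v = 0}" using eq by (simp add: local_lee_eq[OF a])
  next
    fix v assume "v \<in> {v. local_lee a (coord a x) v = 0}"
    then have "tangent_of_coords A a x v \<in> range ?T" using T(2) by (simp add: local_lee_eq[OF a])
    then obtain z where "tangent_of_coords A a x v = ?T z" by auto
    then have "tangent_of_coords A a x v = tangent_of_coords A a x (?\<iota> (coords_of_tangent B b x z))"
      using eq invB(1) by metis
    then have "v = ?\<iota> (coords_of_tangent B b x z)" using invA(2) by metis
    then show "v \<in> range ?\<iota>" by simp
  qed
qed

definition transversal :: "'m \<Rightarrow> 'e" where
  "transversal p = (SOME w. lee p w \<noteq> 0)"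

lemma transversal: "p \<in> points B \<Longrightarrow> lee p (transversal p) \<noteq> 0"
proof -
  assume "p \<in> points B"
  then have "\<exists>w. lee p w \<noteq> 0"
    using integral_manifold by (auto simp: connected_integral_manifold_def regular_set_def)
  then show ?thesis unfolding transversal_def by (rule someI_ex)
qed

definition incl :: "'m \<Rightarrow> 'f \<Rightarrow> 'e" where
  "incl p = local_rep (chart_at B p) (\<lambda>x. x) (chart_at A p)"

definition common :: "'m \<Rightarrow> 'f set" where
  "common p = coord (chart_at B p) ` {x \<in> chart_domain (chart_at B p). x \<in> chart_domain (chart_at A p)}"

text \<open>The vector \<open>transversal p\<close> is used as a constant field in the coordinates around \<open>p\<close>; it is transversal to the leaf
only near \<open>p\<close>, and \<open>frame p u\<close> is an isomorphism there.\<close>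

definition leaf_nbhd :: "'m \<Rightarrow> 'f set" where
  "leaf_nbhd p = {u \<in> common p. local_lee (chart_at A p) (incl p u) (transversal p) \<noteq> 0}"

definition frame :: "'m \<Rightarrow> 'f \<Rightarrow> real \<times> 'f \<Rightarrow> 'e" where
  "frame p u = (\<lambda>(s, v). s *\<^sub>R transversal p + frechet_derivative (incl p) (at u) v)"

context
  fixes p assumes p: "p \<in> points B"
begin

lemma ambient_chart: "chart_at A p \<in> A" "p \<in> chart_domain (chart_at A p)"
  and leaf_chart: "chart_at B p \<in> B" "p \<in> chart_domain (chart_at B p)"
  using chart_at[OF points_B[OF p]] chart_at[OF p] by auto

lemma open_common: "open (common p)"
  unfolding common_def by (rule differentiable_mapD(1)[OF inclusion leaf_chart(1) ambient_chart(1)])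

lemma incl_smooth: "smooth_on (common p) (incl p)"
  unfolding common_def incl_def by (rule inclusion_smooth[OF leaf_chart(1) ambient_chart(1)])

lemma commonE:
  assumes "u \<in> common p"
  obtains x where "x \<in> chart_domain (chart_at B p)" "x \<in> chart_domain (chart_at A p)"
    "u = coord (chart_at B p) x" "chart_inv (chart_at B p) u = x" "incl p u = coord (chart_at A p) x"
    "frechet_derivative (incl p) (at u) = rep_deriv (chart_at B p) (\<lambda>x. x) (chart_at A p) x"
  using assms B_atlas leaf_chart by (auto simp: common_def incl_def local_rep_apply rep_deriv_def)

lemma incl_in_chart: "u \<in> common p \<Longrightarrow> incl p u \<in> coord (chart_at A p) ` chart_domain (chart_at A p)"
  by (erule commonE) auto

lemma linear_incl_derivative: "u \<in> common p \<Longrightarrow> linear (frechet_derivative (incl p) (at u))"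
  using smooth_on_differentiable[OF incl_smooth] by (rule linear_frechet_derivative)

lemma range_incl_derivative:
  assumes u: "u \<in> common p"
  shows "range (frechet_derivative (incl p) (at u)) = {v. local_lee (chart_at A p) (incl p u) v = 0}"
    and "inj (frechet_derivative (incl p) (at u))"
proof -
  obtain x where x: "x \<in> chart_domain (chart_at B p)" "x \<in> chart_domain (chart_at A p)"
    "incl p u = coord (chart_at A p) x"
    "frechet_derivative (incl p) (at u) = rep_deriv (chart_at B p) (\<lambda>x. x) (chart_at A p) x"
    using commonE[OF u] by metis
  show "range (frechet_derivative (incl p) (at u)) = {v. local_lee (chart_at A p) (incl p u) v = 0}"
    "inj (frechet_derivative (incl p) (at u))"
    using inclusion_derivative[OF leaf_chart(1) x(1) ambient_chart(1) x(2)] by (simp_all add: x(3,4))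
qed

lemma local_lee_incl_derivative:
  "u \<in> common p \<Longrightarrow> local_lee (chart_at A p) (incl p u) (frechet_derivative (incl p) (at u) v) = 0"
  using range_incl_derivative(1) by blast

lemma continuous_local_lee_incl: "continuous_on (common p) (\<lambda>u. local_lee (chart_at A p) (incl p u) v)"
  by (rule continuous_on_compose2[OF local_lee_continuous[OF ambient_chart(1)] smooth_on_continuous[OF incl_smooth]])
    (use incl_in_chart in auto)

lemma base_in_leaf_nbhd: "coord (chart_at B p) p \<in> leaf_nbhd p"
proof -
  have "coord (chart_at B p) p \<in> common p" using ambient_chart leaf_chart by (auto simp: common_def)
  moreover have "incl p (coord (chart_at B p) p) = coord (chart_at A p) p"
    using B_atlas leaf_chart by (simp add: incl_def local_rep_apply)
  ultimately show ?thesis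
    using transversal[OF p] by (simp add: leaf_nbhd_def local_lee_eq[OF ambient_chart] tangent_of_coords_chart_at[OF atlas(1) points_B[OF p]])
qed

lemma open_leaf_nbhd: "open (leaf_nbhd p)"
proof -
  have "open (common p \<inter> (\<lambda>u. local_lee (chart_at A p) (incl p u) (transversal p)) -` (- {0}))"
    by (rule continuous_open_preimage[OF continuous_local_lee_incl open_common]) auto
  also have "common p \<inter> (\<lambda>u. local_lee (chart_at A p) (incl p u) (transversal p)) -` (- {0}) = leaf_nbhd p"
    by (auto simp: leaf_nbhd_def)
  finally show ?thesis .
qed

lemma linear_frame: "u \<in> common p \<Longrightarrow> linear (frame p u)"
  using linear_incl_derivative by (auto intro!: linearI simp: frame_def linear_add linear_cmul algebra_simps)

lemma local_lee_frame:
  assumes u: "u \<in> common p"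
  shows "local_lee (chart_at A p) (incl p u) (frame p u (s, v)) = s * local_lee (chart_at A p) (incl p u) (transversal p)"
  using local_lee_linear[OF ambient_chart(1) incl_in_chart[OF u]] local_lee_incl_derivative[OF u]
  by (simp add: frame_def linear_add linear_cmul)

lemma bij_frame:
  assumes u: "u \<in> leaf_nbhd p"
  shows "bij (frame p u)"
proof -
  have uc: "u \<in> common p" and nz: "local_lee (chart_at A p) (incl p u) (transversal p) \<noteq> 0"
    using u by (auto simp: leaf_nbhd_def)
  note lin = local_lee_linear[OF ambient_chart(1) incl_in_chart[OF uc]]
  have "z = 0" if z: "frame p u z = 0" for z
  proof -
    have "fst z * local_lee (chart_at A p) (incl p u) (transversal p) = 0"
      using local_lee_frame[OF uc, of "fst z" "snd z"] z linear_0[OF lin] by simp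
    then have s: "fst z = 0" using nz by simp
    then have "frechet_derivative (incl p) (at u) (snd z) = 0" using z by (simp add: frame_def split_def)
    then have "snd z = 0"
      using range_incl_derivative(2)[OF uc] linear_0[OF linear_incl_derivative[OF uc]] by (metis injD)
    with s show ?thesis by (simp add: prod_eq_iff)
  qed
  then have "inj (frame p u)" using linear_injective_0[OF linear_frame[OF uc]] by blast
  moreover have "v \<in> range (frame p u)" for v
  proof -
    let ?s = "local_lee (chart_at A p) (incl p u) v / local_lee (chart_at A p) (incl p u) (transversal p)"
    have "local_lee (chart_at A p) (incl p u) (v - ?s *\<^sub>R transversal p) = 0"
      using nz by (simp add: linear_diff[OF lin] linear_cmul[OF lin])
    then obtain z where "v - ?s *\<^sub>R transversal p = frechet_derivative (incl p) (at u) z"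
      using range_incl_derivative(1)[OF uc] by blast
    then have "v = frame p u (?s, z)" by (simp add: frame_def algebra_simps)
    then show ?thesis by blast
  qed
  ultimately show ?thesis by (auto simp: bij_def)
qed

end

text \<open>If \<open>\<theta>\<close> is a volume form on the leaf with \<open>(dH - H\<eta>) \<and> \<theta>\<close> equal to the volume of \<open>M\<close>, then \<open>\<theta>(v\<^sub>1, \<dots>) =
vol(w, v\<^sub>1, \<dots>) / (dH - H\<eta>)(w)\<close> for every \<open>w\<close>. The square of this quotient, with \<open>w\<close> the transversal vector, is the density.\<close>

definition leaf_density :: "'m \<Rightarrow> 'f \<Rightarrow> real" where
  "leaf_density p u =
     \<bar>gram (\<lambda>z z'. local2 A \<omega> (chart_at A p) (incl p u) (frame p u z) (frame p u z'))\<bar> /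
     (local_lee (chart_at A p) (incl p u) (transversal p))\<^sup>2"

lemma frame_form_bilinear:
  assumes p: "p \<in> points B" and u: "u \<in> common p"
  shows "bilinear (\<lambda>z z'. local2 A \<omega> (chart_at A p) (incl p u) (frame p u z) (frame p u z'))"
  using local2_bilinear[OF ambient_chart(1)[OF p] incl_in_chart[OF p u]] linear_frame[OF p u]
  unfolding bilinear_def by (auto intro: linear_compose[OF linear_frame[OF p u], unfolded o_def])

lemma leaf_density_pos:
  assumes p: "p \<in> points B" and u: "u \<in> leaf_nbhd p"
  shows "leaf_density p u > 0"
proof -
  have uc: "u \<in> common p" and nz: "local_lee (chart_at A p) (incl p u) (transversal p) \<noteq> 0"
    using u by (auto simp: leaf_nbhd_def)
  have "gram (\<lambda>z z'. local2 A \<omega> (chart_at A p) (incl p u) (frame p u z) (frame p u z')) \<noteq> 0"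
  proof (rule gram_nonzero[OF frame_form_bilinear[OF p uc]])
    fix z assume z: "\<And>z'. local2 A \<omega> (chart_at A p) (incl p u) (frame p u z) (frame p u z') = 0"
    have "local2 A \<omega> (chart_at A p) (incl p u) (frame p u z) v = 0" for v
      using z bij_frame[OF p u] by (metis bij_pointE)
    then have "frame p u z = 0"
      by (rule local2_nondegenerate[OF ambient_chart(1)[OF p] incl_in_chart[OF p uc]])
    then show "z = 0"
      using bij_frame[OF p u] linear_0[OF linear_frame[OF p uc]] by (metis bij_is_inj injD)
  qed
  then show ?thesis using nz by (simp add: leaf_density_def)
qed

lemma leaf_density_continuous:
  assumes p: "p \<in> points B"
  shows "continuous_on (leaf_nbhd p) (leaf_density p)"
proof -
  have sub: "leaf_nbhd p \<subseteq> common p" by (auto simp: leaf_nbhd_def)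
  have fr: "continuous_on (common p) (\<lambda>u. frame p u z)" for z
    unfolding frame_def split_def
    by (intro continuous_intros smooth_on_continuous[OF smooth_on_derivative[OF incl_smooth[OF p]]])
  have "continuous_on (common p) (\<lambda>u. local2 A \<omega> (chart_at A p) (incl p u) (frame p u z) (frame p u z'))" for z z'
  proof -
    have "continuous_on (common p) (\<lambda>u. \<Sum>i\<in>Basis. \<Sum>j\<in>Basis. (frame p u z \<bullet> i) * (frame p u z' \<bullet> j) *
        local2 A \<omega> (chart_at A p) (incl p u) i j)"
      by (intro continuous_intros fr continuous_on_compose2[OF smooth_on_continuous[OF smooth_local2[OF ambient_chart(1)[OF p]]]
            smooth_on_continuous[OF incl_smooth[OF p]]])
        (use incl_in_chart[OF p] in auto)
    then show ?thesis
      by (rule continuous_on_eq) (rule bilinear_expand[OF local2_bilinear[OF ambient_chart(1)[OF p] incl_in_chart[OF p]], symmetric])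
  qed
  then show ?thesis
    unfolding leaf_density_def
    by (intro continuous_on_divide continuous_on_rabs continuous_on_gram continuous_on_power
        continuous_on_subset[OF _ sub] continuous_local_lee_incl[OF p])
      (auto simp: leaf_nbhd_def)
qed

end

section \<open>Invariance of the leaf under the flow\<close>

lemma (in hamiltonian_flow) open_orbit_preimage:
  assumes x: "x \<in> points A" and O: "atlas_open A Q"
  shows "open {s. \<phi> s x \<in> Q}"
proof -
  have "open {s. \<phi> s x \<in> chart_domain d \<and> \<phi> s x \<in> Q}" if d: "d \<in> A" for d
  proof -
    let ?T = "{s. \<phi> s x \<in> chart_domain d}"
    have "continuous_on ?T (\<lambda>s. coord d (\<phi> s x))"
      using flow_chart_derivative[OF x d] has_vector_derivative_continuous
      by (intro continuous_at_imp_continuous_on) blast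
    from continuous_open_preimage[OF this open_flow_times[OF x d] atlas_open_Int_chart_image[OF atlas(1) O d]]
    have "open (?T \<inter> (\<lambda>s. coord d (\<phi> s x)) -` (coord d ` {x \<in> chart_domain d. x \<in> Q}))" .
    also have "?T \<inter> (\<lambda>s. coord d (\<phi> s x)) -` (coord d ` {x \<in> chart_domain d. x \<in> Q}) =
        {s. \<phi> s x \<in> chart_domain d \<and> \<phi> s x \<in> Q}"
      using chart_inv_coord[OF atlas(1) d] by (auto simp: image_iff) metis
    finally show ?thesis .
  qed
  then have "open (\<Union>d\<in>A. {s. \<phi> s x \<in> chart_domain d \<and> \<phi> s x \<in> Q})" by auto
  also have "\<dots> = {s. \<phi> s x \<in> Q}"
    using O by (fastforce simp: atlas_open_def points_def)
  finally show ?thesis .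
qed

context closed_leaf
begin

lemma slice:
  assumes p: "p \<in> points B"
  obtains U V g where "open U" "(0 :: real, coord (chart_at B p) p) \<in> U" "U \<subseteq> UNIV \<times> leaf_nbhd p" "open V"
    "V \<subseteq> coord (chart_at A p) ` chart_domain (chart_at A p)" "coord (chart_at A p) p \<in> V"
    "\<forall>z\<in>U. incl p (snd z) + fst z *\<^sub>R transversal p \<in> V \<and> g (incl p (snd z) + fst z *\<^sub>R transversal p) = z"
    "\<forall>y\<in>V. g y \<in> U \<and> incl p (snd (g y)) + fst (g y) *\<^sub>R transversal p = y"
    "\<forall>y\<in>V. g differentiable (at y)"
proof -
  let ?u0 = "coord (chart_at B p) p"
  have smooth: "smooth_on (leaf_nbhd p) (incl p)"
    unfolding smooth_on_def
  proof
    fix k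
    have sub: "leaf_nbhd p \<subseteq> common p" by (auto simp: leaf_nbhd_def)
    have "Ck_on k S f \<Longrightarrow> T \<subseteq> S \<Longrightarrow> Ck_on k T f" for S T and f :: "'f \<Rightarrow> 'e"
      by (induction k arbitrary: f) (auto intro: continuous_on_subset)
    then show "Ck_on k (leaf_nbhd p) (incl p)"
      using incl_smooth[OF p] sub by (auto simp: smooth_on_def)
  qed
  have inj: "inj (\<lambda>(s :: real, u). s *\<^sub>R transversal p + frechet_derivative (incl p) (at ?u0) u)"
    using bij_is_inj[OF bij_frame[OF p base_in_leaf_nbhd[OF p]]] by (simp add: frame_def)
  have base: "incl p ?u0 = coord (chart_at A p) p"
    using B_atlas leaf_chart[OF p] by (simp add: incl_def local_rep_apply)
  show ?thesis
    by (rule transversal_chart[OF dim open_leaf_nbhd[OF p] base_in_leaf_nbhd[OF p] smooth inj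
          open_chart_image[OF atlas(1) ambient_chart(1)[OF p]]])
      (use ambient_chart[OF p] base that in \<open>simp_all add: base\<close>)
qed

lemma embedded_topology:
  assumes "atlas_open B T"
  obtains Q where "atlas_open A Q" "T = Q \<inter> points B"
proof -
  have "embedding_map (atlas_topology B) (atlas_topology A) (\<lambda>x. x)"
    using embedded by (simp add: embedded_leaf_def)
  then have "homeomorphic_map (atlas_topology B) (subtopology (atlas_topology A) (points B)) (\<lambda>x. x)"
    by (simp add: embedding_map_def topspace_atlas[OF B_atlas(1)])
  then have "open_map (atlas_topology B) (subtopology (atlas_topology A) (points B)) (\<lambda>x. x)"
    by (rule homeomorphic_imp_open_map)
  then have "openin (subtopology (atlas_topology A) (points B)) ((\<lambda>x. x) ` T)"
    using assms by (simp only: open_map_def openin_atlas_topology[OF B_atlas(1)])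
  then show ?thesis using that by (auto simp: openin_subtopology openin_atlas_topology[OF atlas(1)])
qed

text \<open>Near \<open>p\<close>, the leaf occupies only one sheet \<open>s = 0\<close> of the transversal coordinates. Here embeddedness is essential: an
immersed leaf can return to every neighbourhood of \<open>p\<close>.\<close>

lemma plaque:
  assumes p: "p \<in> points B" and U: "open U" "(0 :: real, coord (chart_at B p) p) \<in> U"
  obtains V where "open V" "coord (chart_at A p) p \<in> V"
    "\<forall>x\<in>points B. x \<in> chart_domain (chart_at A p) \<longrightarrow> coord (chart_at A p) x \<in> V \<longrightarrow>
      x \<in> chart_domain (chart_at B p) \<and> (0, coord (chart_at B p) x) \<in> U"
proof -
  have "open ((\<lambda>u. (0 :: real, u)) -` U)" by (intro open_vimage U continuous_intros)
  from atlas_open_chart_preimage[OF B_atlas(1) leaf_chart(1)[OF p] this]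
  obtain Q where Q: "atlas_open A Q"
    "{x \<in> chart_domain (chart_at B p). coord (chart_at B p) x \<in> (\<lambda>u. (0, u)) -` U} = Q \<inter> points B"
    by (rule embedded_topology)
  show ?thesis
  proof (rule that[OF atlas_open_Int_chart_image[OF atlas(1) Q(1) ambient_chart(1)[OF p]]])
    have "p \<in> Q" using Q(2) U(2) leaf_chart[OF p] by auto
    then show "coord (chart_at A p) p \<in> coord (chart_at A p) ` {x \<in> chart_domain (chart_at A p). x \<in> Q}"
      using ambient_chart[OF p] by auto
  next
    show "\<forall>x\<in>points B. x \<in> chart_domain (chart_at A p) \<longrightarrow>
        coord (chart_at A p) x \<in> coord (chart_at A p) ` {x \<in> chart_domain (chart_at A p). x \<in> Q} \<longrightarrow>
        x \<in> chart_domain (chart_at B p) \<and> (0, coord (chart_at B p) x) \<in> U"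
    proof (intro ballI impI)
      fix x assume x: "x \<in> points B" "x \<in> chart_domain (chart_at A p)"
        and "coord (chart_at A p) x \<in> coord (chart_at A p) ` {x \<in> chart_domain (chart_at A p). x \<in> Q}"
      then have "x \<in> Q" using chart_inv_coord[OF atlas(1) ambient_chart(1)[OF p]] by (auto simp: image_iff) metis
      then show "x \<in> chart_domain (chart_at B p) \<and> (0, coord (chart_at B p) x) \<in> U" using Q(2) x(1) by blast
    qed
  qed
qed

text \<open>Write an orbit in transversal coordinates as \<open>(s(t), u(t))\<close>. Applying \<open>\<alpha> = dH - H\<eta>\<close>, taken at the point \<open>\<iota>(u)\<close> of the
leaf, to the velocity gives \<open>s' \<alpha>(w) = \<alpha>(X(\<iota>(u) + s w))\<close>. The right-hand side vanishes for \<open>s = 0\<close>, since \<open>\<alpha>(X) = 0\<close>, and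
\<open>X\<close> is Lipschitz; so \<open>\<bar>s'\<bar> \<le> (C / m) \<bar>s\<bar>\<close> and \<open>s\<close> remains \<open>0\<close>. The orbit thus stays in the leaf for a short time. The
functions \<open>L\<close>, \<open>h\<close> and \<open>k\<close> below are \<open>\<alpha>(w)\<close>, the right-hand side, and its derivative in \<open>s\<close>.\<close>

lemma flow_stays_locally:
  assumes p: "p \<in> points B"
  shows "\<exists>\<epsilon>>0. \<forall>t. \<bar>t\<bar> < \<epsilon> \<longrightarrow> \<phi> t p \<in> points B"
proof -
  let ?a = "chart_at A p" and ?b = "chart_at B p" and ?w = "transversal p"
  let ?u0 = "coord ?b p" and ?im = "coord ?a ` chart_domain ?a"
  note pA = points_B[OF p] and a = ambient_chart[OF p] and b = leaf_chart[OF p]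
  obtain U V g where U: "open U" "(0 :: real, ?u0) \<in> U" "U \<subseteq> UNIV \<times> leaf_nbhd p"
    and V: "open V" "V \<subseteq> ?im" "coord ?a p \<in> V"
    and gU: "\<forall>z\<in>U. incl p (snd z) + fst z *\<^sub>R ?w \<in> V \<and> g (incl p (snd z) + fst z *\<^sub>R ?w) = z"
    and gV: "\<forall>y\<in>V. g y \<in> U \<and> incl p (snd (g y)) + fst (g y) *\<^sub>R ?w = y"
    and gd: "\<forall>y\<in>V. g differentiable (at y)"
    using slice[OF p] .
  have Uc: "snd z \<in> common p" "snd z \<in> leaf_nbhd p" if "z \<in> U" for z
    using U(3) that by (auto simp: leaf_nbhd_def)
  define L where "L u = local_lee ?a (incl p u) ?w" for u
  define h where "h z = local_lee ?a (incl p (snd z)) (local_field ?a (incl p (snd z) + fst z *\<^sub>R ?w))" for z :: "real \<times> 'f"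
  define k where "k z = local_lee ?a (incl p (snd z))
    (frechet_derivative (local_field ?a) (at (incl p (snd z) + fst z *\<^sub>R ?w)) ?w)" for z :: "real \<times> 'f"
  have Phi_V: "incl p (snd z) + fst z *\<^sub>R ?w \<in> V" if "z \<in> U" for z
    using gU that by blast
  have lee_expand: "local_lee ?a y v = (\<Sum>i\<in>Basis. (v \<bullet> i) * local_lee ?a y i)" if "y \<in> ?im" for y v
  proof -
    note lin = local_lee_linear[OF a(1) that]
    have "local_lee ?a y v = local_lee ?a y (\<Sum>i\<in>Basis. (v \<bullet> i) *\<^sub>R i)" by (simp add: euclidean_representation)
    then show ?thesis by (simp only: linear_sum[OF lin] linear_cmul[OF lin] real_scaleR_def)
  qed
  have cont_incl: "continuous_on U (\<lambda>z. incl p (snd z))"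
    by (rule continuous_on_compose2[OF smooth_on_continuous[OF incl_smooth[OF p]]])
      (use Uc in \<open>auto intro!: continuous_intros\<close>)
  have cont_k: "continuous_on U k"
  proof -
    have 1: "continuous_on U (\<lambda>z. frechet_derivative (local_field ?a) (at (incl p (snd z) + fst z *\<^sub>R ?w)) ?w)"
      by (rule continuous_on_compose2[OF smooth_on_continuous[OF smooth_on_derivative[OF smooth_local_field[OF a(1)]]]])
        (use Phi_V V(2) in \<open>auto intro!: continuous_intros cont_incl\<close>)
    have 2: "continuous_on U (\<lambda>z. local_lee ?a (incl p (snd z)) i)" for i
      by (rule continuous_on_compose2[OF local_lee_continuous[OF a(1)] cont_incl])
        (use incl_in_chart[OF p] Uc in auto)
    have "continuous_on U (\<lambda>z. \<Sum>i\<in>Basis. (frechet_derivative (local_field ?a) (at (incl p (snd z) + fst z *\<^sub>R ?w)) ?w \<bullet> i) *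
        local_lee ?a (incl p (snd z)) i)"
      by (intro continuous_intros 1 2)
    then show ?thesis
      by (rule continuous_on_eq) (simp add: k_def lee_expand[OF incl_in_chart[OF p Uc(1)], symmetric])
  qed
  \<comment> \<open>a product neighbourhood on which the constants of the differential inequality exist\<close>
  obtain \<delta> where \<delta>: "\<delta> > 0" "cball 0 \<delta> \<times> cball ?u0 \<delta> \<subseteq> U"
  proof -
    obtain P Q where "open P" "open Q" "(0 :: real, ?u0) \<in> P \<times> Q" "P \<times> Q \<subseteq> U"
      using open_prod_elim[OF U(1,2)] .
    then have PQ: "open P" "open Q" "(0 :: real) \<in> P" "?u0 \<in> Q" "P \<times> Q \<subseteq> U" by simp_all
    obtain d1 d2 where "d1 > 0" "cball 0 d1 \<subseteq> P" "d2 > 0" "cball ?u0 d2 \<subseteq> Q"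
      using PQ by (meson open_contains_cball)
    moreover have "cball (0 :: real) (min d1 d2) \<subseteq> cball 0 d1" "cball ?u0 (min d1 d2) \<subseteq> cball ?u0 d2" by auto
    ultimately show ?thesis using PQ(5) by (intro that[of "min d1 d2"]) (auto 0 3)
  qed
  let ?K = "cball (0 :: real) \<delta> \<times> cball ?u0 \<delta>"
  obtain C where C: "\<And>z. z \<in> ?K \<Longrightarrow> \<bar>k z\<bar> \<le> C"
  proof -
    have "compact (k ` ?K)"
      by (intro compact_continuous_image continuous_on_subset[OF cont_k \<delta>(2)] compact_Times compact_cball)
    then have "bounded (k ` ?K)" by (rule compact_imp_bounded)
    then obtain C where C: "\<forall>v\<in>k ` ?K. norm v \<le> C" unfolding bounded_iff ..
    show ?thesis
    proof (rule that)
      fix z assume "z \<in> ?K"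
      from bspec[OF C imageI[OF this]] show "\<bar>k z\<bar> \<le> C" by simp
    qed
  qed
  obtain m where m: "m > 0" "\<And>u. u \<in> cball ?u0 \<delta> \<Longrightarrow> m \<le> \<bar>L u\<bar>"
  proof -
    have sub: "cball ?u0 \<delta> \<subseteq> leaf_nbhd p"
    proof
      fix u assume "u \<in> cball ?u0 \<delta>"
      then have "(0, u) \<in> U" using \<delta> by auto
      then show "u \<in> leaf_nbhd p" using U(3) by auto
    qed
    have contL: "continuous_on (cball ?u0 \<delta>) (\<lambda>u. \<bar>L u\<bar>)"
      unfolding L_def
      by (intro continuous_on_rabs continuous_on_subset[OF continuous_local_lee_incl[OF p]])
        (use sub in \<open>auto simp: leaf_nbhd_def\<close>)
    have "cball ?u0 \<delta> \<noteq> {}" using \<delta>(1) by simp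
    from continuous_attains_inf[OF compact_cball this contL]
    obtain u1 where "u1 \<in> cball ?u0 \<delta>" "\<forall>u\<in>cball ?u0 \<delta>. \<bar>L u1\<bar> \<le> \<bar>L u\<bar>" by blast
    moreover have "L u1 \<noteq> 0" using \<open>u1 \<in> cball ?u0 \<delta>\<close> sub by (auto simp: leaf_nbhd_def L_def)
    ultimately show ?thesis by (intro that[of "\<bar>L u1\<bar>"]) auto
  qed
  have h_bound: "\<bar>h (s, u)\<bar> \<le> C * \<bar>s\<bar>" if "(s, u) \<in> ?K" for s u
  proof -
    have seg: "(\<sigma>, u) \<in> U" "(\<sigma>, u) \<in> ?K" if "\<sigma> \<in> cball 0 \<delta>" for \<sigma> using that \<open>(s, u) \<in> ?K\<close> \<delta> by auto
    have u: "incl p u \<in> ?im" using incl_in_chart[OF p Uc(1)[OF seg(1)[of 0]]] \<delta>(1) by simp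
    note lin = local_lee_linear[OF a(1) u]
    have der: "((\<lambda>\<sigma>. h (\<sigma>, u)) has_real_derivative k (\<sigma>, u)) (at \<sigma> within cball 0 \<delta>)" if "\<sigma> \<in> cball 0 \<delta>" for \<sigma>
    proof -
      have y: "incl p u + \<sigma> *\<^sub>R ?w \<in> ?im" using Phi_V[OF seg(1)[OF that]] V(2) by auto
      have "((\<lambda>\<sigma>. incl p u + \<sigma> *\<^sub>R ?w) has_derivative (\<lambda>d. d *\<^sub>R ?w)) (at \<sigma>)"
        by (auto intro!: derivative_eq_intros)
      from diff_chain_at[OF this smooth_on_has_derivative[OF smooth_local_field[OF a(1)] y]]
      have "((\<lambda>\<sigma>. local_field ?a (incl p u + \<sigma> *\<^sub>R ?w)) has_derivative
          (\<lambda>d. frechet_derivative (local_field ?a) (at (incl p u + \<sigma> *\<^sub>R ?w)) (d *\<^sub>R ?w))) (at \<sigma>)"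
        by (simp add: o_def)
      from diff_chain_at[OF this linear_imp_has_derivative[OF lin]]
      have "((\<lambda>\<sigma>. h (\<sigma>, u)) has_derivative (\<lambda>d. local_lee ?a (incl p u)
          (frechet_derivative (local_field ?a) (at (incl p u + \<sigma> *\<^sub>R ?w)) (d *\<^sub>R ?w)))) (at \<sigma>)"
        by (simp add: o_def h_def)
      moreover have "linear (frechet_derivative (local_field ?a) (at (incl p u + \<sigma> *\<^sub>R ?w)))"
        using smooth_on_differentiable[OF smooth_local_field[OF a(1)] y] by (rule linear_frechet_derivative)
      ultimately have "((\<lambda>\<sigma>. h (\<sigma>, u)) has_real_derivative k (\<sigma>, u)) (at \<sigma>)"
        by (simp add: has_field_derivative_def linear_cmul linear_cmul[OF lin] k_def mult_commute_abs)
      then show ?thesis by (rule has_field_derivative_at_within)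
    qed
    have "norm (h (s, u) - h (0, u)) \<le> C * norm (s - 0)"
      by (rule field_differentiable_bound[OF convex_cball der]) (use C seg(2) that \<delta>(1) in auto)
    moreover have "h (0, u) = 0" using local_lee_field[OF a(1) u] by (simp add: h_def)
    ultimately show ?thesis by simp
  qed
  let ?T = "{t. \<phi> t p \<in> chart_domain ?a}" and ?y = "\<lambda>t. coord ?a (\<phi> t p)"
  let ?V' = "V \<inter> g -` (ball 0 \<delta> \<times> ball ?u0 \<delta>)"
  have "open ?V'"
    using gd V(1) by (intro continuous_open_preimage continuous_at_imp_continuous_on ballI
        differentiable_imp_continuous_within open_Times open_ball) auto
  have cont_y: "continuous_on ?T ?y"
    using flow_chart_derivative[OF pA a(1)] has_vector_derivative_continuous
    by (intro continuous_at_imp_continuous_on) blast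
  have "open (?T \<inter> ?y -` ?V')"
    by (rule continuous_open_preimage[OF cont_y open_flow_times[OF pA a(1)] \<open>open ?V'\<close>])
  moreover have "0 \<in> ?T \<inter> ?y -` ?V'"
  proof -
    have "incl p ?u0 = coord ?a p" using B_atlas b by (simp add: incl_def local_rep_apply)
    then have "g (coord ?a p) = (0, ?u0)" using bspec[OF gU U(2)] by simp
    then show ?thesis using flow_0[OF pA] a V(3) \<delta>(1) by simp
  qed
  ultimately obtain \<epsilon> where \<epsilon>: "\<epsilon> > 0" "ball 0 \<epsilon> \<subseteq> ?T \<inter> ?y -` ?V'"
    by (meson open_contains_ball)
  have T: "\<phi> t p \<in> chart_domain ?a" "?y t \<in> V" "g (?y t) \<in> ball 0 \<delta> \<times> ball ?u0 \<delta>" if "\<bar>t\<bar> < \<epsilon>" for t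
    using \<epsilon>(2) that by (auto simp: subset_iff dist_real_def)
  define s where "s t = fst (g (?y t))" for t
  define s' where "s' t = fst (frechet_derivative g (at (?y t)) (local_field ?a (?y t)))" for t
  have z_K: "g (?y t) \<in> ?K" "g (?y t) \<in> U" if "\<bar>t\<bar> < \<epsilon>" for t
  proof -
    have "ball (0 :: real) \<delta> \<times> ball ?u0 \<delta> \<subseteq> ?K" by (intro Sigma_mono ball_subset_cball)
    then show "g (?y t) \<in> ?K" using T(3)[OF that] by (rule subsetD)
    then show "g (?y t) \<in> U" by (rule subsetD[OF \<delta>(2)])
  qed
  have der: "((\<lambda>t. g (?y t)) has_derivative (\<lambda>d. frechet_derivative g (at (?y t)) (d *\<^sub>R local_field ?a (?y t)))) (at t)"
    if "\<bar>t\<bar> < \<epsilon>" for t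
  proof -
    have "(g has_derivative frechet_derivative g (at (?y t))) (at (?y t))"
      using bspec[OF gd T(2)[OF that]] by (simp add: frechet_derivative_works)
    from diff_chain_at[OF flow_chart_derivative[OF pA a(1) T(1)[OF that], unfolded has_vector_derivative_def] this]
    show ?thesis by (simp add: o_def)
  qed
  have lin_g: "linear (frechet_derivative g (at (?y t)))" if "\<bar>t\<bar> < \<epsilon>" for t
    using bspec[OF gd T(2)[OF that]] by (rule linear_frechet_derivative)
  have s_der: "(s has_real_derivative s' t) (at t)" if "\<bar>t\<bar> < \<epsilon>" for t
    using has_derivative_fst[OF der[OF that]] linear_cmul[OF lin_g[OF that]]
    by (simp add: s_def[abs_def] s'_def has_field_derivative_def mult_commute_abs)
  have s_bound: "\<bar>s' t\<bar> \<le> (C / m) * \<bar>s t\<bar>" if t: "\<bar>t\<bar> < \<epsilon>" for t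
  proof -
    let ?z = "g (?y t)" and ?G = "frechet_derivative g (at (?y t)) (local_field ?a (?y t))"
    let ?u = "snd ?z"
    have uc: "?u \<in> common p" using Uc(1)[OF z_K(2)[OF t]] .
    note lin = local_lee_linear[OF a(1) incl_in_chart[OF p uc]]
    have "((\<lambda>t. snd (g (?y t))) has_derivative (\<lambda>d. snd (frechet_derivative g (at (?y t)) (d *\<^sub>R local_field ?a (?y t))))) (at t)"
      by (rule has_derivative_snd[OF der[OF t]])
    from diff_chain_at[OF this smooth_on_has_derivative[OF incl_smooth[OF p] uc]]
    have 1: "((\<lambda>t. incl p (snd (g (?y t))) + fst (g (?y t)) *\<^sub>R ?w) has_derivative
        (\<lambda>d. frechet_derivative (incl p) (at ?u) (snd (frechet_derivative g (at (?y t)) (d *\<^sub>R local_field ?a (?y t)))) +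
          fst (frechet_derivative g (at (?y t)) (d *\<^sub>R local_field ?a (?y t))) *\<^sub>R ?w)) (at t)"
      by (intro has_derivative_add has_derivative_scaleR_left has_derivative_fst der[OF t]) (simp add: o_def)
    have "(?y has_derivative
        (\<lambda>d. frechet_derivative (incl p) (at ?u) (snd (frechet_derivative g (at (?y t)) (d *\<^sub>R local_field ?a (?y t)))) +
          fst (frechet_derivative g (at (?y t)) (d *\<^sub>R local_field ?a (?y t))) *\<^sub>R ?w)) (at t)"
      by (rule has_derivative_transform_within_open[OF 1 open_ball[of 0 \<epsilon>]])
        (use gV T(2) t in \<open>auto simp: dist_real_def\<close>)
    from fun_cong[OF has_derivative_unique[OF this
          flow_chart_derivative[OF pA a(1) T(1)[OF t], unfolded has_vector_derivative_def]], of 1]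
    have split: "local_field ?a (?y t) = frechet_derivative (incl p) (at ?u) (snd ?G) + fst ?G *\<^sub>R ?w" by simp
    have "h ?z = local_lee ?a (incl p ?u) (local_field ?a (?y t))"
      using bspec[OF gV T(2)[OF t]] by (simp add: h_def)
    also have "\<dots> = local_lee ?a (incl p ?u) (frechet_derivative (incl p) (at ?u) (snd ?G) + fst ?G *\<^sub>R ?w)"
      by (rule arg_cong[OF split])
    also have "\<dots> = s' t * L ?u"
      unfolding linear_add[OF lin] linear_cmul[OF lin]
      by (simp add: local_lee_incl_derivative[OF p uc] s'_def L_def)
    finally have eq: "h ?z = s' t * L ?u" .
    have "\<bar>s' t\<bar> * m \<le> \<bar>s' t\<bar> * \<bar>L ?u\<bar>"
      using m(2)[of ?u] z_K(1)[OF t] by (intro mult_left_mono) auto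
    also have "\<dots> = \<bar>h ?z\<bar>" by (simp add: eq abs_mult)
    also have "\<dots> \<le> C * \<bar>s t\<bar>" using h_bound[of "s t" ?u] z_K(1)[OF t] by (simp add: s_def)
    finally show ?thesis using m(1) by (simp add: field_simps)
  qed
  have s0: "s 0 = 0"
  proof -
    have "incl p ?u0 = coord ?a p" using B_atlas b by (simp add: incl_def local_rep_apply)
    then have "g (coord ?a p) = (0, ?u0)" using bspec[OF gU U(2)] by simp
    then show ?thesis using flow_0[OF pA] by (simp add: s_def)
  qed
  show ?thesis
  proof (intro exI[of _ \<epsilon>] conjI \<epsilon>(1) allI impI)
    fix t assume t: "\<bar>t\<bar> < \<epsilon>"
    have "s t = 0" by (rule gronwall_zero[OF s_der s_bound s0 t])
    then have y: "?y t = incl p (snd (g (?y t)))" using bspec[OF gV T(2)[OF t]] by (simp add: s_def)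
    obtain x where x: "x \<in> chart_domain ?b" "x \<in> chart_domain ?a" "incl p (snd (g (?y t))) = coord ?a x"
      using commonE[OF p Uc(1)[OF z_K(2)[OF t]]] by metis
    have "\<phi> t p = x" using y x T(1)[OF t] chart_inv_coord[OF atlas(1) a(1)] by metis
    then show "\<phi> t p \<in> points B" using chart_domain_points[OF b(1) x(1)] by simp
  qed
qed

end

context closed_leaf
begin

text \<open>The set of times at which an orbit is in the leaf is open by the previous lemma, and closed because the leaf is closed in
the invariant set \<open>{H \<noteq> 0}\<close>.\<close>

lemma flow_invariant:
  assumes x: "x \<in> points B"
  shows "\<phi> t x \<in> points B"
proof -
  let ?T = "{t. \<phi> t x \<in> points B}"
  note xA = points_B[OF x]
  have "open ?T"
    unfolding open_dist
  proof
    fix t0 assume "t0 \<in> ?T"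
    then obtain \<epsilon> where \<epsilon>: "\<epsilon> > 0" "\<forall>t. \<bar>t\<bar> < \<epsilon> \<longrightarrow> \<phi> t (\<phi> t0 x) \<in> points B"
      using flow_stays_locally by auto
    have "t \<in> ?T" if "dist t t0 < \<epsilon>" for t
      using \<epsilon>(2)[rule_format, of "t - t0"] flow_add[OF xA, of "t - t0" t0] that by (simp add: dist_real_def)
    then show "\<exists>e>0. \<forall>y. dist y t0 < e \<longrightarrow> y \<in> ?T" using \<epsilon>(1) by blast
  qed
  moreover have "closed ?T"
  proof -
    let ?Y = "subtopology (atlas_topology A) {x \<in> points A. H x \<noteq> 0}"
    have "closedin ?Y ((\<lambda>x. x) ` points B)"
      using proper closedin_topspace[of "atlas_topology B"]
      unfolding proper_map_def closed_map_def topspace_atlas[OF B_atlas(1)] by blast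
    then have "closedin ?Y (points B)" by simp
    then have "openin ?Y (topspace ?Y - points B)" by (rule openin_diff[OF openin_topspace])
    then obtain Q where Q: "atlas_open A Q" "topspace ?Y - points B = Q \<inter> {x \<in> points A. H x \<noteq> 0}"
      by (auto simp: openin_subtopology openin_atlas_topology[OF atlas(1)])
    have "topspace ?Y = {x \<in> points A. H x \<noteq> 0}"
      by (auto simp: topspace_subtopology topspace_atlas[OF atlas(1)])
    moreover have "\<phi> t x \<in> {x \<in> points A. H x \<noteq> 0}" for t
      using flow_points[OF xA] H_along_flow[OF xA] nonzero x by auto
    ultimately have "- ?T = {t. \<phi> t x \<in> Q}" using Q(2) by blast
    then show ?thesis using open_orbit_preimage[OF xA Q(1)] by (simp add: closed_def)
  qed
  ultimately have "closed ?T \<and> open ?T" by (rule conjI[rotated])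
  then have "?T = {} \<or> ?T = UNIV" by (simp only: clopen)
  moreover have "0 \<in> ?T" using x flow_0[OF xA] by simp
  ultimately show ?thesis by blast
qed

lemma flow_to_ambient: "differentiable_map B A (\<lambda>x. \<phi> t x)"
  by (rule differentiable_map_compose[OF B_atlas(1) atlas(1) atlas(1) inclusion differentiable_flow])

text \<open>The representative of the flow in charts of the leaf is the \<open>u\<close>-component, in transversal coordinates around the image
point, of its representative with values in \<open>M\<close>.\<close>

lemma flow_differentiable_leaf: "differentiable_map B B (\<phi> t)"
  unfolding differentiable_map_def
proof (intro conjI ballI impI)
  show "\<phi> t \<in> points B \<rightarrow> points B" using flow_invariant by blast
  fix c d assume c: "c \<in> B" and d: "d \<in> B"
  obtain Q where Q: "atlas_open A Q" "chart_domain d = Q \<inter> points B"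
    using embedded_topology[OF atlas_open_chart_domain[OF B_atlas(1) d]] .
  have "openin (atlas_topology B) {x \<in> topspace (atlas_topology B). \<phi> t x \<in> Q}"
    by (rule openin_continuous_map_preimage[OF differentiable_map_imp_continuous_map[OF B_atlas(1) atlas(1) flow_to_ambient]])
      (simp add: openin_atlas_topology[OF atlas(1)] Q(1))
  then have "atlas_open B {x \<in> points B. \<phi> t x \<in> Q}"
    by (simp add: openin_atlas_topology[OF B_atlas(1)] topspace_atlas[OF B_atlas(1)])
  from atlas_open_Int_chart_image[OF B_atlas(1) this c]
  have "open (coord c ` {x \<in> chart_domain c. x \<in> {x \<in> points B. \<phi> t x \<in> Q}})" .
  also have "{x \<in> chart_domain c. x \<in> {x \<in> points B. \<phi> t x \<in> Q}} = {x \<in> chart_domain c. \<phi> t x \<in> chart_domain d}"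
    using chart_domain_points[OF c] flow_invariant Q(2) by blast
  finally show W: "open (coord c ` {x \<in> chart_domain c. \<phi> t x \<in> chart_domain d})" .
  fix x assume x: "x \<in> chart_domain c" "\<phi> t x \<in> chart_domain d"
  let ?p = "\<phi> t x"
  have p: "?p \<in> points B" using flow_invariant chart_domain_points[OF c x(1)] by blast
  let ?a = "chart_at A ?p" and ?b = "chart_at B ?p"
  note a = ambient_chart[OF p] and b = leaf_chart[OF p]
  obtain U V g where U: "open U" "(0 :: real, coord ?b ?p) \<in> U" "U \<subseteq> UNIV \<times> leaf_nbhd ?p"
    and V: "open V" "V \<subseteq> coord ?a ` chart_domain ?a" "coord ?a ?p \<in> V"
    and gU: "\<forall>z\<in>U. incl ?p (snd z) + fst z *\<^sub>R transversal ?p \<in> V \<and> g (incl ?p (snd z) + fst z *\<^sub>R transversal ?p) = z"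
    and gV: "\<forall>y\<in>V. g y \<in> U \<and> incl ?p (snd (g y)) + fst (g y) *\<^sub>R transversal ?p = y"
    and gd: "\<forall>y\<in>V. g differentiable (at y)"
    using slice[OF p] .
  obtain V1 where V1: "open V1" "coord ?a ?p \<in> V1"
    "\<forall>x\<in>points B. x \<in> chart_domain ?a \<longrightarrow> coord ?a x \<in> V1 \<longrightarrow> x \<in> chart_domain ?b \<and> (0, coord ?b x) \<in> U"
    using plaque[OF p U(1,2)] .
  let ?f = "local_rep c (\<phi> t) ?a" and ?u = "coord c x"
  let ?Wa = "coord c ` {x \<in> chart_domain c. \<phi> t x \<in> chart_domain ?a}"
  note fd = differentiable_mapD[OF flow_to_ambient c a(1)]
  have fu: "?f ?u = coord ?a ?p" using B_atlas c x by (simp add: local_rep_apply)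
  have "continuous_on ?Wa ?f"
    using fd(2) by (intro continuous_at_imp_continuous_on) (auto dest: has_derivative_continuous)
  then have "open (?Wa \<inter> ?f -` V1)" using fd(1) V1(1) by (rule continuous_open_preimage)
  then have O: "open (?Wa \<inter> ?f -` V1 \<inter> coord c ` {x \<in> chart_domain c. \<phi> t x \<in> chart_domain d})"
    using W by (rule open_Int)
  have u: "?u \<in> ?Wa \<inter> ?f -` V1 \<inter> coord c ` {x \<in> chart_domain c. \<phi> t x \<in> chart_domain d}"
    using x a V1(2) fu by auto
  have g: "(g has_derivative frechet_derivative g (at (?f ?u))) (at (?f ?u))"
    using bspec[OF gd V(3)] by (simp add: fu frechet_derivative_works)
  have "((\<lambda>u. snd (g (?f u))) has_derivative
      (\<lambda>v. snd (frechet_derivative g (at (?f ?u)) (rep_deriv c (\<phi> t) ?a x v)))) (at ?u)"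
    using has_derivative_snd[OF diff_chain_at[OF fd(2)[OF x(1) a(2)] g]] by (simp add: o_def)
  moreover have g_eq: "snd (g (coord ?a y)) = coord ?b y \<and> y \<in> chart_domain ?b"
    if "y \<in> points B" "y \<in> chart_domain ?a" "coord ?a y \<in> V1" for y
  proof -
    have y: "y \<in> chart_domain ?b" "(0, coord ?b y) \<in> U" using V1(3) that by auto
    have "incl ?p (coord ?b y) = coord ?a y" using B_atlas b y by (simp add: incl_def local_rep_apply)
    then show ?thesis using bspec[OF gU y(2)] y(1) by simp
  qed
  moreover have "snd (g (?f ?u)) = coord ?b ?p" using g_eq[OF p a(2) V1(2)] fu by simp
  ultimately have "((local_rep ?b (\<lambda>x. x) d \<circ> (\<lambda>u. snd (g (?f u)))) has_derivative
      (rep_deriv ?b (\<lambda>x. x) d ?p \<circ> (\<lambda>v. snd (frechet_derivative g (at (?f ?u)) (rep_deriv c (\<phi> t) ?a x v))))) (at ?u)"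
    using differentiable_mapD(2)[OF differentiable_map_ident[OF B_atlas(1)] b(1) d b(2) x(2)]
    by (intro diff_chain_at) simp_all
  then have "(local_rep c (\<phi> t) d has_derivative
      (rep_deriv ?b (\<lambda>x. x) d ?p \<circ> (\<lambda>v. snd (frechet_derivative g (at (?f ?u)) (rep_deriv c (\<phi> t) ?a x v))))) (at ?u)"
  proof (rule has_derivative_transform_within_open[OF _ O u])
    fix v assume v: "v \<in> ?Wa \<inter> ?f -` V1 \<inter> coord c ` {x \<in> chart_domain c. \<phi> t x \<in> chart_domain d}"
    then obtain y where y: "y \<in> chart_domain c" "\<phi> t y \<in> chart_domain ?a" "v = coord c y" by auto
    have inv: "chart_inv c v = y" using B_atlas c y by simp
    have "\<phi> t y \<in> points B" using flow_invariant chart_domain_points[OF c y(1)] by blast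
    moreover have "coord ?a (\<phi> t y) \<in> V1" using v by (simp add: local_rep_apply inv)
    ultimately show "(local_rep ?b (\<lambda>x. x) d \<circ> (\<lambda>u. snd (g (?f u)))) v = local_rep c (\<phi> t) d v"
      using g_eq[of "\<phi> t y"] y(2) B_atlas b by (simp add: local_rep_apply inv)
  qed
  then show "local_rep c (\<phi> t) d differentiable (at ?u)" by (auto simp: differentiable_def)
qed

section \<open>Volume and compactness on the leaf\<close>

text \<open>In the frames of \<open>p\<close> and \<open>q\<close> the derivative of the flow is block triangular: it maps leaf vectors by \<open>D\<close>, and it maps the
transversal vector of \<open>p\<close> to \<open>c\<close> times that of \<open>q\<close> plus a vector \<open>v\<^sub>0\<close> tangent to the leaf. The factor \<open>c\<close> is read off from the
scaling of \<open>dH - H\<eta>\<close>, and the determinant of the whole matrix from the scaling of \<open>\<omega>\<close>. The exponent is the exponent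
for \<open>M\<close> less \<open>2\<close>, the contribution of \<open>c\<^sup>2\<close>.\<close>

lemma leaf_jacobian:
  assumes p: "p \<in> points B" and q: "q \<in> points B"
    and x: "x \<in> chart_domain (chart_at B p)" "coord (chart_at B p) x \<in> leaf_nbhd p"
    and x': "\<phi> t x \<in> chart_domain (chart_at B q)" "coord (chart_at B q) (\<phi> t x) \<in> leaf_nbhd q"
  shows "(ldet (rep_deriv (chart_at B p) (\<phi> t) (chart_at B q) x))\<^sup>2 * leaf_density q (coord (chart_at B q) (\<phi> t x)) =
    exp ((real CARD((real \<times> 'f) basis_index) - 2) * r t x) * leaf_density p (coord (chart_at B p) x)"
proof -
  let ?ap = "chart_at A p" and ?aq = "chart_at A q" and ?bp = "chart_at B p" and ?bq = "chart_at B q"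
  let ?x' = "\<phi> t x"
  let ?u = "coord ?bp x" and ?u' = "coord ?bq ?x'"
  note ap = ambient_chart[OF p] and aq = ambient_chart[OF q] and bp = leaf_chart[OF p] and bq = leaf_chart[OF q]
  have uc: "?u \<in> common p" and lp: "local_lee ?ap (incl p ?u) (transversal p) \<noteq> 0"
    and uc': "?u' \<in> common q" and lq: "local_lee ?aq (incl q ?u') (transversal q) \<noteq> 0"
    using x(2) x'(2) by (auto simp: leaf_nbhd_def)
  obtain z where "z \<in> chart_domain ?bp" "z \<in> chart_domain ?ap" "chart_inv ?bp ?u = z" "incl p ?u = coord ?ap z"
    "frechet_derivative (incl p) (at ?u) = rep_deriv ?bp (\<lambda>x. x) ?ap z"
    using commonE[OF p uc] by metis
  then have xa: "x \<in> chart_domain ?ap" and ix: "incl p ?u = coord ?ap x"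
    and dx: "frechet_derivative (incl p) (at ?u) = rep_deriv ?bp (\<lambda>x. x) ?ap x"
    using B_atlas bp x(1) by auto
  obtain z where "z \<in> chart_domain ?bq" "z \<in> chart_domain ?aq" "chart_inv ?bq ?u' = z" "incl q ?u' = coord ?aq z"
    "frechet_derivative (incl q) (at ?u') = rep_deriv ?bq (\<lambda>x. x) ?aq z"
    using commonE[OF q uc'] by metis
  then have xa': "?x' \<in> chart_domain ?aq" and ix': "incl q ?u' = coord ?aq ?x'"
    and dx': "frechet_derivative (incl q) (at ?u') = rep_deriv ?bq (\<lambda>x. x) ?aq ?x'"
    using B_atlas bq x'(1) by auto
  let ?D = "rep_deriv ?bp (\<phi> t) ?bq x" and ?E = "rep_deriv ?ap (\<phi> t) ?aq x"
  let ?lp = "local_lee ?ap (incl p ?u)" and ?lq = "local_lee ?aq (incl q ?u')"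
  have linD: "linear ?D" by (rule linear_rep_deriv[OF flow_differentiable_leaf bp(1) bq(1) x(1) x'(1)])
  have linE: "linear ?E" by (rule linear_rep_deriv[OF differentiable_flow ap(1) aq(1) xa xa'])
  have chain: "?E (frechet_derivative (incl p) (at ?u) v) = frechet_derivative (incl q) (at ?u') (?D v)" for v
    using rep_deriv_compose[OF B_atlas(1) atlas(1) inclusion differentiable_flow bp(1) x(1) ap(1) xa aq(1) xa', of v]
      rep_deriv_compose[OF B_atlas(1) B_atlas(1) flow_differentiable_leaf inclusion bp(1) x(1) bq(1) x'(1) aq(1) xa', of v]
    by (simp add: dx dx')
  have lee: "?lq (?E v) = exp (r t x) * ?lp v" for v
    unfolding ix ix' local_lee_eq[OF ap(1) xa] local_lee_eq[OF aq(1) xa']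
    using tangent_map_tangent_of_coords[OF atlas(1) atlas(1) differentiable_flow ap(1) xa aq(1) xa', of v]
      pullback_lee_d_H[OF chart_domain_points[OF ap(1) xa], of t "tangent_of_coords A ?ap x v"]
    by simp
  note linq = local_lee_linear[OF aq(1) incl_in_chart[OF q uc']]
  define c where "c = exp (r t x) * ?lp (transversal p) / ?lq (transversal q)"
  have "?lq (?E (transversal p) - c *\<^sub>R transversal q) = 0"
    using lq by (simp add: linear_diff[OF linq] linear_cmul[OF linq] lee c_def)
  then obtain v0 where v0: "?E (transversal p) - c *\<^sub>R transversal q = frechet_derivative (incl q) (at ?u') v0"
    using range_incl_derivative(1)[OF q uc'] by blast
  let ?M = "\<lambda>(s :: real, v). (c * s, ?D v + s *\<^sub>R v0)"
  have frame: "?E (frame p ?u z) = frame q ?u' (?M z)" for z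
  proof -
    have "?E (transversal p) = c *\<^sub>R transversal q + frechet_derivative (incl q) (at ?u') v0" using v0 by (simp add: algebra_simps)
    then show ?thesis
      using linear_incl_derivative[OF q uc']
      by (simp add: frame_def split_def linear_add[OF linE] linear_cmul[OF linE] chain linear_add linear_cmul algebra_simps)
  qed
  have linM: "linear ?M"
    using linD by (auto intro!: linearI simp: linear_add linear_cmul algebra_simps)
  let ?gp = "gram (\<lambda>z z'. local2 A \<omega> ?ap (incl p ?u) (frame p ?u z) (frame p ?u z'))"
  let ?gq = "gram (\<lambda>z z'. local2 A \<omega> ?aq (incl q ?u') (frame q ?u' z) (frame q ?u' z'))"
  let ?n = "CARD((real \<times> 'f) basis_index)"
  have "(ldet ?M)\<^sup>2 * ?gq = gram (\<lambda>z z'. exp (r t x) * local2 A \<omega> ?ap (incl p ?u) (frame p ?u z) (frame p ?u z'))"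
    using gram_compose[OF frame_form_bilinear[OF q uc'] linM]
    unfolding frame[symmetric] ix ix' by (simp add: pullback_local2[OF ap(1) xa aq(1) xa'])
  also have "\<dots> = exp (r t x) ^ ?n * ?gp" by (rule gram_scale)
  finally have "\<bar>(ldet ?M)\<^sup>2 * ?gq\<bar> = \<bar>exp (r t x) ^ ?n * ?gp\<bar>" by simp
  moreover have "(ldet ?M)\<^sup>2 = c\<^sup>2 * (ldet ?D)\<^sup>2"
    using arg_cong[OF abs_ldet_block_triangular[OF linD, of c v0], of "\<lambda>y. y\<^sup>2"] by (simp add: power_mult_distrib)
  ultimately have "c\<^sup>2 * (ldet ?D)\<^sup>2 * \<bar>?gq\<bar> = exp (r t x) ^ ?n * \<bar>?gp\<bar>"
    by (simp add: abs_mult)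
  then have "(exp (r t x))\<^sup>2 * (?lp (transversal p))\<^sup>2 * (ldet ?D)\<^sup>2 * \<bar>?gq\<bar> =
      exp (r t x) ^ ?n * \<bar>?gp\<bar> * (?lq (transversal q))\<^sup>2"
    using lq by (simp add: c_def power_divide power_mult_distrib field_simps)
  then have "(ldet ?D)\<^sup>2 * \<bar>?gq\<bar> / (?lq (transversal q))\<^sup>2 = exp (r t x) ^ ?n / (exp (r t x))\<^sup>2 * (\<bar>?gp\<bar> / (?lp (transversal p))\<^sup>2)"
    using lp lq by (simp add: field_simps)
  moreover have "exp (r t x) ^ ?n / (exp (r t x))\<^sup>2 = exp ((real ?n - 2) * r t x)"
    by (simp add: exp_of_nat_mult[symmetric] exp_diff[symmetric] left_diff_distrib power2_eq_square exp_add[symmetric])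
  ultimately show ?thesis by (simp add: leaf_density_def)
qed

lemma leaf_exhaustion:
  assumes p: "p \<in> points B"
  shows "\<exists>U K. atlas_open B U \<and> p \<in> U \<and> compactin (atlas_topology B) K \<and>
    (\<forall>x\<in>U. \<forall>t. \<bar>r t x\<bar> \<le> L \<longrightarrow> \<phi> t x \<in> K)"
proof -
  define \<delta> where "\<delta> = \<bar>H p\<bar> / 2"
  have \<delta>: "\<delta> > 0" using nonzero p by (auto simp: \<delta>_def)
  have contH: "continuous_map (atlas_topology A) euclidean H"
  proof (rule continuous_map_atlas_real[OF atlas(1)])
    fix c assume "c \<in> A"
    from smooth_on_continuous[OF smooth_local_H[OF this]]
    show "continuous_on (coord c ` chart_domain c) (H \<circ> chart_inv c)"
      by (simp add: local_H_def[abs_def] o_def)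
  qed
  have contHB: "continuous_map (atlas_topology B) euclidean H"
    using continuous_map_compose[OF differentiable_map_imp_continuous_map[OF B_atlas(1) atlas(1) inclusion] contH]
    by (simp add: o_def)
  let ?U = "{x \<in> points B. H x \<in> {y. \<bar>y\<bar> > \<delta>}}"
  let ?KA = "{x \<in> points A. H x \<in> {y. \<bar>y\<bar> \<ge> \<delta> * exp (- L)}}"
  let ?K = "{x \<in> points B. x \<in> ?KA}"
  have "openin (atlas_topology B) {x \<in> topspace (atlas_topology B). H x \<in> {y. \<bar>y\<bar> > \<delta>}}"
    by (rule openin_continuous_map_preimage[OF contHB]) (auto intro!: open_Collect_less continuous_intros)
  then have U: "atlas_open B ?U"
    by (simp add: openin_atlas_topology[OF B_atlas(1)] topspace_atlas[OF B_atlas(1)])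
  have "closedin (atlas_topology A) {x \<in> topspace (atlas_topology A). H x \<in> {y. \<bar>y\<bar> \<ge> \<delta> * exp (- L)}}"
    by (rule closedin_continuous_map_preimage[OF contH]) (auto intro!: closed_Collect_le continuous_intros)
  then have "compactin (atlas_topology A) ?KA"
    using compact closedin_compact_space by (simp add: topspace_atlas[OF atlas(1)])
  moreover have "?KA \<subseteq> {x \<in> points A. H x \<noteq> 0}"
  proof
    fix x assume x: "x \<in> ?KA"
    have "\<delta> * exp (- L) > 0" using \<delta> by simp
    then show "x \<in> {x \<in> points A. H x \<noteq> 0}" using x by auto
  qed
  ultimately have "compactin (subtopology (atlas_topology A) {x \<in> points A. H x \<noteq> 0}) ?KA"
    by (simp add: compactin_subtopology)
  from compactin_proper_map_preimage[OF proper this] have K: "compactin (atlas_topology B) ?K"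
    by (simp only: topspace_atlas[OF B_atlas(1)])
  have "\<phi> t x \<in> ?K" if x: "x \<in> ?U" and r: "\<bar>r t x\<bar> \<le> L" for x t
  proof -
    have xB: "x \<in> points B" using x by simp
    note xA = points_B[OF xB]
    have "\<delta> * exp (- L) \<le> \<bar>H x\<bar> * exp (r t x)"
      using x r \<delta> by (intro mult_mono) auto
    also have "\<dots> = \<bar>H (\<phi> t x)\<bar>" by (simp add: H_along_flow[OF xA] abs_mult)
    finally show ?thesis using flow_invariant[OF xB] flow_points[OF xA] by simp
  qed
  moreover have "p \<in> ?U" using p \<delta> by (simp add: \<delta>_def)
  ultimately show ?thesis using U K by blast
qed

lemma scaling_flow_leaf:
  "scaling_flow B \<phi> r leaf_nbhd leaf_density (real CARD((real \<times> 'f) basis_index) - 2)"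
proof
  show "continuous_on (coord c ` chart_domain c) (r t \<circ> chart_inv c)" if "c \<in> B" for t c
  proof (rule continuous_map_atlas_chart[OF B_atlas(1) _ that])
    from continuous_map_compose[OF differentiable_map_imp_continuous_map[OF B_atlas(1) atlas(1) inclusion]
        continuous_map_atlas_real[OF atlas(1) winding_continuous]]
    show "continuous_map (atlas_topology B) euclidean (r t)" by (simp add: o_def)
  qed
  show "leaf_nbhd p \<subseteq> coord (chart_at B p) ` chart_domain (chart_at B p)" if "p \<in> points B" for p
    by (auto simp: leaf_nbhd_def common_def)
qed (use B_atlas flow_0 flow_add points_B flow_differentiable_leaf winding_add open_leaf_nbhd base_in_leaf_nbhd
    leaf_density_continuous leaf_density_pos leaf_jacobian leaf_exhaustion in auto)

theorem zero_volume_leaf: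
  "zero_volume B
     (((pos_conservative A \<eta> X \<phi> \<inter> points B) - (neg_conservative A \<eta> X \<phi> \<inter> points B)) \<union>
      ((neg_conservative A \<eta> X \<phi> \<inter> points B) - (pos_conservative A \<eta> X \<phi> \<inter> points B)))"
  by (rule zero_volume_subset[OF scaling_flow.zero_volume_escape_times_differ[OF scaling_flow_leaf]])
    (auto simp: pos_conservative_iff neg_conservative_iff points_B)

end

theorem (in closed_hamiltonian_flow) zero_volume_ambient:
  "zero_volume A
     ((pos_conservative A \<eta> X \<phi> - neg_conservative A \<eta> X \<phi>) \<union>
      (neg_conservative A \<eta> X \<phi> - pos_conservative A \<eta> X \<phi>))"
proof (rule zero_volume_subset[OF scaling_flow.zero_volume_escape_times_differ[OF scaling_flow_ambient]])
  have "pos_conservative A \<eta> X \<phi> \<subseteq> points A" "neg_conservative A \<eta> X \<phi> \<subseteq> points A"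
    by (auto simp: pos_conservative_def neg_conservative_def)
  then show "(pos_conservative A \<eta> X \<phi> - neg_conservative A \<eta> X \<phi>) \<union>
      (neg_conservative A \<eta> X \<phi> - pos_conservative A \<eta> X \<phi>) \<subseteq>
    {x \<in> points A. filterlim (\<lambda>k. \<bar>r (real k) x\<bar>) at_top sequentially \<noteq>
      filterlim (\<lambda>k. \<bar>r (- real k) x\<bar>) at_top sequentially}"
    using pos_conservative_iff neg_conservative_iff by blast
qed

theorem proposition10:
  fixes A :: "('m, 'e::euclidean_space) atlas"
    and \<eta> :: "('m, 'e) form1"
    and \<omega> :: "('m, 'e) form2"
    and H :: "'m \<Rightarrow> real"
    and X :: "'m \<Rightarrow> 'e"
    and \<phi> :: "real \<Rightarrow> 'm \<Rightarrow> 'm"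
    and n :: nat
  assumes "closed_manifold A"
    and "DIM('e) = 2 * n"
    and "DIM('f::euclidean_space) = 2 * n - 1"
    and "conformal_symplectic A \<eta> \<omega>"
    and "smooth_map A real_atlas H"
    and "hamiltonian_vector_field A \<eta> \<omega> H X"
    and "flow_of A X \<phi>"
  shows "zero_volume A
           ((pos_conservative A \<eta> X \<phi> - neg_conservative A \<eta> X \<phi>) \<union>
            (neg_conservative A \<eta> X \<phi> - pos_conservative A \<eta> X \<phi>)) \<and>
         (\<forall>\<Sigma> :: ('m, 'f) atlas.
            embedded_leaf A \<eta> H \<Sigma> \<and>
            points \<Sigma> \<subseteq> {x \<in> points A. H x \<noteq> 0} \<and>
            proper_map (atlas_topology \<Sigma>)
              (subtopology (atlas_topology A) {x \<in> points A. H x \<noteq> 0}) (\<lambda>x. x) \<longrightarrow>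
            zero_volume \<Sigma>
              (((pos_conservative A \<eta> X \<phi> \<inter> points \<Sigma>) - (neg_conservative A \<eta> X \<phi> \<inter> points \<Sigma>)) \<union>
               ((neg_conservative A \<eta> X \<phi> \<inter> points \<Sigma>) - (pos_conservative A \<eta> X \<phi> \<inter> points \<Sigma>))))"
proof -
  interpret closed_hamiltonian_flow A \<eta> \<omega> H X \<phi>
    using assms by unfold_locales (auto simp: closed_manifold_def)
  have dim: "DIM('e) = DIM('f) + 1"
    using assms(2,3) DIM_positive[where 'a = 'e] by linarith
  have "zero_volume \<Sigma>
      (((pos_conservative A \<eta> X \<phi> \<inter> points \<Sigma>) - (neg_conservative A \<eta> X \<phi> \<inter> points \<Sigma>)) \<union>
       ((neg_conservative A \<eta> X \<phi> \<inter> points \<Sigma>) - (pos_conservative A \<eta> X \<phi> \<inter> points \<Sigma>)))"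
    if "embedded_leaf A \<eta> H \<Sigma>" "points \<Sigma> \<subseteq> {x \<in> points A. H x \<noteq> 0}"
      "proper_map (atlas_topology \<Sigma>) (subtopology (atlas_topology A) {x \<in> points A. H x \<noteq> 0}) (\<lambda>x. x)"
    for \<Sigma> :: "('m, 'f) atlas"
  proof -
    interpret closed_leaf A \<eta> \<omega> H X \<phi> \<Sigma>
      by unfold_locales (use dim that in auto)
    show ?thesis by (rule zero_volume_leaf)
  qed
  then show ?thesis using zero_volume_ambient by blast
qed

end
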